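(* Let $l\ge2$. The graded dimension $\chi_0(x_1,\dots,x_l;q)$ of the principal subspace $W(\Lambda_0)$ satisfies the following recursions: $$\chi_0(x_1,\dots,x_l;q)=\chi_0(x_1q,x_2,x_3,\dots,x_l;q)+x_1q\,\chi_0(x_1q^2,x_2q^{-1},x_3,\dots,x_l;q),$$ $$\chi_0(x_1,\dots,x_l;q)=\chi_0(x_1,x_2q,x_3,\dots,x_l;q)+x_2q\,\chi_0(x_1q^{-1},x_2q^2,x_3q^{-1},\dots,x_l;q),$$ $$\vdots$$ $$\chi_0(x_1,\dots,x_l;q)=\chi_0(x_1,x_2,\dots,x_lq;q)+x_lq\,\chi_0(x_1,x_2,\dots,x_{l-1}q^{-1},x_lq^2;q).$$ That is, for every $j=1,\dots,l$, $$\chi_0(x_1,\dots,x_l;q)=\chi_0(x_1,\dots,x_jq,\dots,x_l;q)+x_jq\,\chi_0(x_1q^{a_{j1}},\dots,x_lq^{a_{jl}};q),$$ where $a_{jj}=2$, $a_{ji}=-1$ if $|i-j|=1$, and $a_{ji}=0$ otherwise.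
   Context: Let $\mathfrak g=\mathfrak{sl}(l+1,\mathbb C)$ with Cartan subalgebra $\mathfrak h$ of diagonal matrices, simple roots $\alpha_1,\dots,\alpha_l$ labelled along the Dynkin diagram, positive roots $\Delta_+$, root vectors $x_\alpha$, invariant form $\langle\cdot,\cdot\rangle$ with $\langle\alpha_i,\alpha_i\rangle=2$ (identifying $\mathfrak h\simeq\mathfrak h^*$), and fundamental weights $\lambda_1,\dots,\lambda_l$. $\widehat{\mathfrak g}=\mathfrak g\otimes\mathbb C[t,t^{-1}]\oplus\mathbb Cc$ with $c$ central and $[x\otimes t^m,y\otimes t^n]=[x,y]\otimes t^{m+n}+m\langle x,y\rangle\delta_{m+n,0}c$; $x(m)=x\otimes t^m$. $L(\Lambda_0)$ is the level $1$ standard (irreducible integrable highest weight) $\widehat{\mathfrak g}$-module with highest weight vector $v_{\Lambda_0}$ annihilated by $\mathfrak g\otimes\mathbb C[t]$, with $c$ acting as $1$. Let $\mathfrak n=\sum_{\alpha\in\Delta_+}\mathbb Cx_\alpha$, $\bar{\mathfrak n}=\mathfrak n\otimes\mathbb C[t,t^{-1}]$, and $W(\Lambda_0)=U(\bar{\mathfrak n})\cdot v_{\Lambda_0}$ (the principal subspace). Gradings: $W(\Lambda_0)$ is graded by weight (eigenvalues of the Virasoro operator $L(0)$) and by $l$ charges (eigenvalues of $\lambda_j(0)$, $1\le j\le l$, i.e. of $\lambda_j\in\mathfrak h$ acting as $\lambda_j\otimes t^0$). Explicitly, a vector $x_{\gamma_1}(m_1)\cdots x_{\gamma_s}(m_s)\cdot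 v_{\Lambda_0}$ with $\gamma_i\in\Delta_+$ has weight $-(m_1+\cdots+m_s)$ and $\lambda_j$-charge $\sum_i\langle\lambda_j,\gamma_i\rangle$. The graded dimension is $$\chi_0(x_1,\dots,x_l;q)=\mathrm{tr}|_{W(\Lambda_0)}x_1^{\lambda_1}\cdots x_l^{\lambda_l}q^{L(0)}=\sum_{r_1,\dots,r_l,k\ge0}\dim W(\Lambda_0)_{r_1,\dots,r_l;k}\,x_1^{r_1}\cdots x_l^{r_l}q^k,$$ where $W(\Lambda_0)_{r_1,\dots,r_l;k}$ is the subspace of charges $r_1,\dots,r_l$ and weight $k$. The variables are formal, and the identities are between formal series in $x_1,\dots,x_l$ whose coefficients are formal Laurent series in $q$. *)

theory Defs
  imports
    "Jordan_Normal_Form.Matrix"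
    "HOL-Computational_Algebra.Formal_Laurent_Series"
    "HOL-Library.Groups_Big_Fun"
begin

section \<open>The Lie algebra \<open>sl(l+1)\<close>\<close>

text \<open>
  Matrix rows and columns are numbered from \<open>0\<close> to \<open>l\<close>, whereas simple roots, fundamental weights
  and formal variables are numbered from \<open>1\<close> to \<open>l\<close>. The form \<open>trace (x * y)\<close> identifies the
  diagonal subalgebra with its dual.
\<close>

definition mat_trace :: "complex mat \<Rightarrow> complex" where
  "mat_trace A = (\<Sum>i<dim_row A. A $$ (i, i))"

definition sl_carrier :: "nat \<Rightarrow> complex mat set" where
  "sl_carrier l = {A \<in> carrier_mat (l + 1) (l + 1). mat_trace A = 0}"

definition mat_bracket :: "complex mat \<Rightarrow> complex mat \<Rightarrow> complex mat" where
  "mat_bracket A B = A * B - B * A"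

definition inv_form :: "complex mat \<Rightarrow> complex mat \<Rightarrow> complex" where
  "inv_form A B = mat_trace (A * B)"

text \<open>
  For \<open>a \<noteq> b\<close>, \<open>root_vec l a b\<close> is the root vector of the root \<open>\<epsilon>\<^sub>a - \<epsilon>\<^sub>b\<close>, which is positive iff
  \<open>a < b\<close>.
\<close>

definition root_vec :: "nat \<Rightarrow> nat \<Rightarrow> nat \<Rightarrow> complex mat" where
  "root_vec l a b = mat (l + 1) (l + 1) (\<lambda>(i, j). if i = a \<and> j = b then 1 else 0)"

definition simple_root :: "nat \<Rightarrow> nat \<Rightarrow> complex mat" where
  "simple_root l i = root_vec l (i - 1) (i - 1) - root_vec l i i"

definition fund_weight :: "nat \<Rightarrow> nat \<Rightarrow> complex mat" where
  "fund_weight l j = mat (l + 1) (l + 1) (\<lambda>(a, b).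
     if a = b then (if a < j then 1 else 0) - of_nat j / of_nat (l + 1) else 0)"

lemma inv_form_simple_root:
  assumes "H \<in> carrier_mat (l + 1) (l + 1)" and "i \<in> {1..l}"
  shows "inv_form H (simple_root l i) = H $$ (i - 1, i - 1) - H $$ (i, i)"
proof -
  have "i - 1 < l + 1"
    using assms by auto
  have diag: "(H * simple_root l i) $$ (a, a)
      = (if a = i - 1 then H $$ (i - 1, i - 1) else 0) - (if a = i then H $$ (i, i) else 0)"
    if "a < l + 1" for a
  proof -
    have "(H * simple_root l i) $$ (a, a)
        = (\<Sum>b = 0..<l + 1. H $$ (a, b) *
            ((if b = i - 1 \<and> a = i - 1 then 1 else 0) - (if b = i \<and> a = i then 1 else 0)))"
      using assms that by (simp add: scalar_prod_def simple_root_def root_vec_def)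
    also have "\<dots> = (\<Sum>b = 0..<l + 1.
            (if b = i - 1 then (if a = i - 1 then H $$ (i - 1, i - 1) else 0) else 0)
            - (if b = i then (if a = i then H $$ (i, i) else 0) else 0))"
      by (intro sum.cong) auto
    also have "\<dots> = (if a = i - 1 then H $$ (i - 1, i - 1) else 0) - (if a = i then H $$ (i, i) else 0)"
      using assms \<open>i - 1 < l + 1\<close> by (simp add: sum_subtractf del: sum.op_ivl_Suc)
    finally show ?thesis .
  qed
  have "inv_form H (simple_root l i) = (\<Sum>a<l + 1. (H * simple_root l i) $$ (a, a))"
    using assms by (simp add: inv_form_def mat_trace_def simple_root_def root_vec_def)
  also have "\<dots> = (\<Sum>a<l + 1. (if a = i - 1 then H $$ (i - 1, i - 1) else 0)
      - (if a = i then H $$ (i, i) else 0))"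
    by (intro sum.cong) (auto simp: diag)
  also have "\<dots> = H $$ (i - 1, i - 1) - H $$ (i, i)"
    using assms \<open>i - 1 < l + 1\<close> by (simp add: sum_subtractf del: sum.lessThan_Suc)
  finally show ?thesis .
qed

lemma inv_form_fund_weight:
  assumes "i \<in> {1..l}" and "j \<in> {1..l}"
  shows "inv_form (fund_weight l j) (simple_root l i) = (if i = j then 1 else 0)"
  using assms by (subst inv_form_simple_root) (auto simp: fund_weight_def)

lemma inv_form_simple_root_self:
  assumes "i \<in> {1..l}"
  shows "inv_form (simple_root l i) (simple_root l i) = 2"
  using assms by (subst inv_form_simple_root) (auto simp: simple_root_def root_vec_def)

lemma fund_weight_in_sl:
  assumes "j \<in> {1..l}"
  shows "fund_weight l j \<in> sl_carrier l"
proof -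
  have "{..<l + 1} \<inter> {a. a < j} = {..<j}"
    using assms by auto
  hence "mat_trace (fund_weight l j) = of_nat j - of_nat (l + 1) * (of_nat j / of_nat (l + 1))"
    by (simp add: mat_trace_def fund_weight_def sum_subtractf sum.If_cases del: sum.lessThan_Suc of_nat_Suc)
  thus ?thesis
    by (simp add: sl_carrier_def fund_weight_def del: of_nat_Suc)
qed

definition cartan_entry :: "nat \<Rightarrow> nat \<Rightarrow> int" where
  "cartan_entry j i = (if i = j then 2 else if i = j + 1 \<or> j = i + 1 then - 1 else 0)"


section \<open>Modules for the affine Lie algebra\<close>

text \<open>
  A representation of \<open>sl(l+1) \<otimes> \<complex>[t, t\<^sup>-\<^sup>1] \<oplus> \<complex>c\<close> on the complex vector space with carrier type
  \<open>'v\<close> and scalar multiplication \<open>scale\<close>. Since the Lie algebra is the direct sum of \<open>\<complex>c\<close> and the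
  spaces \<open>sl(l+1) \<otimes> t\<^sup>m\<close>, such a representation is given by the operators \<open>X x m\<close> of \<open>x \<otimes> t\<^sup>m\<close>,
  linear in \<open>x\<close>, together with the operator \<open>C\<close> of \<open>c\<close>. The values of \<open>X\<close> outside
  \<open>sl_carrier l\<close> are irrelevant.
\<close>

locale affine_sl_module = vector_space scale
  for scale :: "complex \<Rightarrow> 'v::ab_group_add \<Rightarrow> 'v" +
  fixes l :: nat
    and X :: "complex mat \<Rightarrow> int \<Rightarrow> 'v \<Rightarrow> 'v"
    and C :: "'v \<Rightarrow> 'v"
  assumes linear_X: "x \<in> sl_carrier l \<Longrightarrow> Vector_Spaces.linear scale scale (X x m)"
    and linear_C: "Vector_Spaces.linear scale scale C"
    and X_add: "x \<in> sl_carrier l \<Longrightarrow> y \<in> sl_carrier l \<Longrightarrow> X (x + y) m w = X x m w + X y m w"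
    and X_smult: "x \<in> sl_carrier l \<Longrightarrow> X (a \<cdot>\<^sub>m x) m w = scale a (X x m w)"
    and X_bracket: "x \<in> sl_carrier l \<Longrightarrow> y \<in> sl_carrier l \<Longrightarrow>
      X x m (X y n w) - X y n (X x m w)
        = X (mat_bracket x y) (m + n) w
          + (if m + n = 0 then scale (of_int m * inv_form x y) (C w) else 0)"
    and X_central: "x \<in> sl_carrier l \<Longrightarrow> C (X x m w) = X x m (C w)"
begin

definition submodule :: "'v set \<Rightarrow> bool" where
  "submodule S \<longleftrightarrow> subspace S \<and> (\<forall>x\<in>sl_carrier l. \<forall>m. \<forall>w\<in>S. X x m w \<in> S) \<and> (\<forall>w\<in>S. C w \<in> S)"

definition irreducible_module :: bool where
  "irreducible_module \<longleftrightarrow>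
     (\<exists>w::'v. w \<noteq> 0) \<and> (\<forall>S. submodule S \<longrightarrow> S = {0} \<or> S = UNIV)"

definition locally_nilpotent :: "('v \<Rightarrow> 'v) \<Rightarrow> bool" where
  "locally_nilpotent f \<longleftrightarrow> (\<forall>w. \<exists>N. (f ^^ N) w = 0)"

text \<open>
  The module is the span of its weight vectors and the affine Chevalley generators act locally
  nilpotently; those with index \<open>0\<close> are \<open>x\<^bsub>-\<theta>\<^esub> \<otimes> t\<close> and \<open>x\<^bsub>\<theta>\<^esub> \<otimes> t\<^sup>-\<^sup>1\<close> for the highest
  root \<open>\<theta> = \<epsilon>\<^sub>0 - \<epsilon>\<^sub>l\<close>.
\<close>

definition integrable_module :: bool where
  "integrable_module \<longleftrightarrow>
     span {w. (\<exists>\<mu>. \<forall>i\<in>{1..l}. X (simple_root l i) 0 w = scale (\<mu> i) w) \<and> (\<exists>\<kappa>. C w = scale \<kappa> w)} = UNIV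
     \<and> (\<forall>i\<in>{1..l}. locally_nilpotent (X (root_vec l (i - 1) i) 0)
                  \<and> locally_nilpotent (X (root_vec l i (i - 1)) 0))
     \<and> locally_nilpotent (X (root_vec l l 0) 1)
     \<and> locally_nilpotent (X (root_vec l 0 l) (- 1))"

end


section \<open>The level one standard module and its principal subspace\<close>

locale level_one_standard_module = affine_sl_module scale l X C
  for scale :: "complex \<Rightarrow> 'v::ab_group_add \<Rightarrow> 'v"
    and l :: nat
    and X :: "complex mat \<Rightarrow> int \<Rightarrow> 'v \<Rightarrow> 'v"
    and C :: "'v \<Rightarrow> 'v" +
  fixes v :: 'v
  assumes irreducible: "irreducible_module"
    and integrable: "integrable_module"
    and hw_nonzero: "v \<noteq> 0"
    and hw_annihilated: "x \<in> sl_carrier l \<Longrightarrow> 0 \<le> m \<Longrightarrow> X x m v = 0"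
    and level_one: "C w = w"
begin

text \<open>
  A list entry \<open>((a, b), m)\<close> stands for \<open>x\<^sub>\<gamma>(m)\<close> with \<open>\<gamma> = \<epsilon>\<^sub>a - \<epsilon>\<^sub>b\<close>. The products of these
  operators with \<open>\<gamma>\<close> positive span the image of the enveloping algebra of \<open>\<nn> \<otimes> \<complex>[t, t\<^sup>-\<^sup>1]\<close>.
\<close>

definition root_monomial :: "((nat \<times> nat) \<times> int) list \<Rightarrow> 'v" where
  "root_monomial ps = foldr (\<lambda>((a, b), m) w. X (root_vec l a b) m w) ps v"

definition principal_subspace :: "'v set" where
  "principal_subspace =
     span {root_monomial ps | ps. \<forall>((a, b), m) \<in> set ps. a < b \<and> b \<le> l}"

text \<open>
  \<open>casimir_modes m\<close> is the sum of \<open>u(-m) u'(m)\<close> over dual bases \<open>u\<close>, \<open>u'\<close> of \<open>sl(l+1)\<close>; the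
  simple roots and the fundamental weights are dual bases of the Cartan subalgebra.
  \<open>virasoro_L0\<close> is the Sugawara operator \<open>L(0)\<close> at level \<open>1\<close>, with dual Coxeter number \<open>l + 1\<close>.
  On every vector \<open>w\<close> only finitely many modes \<open>m > 0\<close> contribute, so that \<^const>\<open>Sum_any\<close> is the
  actual sum.
\<close>

definition casimir_modes :: "int \<Rightarrow> 'v \<Rightarrow> 'v" where
  "casimir_modes m w =
     (\<Sum>(a, b) \<in> {(a, b). a \<le> l \<and> b \<le> l \<and> a \<noteq> b}. X (root_vec l a b) (- m) (X (root_vec l b a) m w))
     + (\<Sum>i = 1..l. X (simple_root l i) (- m) (X (fund_weight l i) m w))"

definition virasoro_L0 :: "'v \<Rightarrow> 'v" where
  "virasoro_L0 w = scale (1 / (2 * (1 + of_nat (l + 1))))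
     (casimir_modes 0 w + scale 2 (Sum_any (\<lambda>m::nat. casimir_modes (int (Suc m)) w)))"

definition graded_piece :: "(nat \<Rightarrow> nat) \<Rightarrow> nat \<Rightarrow> 'v set" where
  "graded_piece r k = {w \<in> principal_subspace.
     (\<forall>j\<in>{1..l}. X (fund_weight l j) 0 w = scale (of_nat (r j)) w)
     \<and> virasoro_L0 w = scale (of_nat k) w}"

text \<open>
  A formal series in \<open>x\<^sub>1, \<dots>, x\<^sub>l\<close> is the function mapping an exponent \<open>r\<close>, extended by \<open>0\<close> outside
  \<open>{1..l}\<close>, to the coefficient of \<open>x\<^sub>1\<^bsup>r 1\<^esup> \<cdots> x\<^sub>l\<^bsup>r l\<^esup>\<close>, a formal Laurent series in \<open>q\<close>.
\<close>

definition graded_dim :: "(nat \<Rightarrow> nat) \<Rightarrow> int fls" where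
  "graded_dim r = (if \<forall>i. i \<notin> {1..l} \<longrightarrow> r i = 0
     then fps_to_fls (Abs_fps (\<lambda>k. of_nat (dim (graded_piece r k)))) else 0)"

end


section \<open>Operations on formal series\<close>

text \<open>The series \<open>F(x\<^sub>1 q\<^bsup>e 1\<^esup>, \<dots>, x\<^sub>l q\<^bsup>e l\<^esup>; q)\<close>.\<close>

definition subst_q_powers ::
    "nat \<Rightarrow> (nat \<Rightarrow> int) \<Rightarrow> ((nat \<Rightarrow> nat) \<Rightarrow> int fls) \<Rightarrow> (nat \<Rightarrow> nat) \<Rightarrow> int fls" where
  "subst_q_powers l e F = (\<lambda>r. fls_X_intpow (\<Sum>i = 1..l. e i * int (r i)) * F r)"

text \<open>The series \<open>x\<^sub>j q F(x\<^sub>1, \<dots>, x\<^sub>l; q)\<close>.\<close>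

definition times_xq :: "nat \<Rightarrow> ((nat \<Rightarrow> nat) \<Rightarrow> int fls) \<Rightarrow> (nat \<Rightarrow> nat) \<Rightarrow> int fls" where
  "times_xq j F = (\<lambda>r. if r j = 0 then 0 else fls_X * F (r(j := r j - 1)))"

end

(*
  In an irreducible module a vector of positive weight killed by all x(1) is zero, which gives
  x_j(z)^2 v = 0 for the simple root vectors.  So every functional on W(Lambda_0), read as a
  function on words in the root vectors x_gamma(m), solves three sets of relations: commutators,
  x_gamma(m) v = 0 for m >= 0, and x_j(z)^2 v = 0.

  Two operations connect W(Lambda_0) in different degrees.  Twisting the action by the translation
  x_gamma(m) -> x_gamma(m - <gamma, alpha_j>) makes x_j(-1) v a vacuum, so U x_j(-1) v is again a
  principal subspace, graded by x_j q chi(x_i q^(a_ji)).  The top coefficient of the exponential of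
  the operators lambda_j(n), n > 0, replaces every factor x_gamma(m) with <lambda_j, gamma> = 1
  by x_gamma(m + 1); it maps W(Lambda_0) onto itself, lowering the weight by the j-th charge, and
  kills U x_j(-1) v.

  By induction on charge and weight every solution of the relations is a functional on
  W(Lambda_0).  This identifies the kernel of the second map with U x_j(-1) v, and the recursion is
  the rank-nullity formula.
*)

theory Submission
  imports Defs
begin

section \<open>Modules over the loop algebra in terms of traceless matrix units\<close>

text \<open>The obstacle is that the annihilator of v in the enveloping algebra is not known in
  advance, while comparing the kernel of the second map with the image of the first needs exactly
  this knowledge. Functionals on words avoid an abstract quotient and a basis of it: twists and
  shifts only relabel modes, so relations can be transported letter by letter. The two induction
  parameters match the two maps. Removing a factor x_j and twisting lowers the total charge; the
  shift keeps the charges and lowers the weight. The twisted action lives on the same space but is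
  another module with another vacuum, and no isomorphism with the original one is constructed.
  Therefore the statements on functionals and on dimensions are proved for all modules at once, and
  a dimension is shown to depend only on the degree. Level one enters through the central term: in
  the quadratic relation two central contributions cancel <gamma, gamma> = 2, and x_j(-1) v is
  nonzero because a single central term brings it back to v.\<close>

type_synonym letter = "(nat \<times> nat) \<times> int"

definition word_act :: "(nat \<Rightarrow> nat \<Rightarrow> int \<Rightarrow> 'v \<Rightarrow> 'v) \<Rightarrow> letter list \<Rightarrow> 'v \<Rightarrow> 'v" where
  "word_act Y ps u = foldr (\<lambda>((a, b), m) w. Y a b m w) ps u"

lemma word_act_Nil [simp]: "word_act Y [] u = u"
  and word_act_Cons [simp]: "word_act Y (((a, b), m) # ps) u = Y a b m (word_act Y ps u)"
  and word_act_append [simp]: "word_act Y (ps @ qs) u = word_act Y ps (word_act Y qs u)"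
  by (simp_all add: word_act_def)

text \<open>
  \<open>Y a b m\<close> is the action of \<open>(E\<^bsub>ab\<^esub> - \<delta>\<^bsub>ab\<^esub> / (l + 1)) \<otimes> t\<^sup>m\<close>. The traceless matrix units span \<open>sl(l+1)\<close>
  and are self-dual up to transposition, so that no basis of the Cartan subalgebra is needed.
\<close>

locale loop_module = vector_space scale
  for scale :: "complex \<Rightarrow> 'v::ab_group_add \<Rightarrow> 'v" +
  fixes l :: nat
    and Y :: "nat \<Rightarrow> nat \<Rightarrow> int \<Rightarrow> 'v \<Rightarrow> 'v"
    and v :: 'v
  assumes Y_add: "a \<le> l \<Longrightarrow> b \<le> l \<Longrightarrow> Y a b m (x + y) = Y a b m x + Y a b m y"
    and Y_scale: "a \<le> l \<Longrightarrow> b \<le> l \<Longrightarrow> Y a b m (scale z x) = scale z (Y a b m x)"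
    and Y_bracket: "a \<le> l \<Longrightarrow> b \<le> l \<Longrightarrow> c \<le> l \<Longrightarrow> d \<le> l \<Longrightarrow>
      Y a b m (Y c d n w) - Y c d n (Y a b m w) =
        (if b = c then Y a d (m + n) w else 0) - (if a = d then Y c b (m + n) w else 0)
        + (if m + n = 0 then scale (of_int m * ((if b = c \<and> a = d then 1 else 0)
            - (if a = b \<and> c = d then 1 / of_nat (l + 1) else 0))) w else 0)"
    and Y_trace: "(\<Sum>a\<le>l. Y a a m w) = 0"
    and Y_irreducible: "subspace S \<Longrightarrow> (\<And>a b m w. a \<le> l \<Longrightarrow> b \<le> l \<Longrightarrow> w \<in> S \<Longrightarrow> Y a b m w \<in> S) \<Longrightarrow>
      S = {0} \<or> S = UNIV"
    and v_nonzero: "v \<noteq> 0"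
    and Y_vac: "a \<le> l \<Longrightarrow> b \<le> l \<Longrightarrow> 0 \<le> m \<Longrightarrow> Y a b m v = 0"
begin

lemma Y_zero [simp]: "a \<le> l \<Longrightarrow> b \<le> l \<Longrightarrow> Y a b m 0 = 0"
  using Y_scale[of a b m 0 0] by simp

lemma Y_diff: "a \<le> l \<Longrightarrow> b \<le> l \<Longrightarrow> Y a b m (x - y) = Y a b m x - Y a b m y"
  using Y_add[of a b m "x - y" y] by (simp add: algebra_simps)

lemma Y_sum: "a \<le> l \<Longrightarrow> b \<le> l \<Longrightarrow> Y a b m (sum f A) = (\<Sum>i\<in>A. Y a b m (f i))"
  by (induction A rule: infinite_finite_induct) (auto simp: Y_add)

lemma Y_swap: "a \<le> l \<Longrightarrow> b \<le> l \<Longrightarrow> c \<le> l \<Longrightarrow> d \<le> l \<Longrightarrow>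
      Y a b m (Y c d n w) = Y c d n (Y a b m w) + ((if b = c then Y a d (m + n) w else 0) - (if a = d then Y c b (m + n) w else 0)
        + (if m + n = 0 then scale (of_int m * ((if b = c \<and> a = d then 1 else 0)
            - (if a = b \<and> c = d then 1 / of_nat (l + 1) else 0))) w else 0))"
  using Y_bracket[of a b c d m n w] by (simp add: algebra_simps)

lemma Y_commute: "a \<le> l \<Longrightarrow> b \<le> l \<Longrightarrow> c \<le> l \<Longrightarrow> d \<le> l \<Longrightarrow> b \<noteq> c \<Longrightarrow> a \<noteq> d \<Longrightarrow> a \<noteq> b \<or> c \<noteq> d \<Longrightarrow>
      Y a b m (Y c d n w) = Y c d n (Y a b m w)"
  using Y_swap[of a b c d m n w] by auto

section \<open>Local finiteness and commutators of the Casimir modes\<close>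

definition locally_finite :: "'v \<Rightarrow> bool" where
  "locally_finite w \<longleftrightarrow> (\<exists>M. \<forall>a\<le>l. \<forall>b\<le>l. \<forall>m>M. Y a b m w = 0)"

text \<open>The vectors killed by all large modes form an invariant subspace containing
  \<open>v\<close>, hence the whole space by irreducibility. This makes the infinite sum in
  \<open>L0\<close> finite on every vector.\<close>

lemma all_locally_finite: "locally_finite w"
proof -
  let ?S = "{w. locally_finite w}"
  have "subspace ?S"
  proof (rule subspaceI)
    show "0 \<in> ?S" by (auto simp: locally_finite_def)
    fix x y assume "x \<in> ?S" "y \<in> ?S"
    then obtain M N where "\<forall>a\<le>l. \<forall>b\<le>l. \<forall>m>M. Y a b m x = 0" "\<forall>a\<le>l. \<forall>b\<le>l. \<forall>m>N. Y a b m y = 0"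
      by (auto simp: locally_finite_def)
    then have "\<forall>a\<le>l. \<forall>b\<le>l. \<forall>m>max M N. Y a b m (x + y) = 0" by (simp add: Y_add)
    then show "x + y \<in> ?S" unfolding locally_finite_def by blast
  next
    fix c x assume "x \<in> ?S"
    then show "scale c x \<in> ?S" by (auto simp: locally_finite_def Y_scale)
  qed
  moreover have "Y c d n w \<in> ?S" if cd: "c \<le> l" "d \<le> l" "w \<in> ?S" for c d n w
  proof -
    obtain M where M: "\<forall>a\<le>l. \<forall>b\<le>l. \<forall>m>M. Y a b m w = 0" using cd(3) unfolding locally_finite_def by blast
    \<comment> \<open>The three bounds kill, in order, \<open>Y a b m w\<close>, the bracket terms
      of mode \<open>m + n\<close>, and the central term.\<close>
    have "\<forall>a\<le>l. \<forall>b\<le>l. \<forall>m>max M (max (M - n) (-n)). Y a b m (Y c d n w) = 0"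
      using M cd by (auto simp: Y_swap)
    then show ?thesis unfolding locally_finite_def by blast
  qed
  ultimately have "?S = {0} \<or> ?S = UNIV" by (intro Y_irreducible)
  moreover have "v \<in> ?S" unfolding locally_finite_def using Y_vac by (auto intro!: exI[of _ 0])
  ultimately show ?thesis using v_nonzero by auto
qed

definition casimir :: "int \<Rightarrow> 'v \<Rightarrow> 'v" where
  "casimir m w = (\<Sum>a\<le>l. \<Sum>b\<le>l. Y a b (- m) (Y b a m w))"

text \<open>What a bracket of \<open>Y p q n\<close> with one factor of a Casimir mode leaves
  behind: total mode \<open>n\<close>, inner factor of mode \<open>k\<close>. The commutator with
  \<open>casimir m\<close> is, up to central terms, the difference of the values at
  \<open>k = m + n\<close> and \<open>k = m\<close>, so that the sum over \<open>m\<close>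
  telescopes.\<close>

definition adj_casimir :: "nat \<Rightarrow> nat \<Rightarrow> int \<Rightarrow> int \<Rightarrow> 'v \<Rightarrow> 'v" where
  "adj_casimir p q n k w = (\<Sum>b\<le>l. Y p b (n - k) (Y b q k w)) - (\<Sum>a\<le>l. Y a q (n - k) (Y p a k w))"

lemma casimir_commutator:
  assumes pq: "p \<le> l" "q \<le> l"
  shows "casimir m (Y p q n w) - Y p q n (casimir m w) =
     adj_casimir p q n (m + n) w - adj_casimir p q n m w
     + (if m + n = 0 then scale (of_int m) (Y p q n w) else 0)
     - (if m = n then scale (of_int m) (Y p q n w) else 0)"
proof -
  \<comment> \<open>\<open>A\<close> and \<open>B\<close> are the brackets with the inner factor,
    \<open>A'\<close> and \<open>B'\<close> those with the outer one. The central term splits into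
    \<open>c\<close>, from the pairing of matrix units, and \<open>c'\<close>, from the trace
    correction; the latter sums to zero by \<open>Y_trace\<close>.\<close>
  define A where "A a b = (if a = p then Y a b (-m) (Y b q (m + n) w) else 0)" for a b
  define B where "B a b = (if b = q then Y a b (-m) (Y p a (m + n) w) else 0)" for a b
  define A' where "A' a b = (if b = p then Y a q (n - m) (Y b a m w) else 0)" for a b
  define B' where "B' a b = (if a = q then Y p b (n - m) (Y b a m w) else 0)" for a b
  define c where "c m a b = (if m + n = 0 \<and> a = p \<and> b = q then scale (of_int m) (Y p q n w) else 0)" for m :: int and a b
  define c' where "c' m a b = (if m + n = 0 \<and> a = b \<and> p = q then scale (of_int m / of_nat (l + 1)) (Y a a n w) else 0)" for m :: int and a b
  have t: "Y a b (-m) (Y b a m (Y p q n w)) - Y p q n (Y a b (-m) (Y b a m w)) =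
     A a b - B a b + c m a b - c' m a b + (A' a b - B' a b) + (c (-m) b a - c' (-m) a b)"
    if ab: "a \<le> l" "b \<le> l" for a b
  proof -
    have "Y a b (-m) (Y b a m (Y p q n w)) = Y a b (-m) (Y p q n (Y b a m w) + ((if a = p then Y b q (m + n) w else 0)
        - (if b = q then Y p a (m + n) w else 0)
        + (if m + n = 0 then scale (of_int m * ((if a = p \<and> b = q then 1 else 0)
            - (if b = a \<and> p = q then 1 / of_nat (l + 1) else 0))) w else 0)))"
      using ab pq by (subst Y_swap[of b a p q]) (simp_all only:)
    also have "\<dots> = Y a b (-m) (Y p q n (Y b a m w)) + (A a b - B a b + c m a b - c' m a b)"
    proof (cases "m + n = 0")
      case True
      then have n: "n = - m" by simp
      show ?thesis using ab pq
        unfolding A_def B_def c_def c'_def n by (auto simp: Y_add Y_diff Y_scale scale_left_diff_distrib right_diff_distrib)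
    next
      case False
      then show ?thesis using ab pq
        unfolding A_def B_def c_def c'_def by (auto simp: Y_add Y_diff Y_scale)
    qed
    finally have 1: "Y a b (-m) (Y b a m (Y p q n w)) = Y a b (-m) (Y p q n (Y b a m w)) + (A a b - B a b + c m a b - c' m a b)" .
    have "Y a b (-m) (Y p q n (Y b a m w)) = Y p q n (Y a b (-m) (Y b a m w)) + ((if b = p then Y a q (- m + n) (Y b a m w) else 0)
        - (if a = q then Y p b (- m + n) (Y b a m w) else 0)
        + (if - m + n = 0 then scale (of_int (- m) * ((if b = p \<and> a = q then 1 else 0)
            - (if a = b \<and> p = q then 1 / of_nat (l + 1) else 0))) (Y b a m w) else 0))"
      using ab pq by (subst Y_swap[of a b p q]) (simp_all only:)
    also have "\<dots> = Y p q n (Y a b (-m) (Y b a m w)) + ((A' a b - B' a b) + (c (-m) b a - c' (-m) a b))"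
    proof (cases "m = n")
      case True
      have d: "scale (z * (x - y)) u = scale (z * x) u - scale (z * y) u" for z x y u
        by (simp only: right_diff_distrib scale_left_diff_distrib)
      show ?thesis unfolding A'_def B'_def c_def c'_def True d
        by (cases "b = p"; cases "a = q"; cases "p = q") simp_all
    next
      case False
      then have "- m + n \<noteq> 0" by simp
      moreover have "- m + n = n - m" by simp
      ultimately show ?thesis unfolding A'_def B'_def c_def c'_def by (simp only: if_False simp_thms) simp
    qed
    finally have 2: "Y a b (-m) (Y p q n (Y b a m w)) = Y p q n (Y a b (-m) (Y b a m w)) + ((A' a b - B' a b) + (c (-m) b a - c' (-m) a b))" .
    show ?thesis unfolding 1 2 by (simp add: algebra_simps)
  qed
  have sA: "(\<Sum>a\<le>l. \<Sum>b\<le>l. A a b) = (\<Sum>b\<le>l. Y p b (-m) (Y b q (m + n) w))"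
    unfolding A_def using pq by (subst sum.swap) simp
  have sB: "(\<Sum>a\<le>l. \<Sum>b\<le>l. B a b) = (\<Sum>a\<le>l. Y a q (-m) (Y p a (m + n) w))"
    unfolding B_def using pq by simp
  have sA': "(\<Sum>a\<le>l. \<Sum>b\<le>l. A' a b) = (\<Sum>a\<le>l. Y a q (n - m) (Y p a m w))"
    unfolding A'_def using pq by simp
  have sB': "(\<Sum>a\<le>l. \<Sum>b\<le>l. B' a b) = (\<Sum>b\<le>l. Y p b (n - m) (Y b q m w))"
    unfolding B'_def using pq by (subst sum.swap) simp
  have sc: "(\<Sum>a\<le>l. \<Sum>b\<le>l. c m a b) = (if m + n = 0 then scale (of_int m) (Y p q n w) else 0)" for m :: int
  proof -
    have "c m a b = (if b = q then (if a = p then (if m + n = 0 then scale (of_int m) (Y p q n w) else 0) else 0) else 0)" for a b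
      by (simp add: c_def)
    then show ?thesis using pq by simp
  qed
  have sc2: "(\<Sum>a\<le>l. \<Sum>b\<le>l. c m b a) = (if m + n = 0 then scale (of_int m) (Y p q n w) else 0)" for m :: int
    by (subst sum.swap) (rule sc)
  have sc': "(\<Sum>a\<le>l. \<Sum>b\<le>l. c' m a b) = 0" for m :: int
  proof -
    have "c' m a b = (if b = a then (if m + n = 0 \<and> p = q then scale (of_int m / of_nat (l + 1)) (Y a a n w) else 0) else 0)" for a b
      by (simp add: c'_def)
    then have "(\<Sum>a\<le>l. \<Sum>b\<le>l. c' m a b) = (\<Sum>a\<le>l. if m + n = 0 \<and> p = q then scale (of_int m / of_nat (l + 1)) (Y a a n w) else 0)"
      by (intro sum.cong refl) simp
    also have "\<dots> = 0"
      using Y_trace[of n w] by (cases "m + n = 0 \<and> p = q") (auto simp: scale_sum_right[symmetric] simp del: of_nat_add)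
    finally show ?thesis .
  qed
  have "casimir m (Y p q n w) - Y p q n (casimir m w) = (\<Sum>a\<le>l. \<Sum>b\<le>l. Y a b (-m) (Y b a m (Y p q n w)) - Y p q n (Y a b (-m) (Y b a m w)))"
    using pq by (simp add: casimir_def Y_sum sum_subtractf)
  also have "\<dots> = (\<Sum>a\<le>l. \<Sum>b\<le>l. A a b - B a b + c m a b - c' m a b + (A' a b - B' a b) + (c (-m) b a - c' (-m) a b))"
    by (intro sum.cong refl t) auto
  also have "\<dots> = (\<Sum>b\<le>l. Y p b (-m) (Y b q (m + n) w)) - (\<Sum>a\<le>l. Y a q (-m) (Y p a (m + n) w))
      + (if m + n = 0 then scale (of_int m) (Y p q n w) else 0)
      + ((\<Sum>a\<le>l. Y a q (n - m) (Y p a m w)) - (\<Sum>b\<le>l. Y p b (n - m) (Y b q m w)))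
      + (if - m + n = 0 then scale (of_int (-m)) (Y p q n w) else 0)"
    by (simp only: sum.distrib sum_subtractf sA sB sA' sB' sc sc' sc2) simp
  finally show ?thesis by (auto simp: adj_casimir_def algebra_simps)
qed

text \<open>The reflection \<open>k \<mapsto> n - k\<close> pairs every product with the reversed
  product, leaving commutators only. Their central terms cancel, and their diagonal parts vanish by
  \<open>Y_trace\<close>. The \<open>l + 1\<close> values of the summation index produce the dual
  Coxeter number.\<close>

lemma adj_casimir_reflect:
  assumes pq: "p \<le> l" "q \<le> l"
  shows "adj_casimir p q n k w + adj_casimir p q n (n - k) w = scale (2 * of_nat (l + 1)) (Y p q n w)"
proof -
  have "adj_casimir p q n k w + adj_casimir p q n (n - k) w =
     (\<Sum>b\<le>l. (Y p b (n - k) (Y b q k w) - Y b q k (Y p b (n - k) w)) + (Y p b k (Y b q (n - k) w) - Y b q (n - k) (Y p b k w)))"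
    by (simp add: adj_casimir_def sum.distrib sum_subtractf)
  also have "\<dots> = (\<Sum>b\<le>l. scale 2 (Y p q n w) - (if p = q then scale 2 (Y b b n w) else 0))"
  proof (intro sum.cong refl)
    fix b assume "b \<in> {..l}"
    then have b: "b \<le> l" by simp
    have d: "x + x = scale 2 x" for x using scale_left_distrib[of 1 1 x] by simp
    show "(Y p b (n - k) (Y b q k w) - Y b q k (Y p b (n - k) w)) + (Y p b k (Y b q (n - k) w) - Y b q (n - k) (Y p b k w)) =
       scale 2 (Y p q n w) - (if p = q then scale 2 (Y b b n w) else 0)"
      using b pq by (subst (1 2) Y_bracket) (auto simp: d[symmetric] algebra_simps)
  qed
  also have "\<dots> = scale (2 * of_nat (l + 1)) (Y p q n w)"
  proof -
    have "(\<Sum>b\<le>l. scale 2 (Y p q n w)) = scale (2 * of_nat (l + 1)) (Y p q n w)"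
      by (subst sum_constant_scale) (simp add: mult.commute)
    moreover have "(\<Sum>b\<le>l. if p = q then scale 2 (Y b b n w) else 0) = 0"
      using Y_trace[of n w] by (cases "p = q") (simp_all add: scale_sum_right[symmetric])
    ultimately show ?thesis by (simp add: sum_subtractf)
  qed
  finally show ?thesis .
qed

end


section \<open>The Sugawara operator and the quadratic relations\<close>

text \<open>A shift by \<open>n\<close> changes the sum only at its lower end, because the terms
  near the upper end vanish by hypothesis.\<close>

lemma sum_shift_diff_int:
  fixes t :: "int \<Rightarrow> 'a::ab_group_add"
  assumes "\<And>k. k > K - \<bar>n\<bar> \<Longrightarrow> t k = 0" and "\<bar>n\<bar> \<le> K"
  shows "(\<Sum>m=1..K. t (m + n)) - (\<Sum>m=1..K. t m)
    = (if 0 \<le> n then - (\<Sum>m=1..n. t m) else (\<Sum>m=n+1..0. t m))"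
proof -
  have "(\<Sum>m=1..K. t (m + n)) = (\<Sum>m=1+n..K+n. t m)"
    by (rule sum.reindex_bij_witness[of _ "\<lambda>m. m - n" "\<lambda>m. m + n"]) auto
  also have "\<dots> = (\<Sum>m=1+n..K. t m)"
  proof (cases "0 \<le> n")
    case True
    then show ?thesis using assms by (intro sum.mono_neutral_right) auto
  next
    case False
    then show ?thesis using assms by (intro sum.mono_neutral_left) auto
  qed
  finally have 1: "(\<Sum>m=1..K. t (m + n)) = (\<Sum>m=1+n..K. t m)" .
  show ?thesis
  proof (cases "0 \<le> n")
    case True
    have "{1..K} = {1..n} \<union> {1+n..K}" using True assms(2) by auto
    then have "(\<Sum>m=1..K. t m) = (\<Sum>m=1..n. t m) + (\<Sum>m=1+n..K. t m)"
      by (simp add: sum.union_disjoint)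
    then show ?thesis using 1 True by simp
  next
    case False
    have "{1+n..K} = {n+1..0} \<union> {1..K}" using False assms(2) by auto
    then have "(\<Sum>m=1+n..K. t m) = (\<Sum>m=n+1..0. t m) + (\<Sum>m=1..K. t m)"
      by (simp add: sum.union_disjoint)
    then show ?thesis using 1 False by simp
  qed
qed

text \<open>The block left over by telescoping is mapped to itself by
  \<open>k \<mapsto> n - k\<close>, up to its end terms \<open>t 0\<close> and \<open>t n\<close>.
  Twice the block is therefore determined by the constant \<open>c\<close> alone, whatever the
  individual terms are.\<close>

lemma sum_reflect_int:
  fixes t :: "int \<Rightarrow> 'a::ab_group_add"
  assumes c: "\<And>k. t k + t (n - k) = c" and K: "\<And>k. k > K - \<bar>n\<bar> \<Longrightarrow> t k = 0" "\<bar>n\<bar> \<le> K"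
  shows "t n - t 0 + ((\<Sum>m=1..K. t (m + n)) - (\<Sum>m=1..K. t m)) + ((\<Sum>m=1..K. t (m + n)) - (\<Sum>m=1..K. t m))
    = (if 0 \<le> n then - (\<Sum>m=1..n. c) else (\<Sum>m=n+1..0. c))"
proof (cases "0 \<le> n")
  case True
  have "(\<Sum>m=1..n. t m) + t 0 = (\<Sum>m=0..n. t m)"
    using True by (simp add: simp_from_to[of 0 n] add.commute)
  also have "\<dots> = (\<Sum>m=1..n. t (n - m)) + t n"
  proof -
    have "(\<Sum>m=0..n. t m) = (\<Sum>m=0..n. t (n - m))"
      by (rule sum.reindex_bij_witness[of _ "\<lambda>m. n - m" "\<lambda>m. n - m"]) auto
    then show ?thesis using True by (simp add: simp_from_to[of 0 n] add.commute)
  qed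
  finally have "(\<Sum>m=1..n. t m) + t 0 = (\<Sum>m=1..n. t (n - m)) + t n" .
  moreover have "(\<Sum>m=1..n. c) = (\<Sum>m=1..n. t m) + (\<Sum>m=1..n. t (n - m))"
    by (simp add: sum.distrib[symmetric] c)
  moreover have "(\<Sum>m=1..K. t (m + n)) - (\<Sum>m=1..K. t m) = - (\<Sum>m=1..n. t m)"
    using True sum_shift_diff_int[of K n t, OF K] by simp
  ultimately show ?thesis using True by (simp only: if_True) (simp add: algebra_simps)
next
  case False
  have ins: "{n..0} = insert n {n+1..0}" "{n..0} = insert 0 {n..-1}" using False by auto
  have "(\<Sum>m=n+1..0. t m) + t n = (\<Sum>m=n..0. t m)"
    by (subst ins(1)) simp
  also have "\<dots> = (\<Sum>m=n..0. t (n - m))"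
    by (rule sum.reindex_bij_witness[of _ "\<lambda>m. n - m" "\<lambda>m. n - m"]) auto
  also have "\<dots> = (\<Sum>m=n+1..0. t (n - m)) + t 0"
    by (subst ins(1)) simp
  finally have "(\<Sum>m=n+1..0. t m) + t n = (\<Sum>m=n+1..0. t (n - m)) + t 0" .
  moreover have "(\<Sum>m=n+1..0. c) = (\<Sum>m=n+1..0. t m) + (\<Sum>m=n+1..0. t (n - m))"
    by (simp add: sum.distrib[symmetric] c)
  moreover have "(\<Sum>m=1..K. t (m + n)) - (\<Sum>m=1..K. t m) = (\<Sum>m=n+1..0. t m)"
    using False sum_shift_diff_int[of K n t, OF K] by simp
  ultimately show ?thesis using False by (simp only: if_False) (simp add: algebra_simps)
qed

definition energy :: "letter list \<Rightarrow> int" where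
  "energy ps = - (\<Sum>p\<leftarrow>ps. snd p)"

lemma energy_simps [simp]: "energy [] = 0" "energy (p # ps) = energy ps - snd p" "energy (ps @ qs) = energy ps + energy qs"
  by (simp_all add: energy_def)

definition word_in :: "nat \<Rightarrow> letter list \<Rightarrow> bool" where
  "word_in l ps \<longleftrightarrow> (\<forall>((a, b), m) \<in> set ps. a \<le> l \<and> b \<le> l)"

lemma word_in_simps [simp]: "word_in l []" "word_in l (((a, b), m) # ps) \<longleftrightarrow> a \<le> l \<and> b \<le> l \<and> word_in l ps"
  "word_in l (ps @ qs) \<longleftrightarrow> word_in l ps \<and> word_in l qs"
  by (simp_all add: word_in_def ball_Un)

context vector_space begin

text \<open>Choose an operator separating \<open>d\<close> from \<open>d'\<close> and apply it minus
  its eigenvalue at \<open>d\<close>: the summand at \<open>d\<close> disappears, and a shorter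
  relation between rescaled eigenvectors remains. The family of operators is needed to separate
  charges and weight simultaneously.\<close>

lemma eigenvectors_independent:
  fixes D :: "'d set" and I :: "'i set"
  assumes "finite D"
    and "\<And>i x y. i \<in> I \<Longrightarrow> T i (x + y) = T i x + T i y" and "\<And>i c x. i \<in> I \<Longrightarrow> T i (scale c x) = scale c (T i x)"
    and "\<And>d d'. d \<in> D \<Longrightarrow> d' \<in> D \<Longrightarrow> d \<noteq> d' \<Longrightarrow> \<exists>i\<in>I. \<mu> i d \<noteq> \<mu> i d'"
    and "\<And>i d. i \<in> I \<Longrightarrow> d \<in> D \<Longrightarrow> T i (f d) = scale (\<mu> i d) (f d)"
    and "(\<Sum>d\<in>D. f d) = 0" and "d \<in> D"
  shows "f d = 0"
  using assms
proof (induction "card D" arbitrary: D f d rule: less_induct)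
  case (less D f d)
  have T_sum: "T i (sum g A) = (\<Sum>d\<in>A. T i (g d))" if "i \<in> I" for i g and A :: "'d set"
  proof -
    have "T i 0 = 0" using less.prems(3)[OF that, of 0 0] by simp
    then show ?thesis by (induction A rule: infinite_finite_induct) (auto simp: less.prems(2)[OF that])
  qed
  have others: "f d' = 0" if d': "d' \<in> D" "d' \<noteq> d" for d'
  proof -
    obtain i where i: "i \<in> I" "\<mu> i d \<noteq> \<mu> i d'" using less.prems(4)[of d d'] d' less.prems(7) by blast
    let ?g = "\<lambda>e. scale (\<mu> i e - \<mu> i d) (f e)"
    have "(\<Sum>e\<in>D - {d}. ?g e) = (\<Sum>e\<in>D. ?g e)"
      using less.prems(1,7) by (subst sum.remove[of D d]) auto
    also have "\<dots> = T i (\<Sum>e\<in>D. f e) - scale (\<mu> i d) (\<Sum>e\<in>D. f e)"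
      using less.prems(5)[OF i(1)] by (simp add: T_sum[OF i(1)] scale_sum_right sum_subtractf scale_left_diff_distrib)
    also have "\<dots> = 0" using less.prems(3)[OF i(1), of 0 0] less.prems(6) by simp
    finally have s: "(\<Sum>e\<in>D - {d}. ?g e) = 0" .
    have "?g d' = 0"
    proof (rule less.hyps[of "D - {d}"])
      show "card (D - {d}) < card D" using less.prems(1,7) by (rule card_Diff1_less)
      show "T i' (?g e) = scale (\<mu> i' e) (?g e)" if "i' \<in> I" "e \<in> D - {d}" for i' e
        using less.prems(3)[OF that(1)] less.prems(5)[OF that(1)] that(2) by (simp add: mult.commute)
    qed (use less.prems(1-4) s d' in auto)
    then show "f d' = 0" using i(2) by simp
  qed
  have "(\<Sum>e\<in>D. f e) = f d"
    using less.prems(1,7) others by (subst sum.remove[of D d]) (auto intro!: sum.neutral)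
  then show ?case using less.prems(6) by simp
qed

end

context loop_module begin

section \<open>L(0) as a grading operator\<close>

definition L0 :: "'v \<Rightarrow> 'v" where
  "L0 w = scale (1 / (2 * (1 + of_nat (l + 1))))
     (casimir 0 w + scale 2 (Sum_any (\<lambda>m::nat. casimir (int (Suc m)) w)))"

lemma double: "scale 2 x = x + x"
  using scale_left_distrib[of 1 1 x] by simp

lemma casimir_zero_beyond:
  assumes "\<forall>a\<le>l. \<forall>b\<le>l. \<forall>m>M. Y a b m w = 0" "m > M"
  shows "casimir m w = 0"
  using assms by (simp add: casimir_def)

text \<open>Any sufficiently large cutoff \<open>K\<close> may be used, so the sums for several
  vectors can be given a common range before they are compared.\<close>

lemma L0_bounded:
  assumes "\<forall>a\<le>l. \<forall>b\<le>l. \<forall>m>K. Y a b m w = 0"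
  shows "L0 w = scale (1 / (2 * (1 + of_nat (l + 1))))
     (casimir 0 w + ((\<Sum>m=1..K. casimir m w) + (\<Sum>m=1..K. casimir m w)))"
proof -
  have "Sum_any (\<lambda>m::nat. casimir (int (Suc m)) w) = (\<Sum>m<nat K. casimir (int (Suc m)) w)"
  proof (rule Sum_any.expand_superset)
    show "{a. casimir (int (Suc a)) w \<noteq> 0} \<subseteq> {..<nat K}"
    proof
      fix a assume "a \<in> {a. casimir (int (Suc a)) w \<noteq> 0}"
      then have "\<not> int (Suc a) > K" using casimir_zero_beyond[OF assms, of "int (Suc a)"] by blast
      then show "a \<in> {..<nat K}" by auto
    qed
  qed simp
  also have "\<dots> = (\<Sum>m=1..K. casimir m w)"
    by (rule sum.reindex_bij_witness[of _ "\<lambda>m. nat (m - 1)" "\<lambda>m. int (Suc m)"]) auto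
  finally show ?thesis by (simp add: L0_def double)
qed

lemma ex_bound:
  obtains M where "\<forall>a\<le>l. \<forall>b\<le>l. \<forall>m>M. Y a b m w = 0" "N \<le> M"
proof -
  obtain M where "\<forall>a\<le>l. \<forall>b\<le>l. \<forall>m>M. Y a b m w = 0"
    using all_locally_finite[of w] unfolding locally_finite_def by blast
  then have "\<forall>a\<le>l. \<forall>b\<le>l. \<forall>m>max M N. Y a b m w = 0" by simp
  then show ?thesis by (intro that[of "max M N"]) auto
qed

lemma casimir_add: "casimir m (x + y) = casimir m x + casimir m y"
  by (simp add: casimir_def Y_add sum.distrib)

lemma casimir_scale: "casimir m (scale c x) = scale c (casimir m x)"
  by (simp add: casimir_def Y_scale scale_sum_right)

lemma L0_add: "L0 (x + y) = L0 x + L0 y"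
proof -
  obtain M where M: "\<forall>a\<le>l. \<forall>b\<le>l. \<forall>m>M. Y a b m x = 0" by (rule ex_bound)
  obtain N where N: "\<forall>a\<le>l. \<forall>b\<le>l. \<forall>m>N. Y a b m y = 0" "M \<le> N" by (rule ex_bound)
  have "\<forall>a\<le>l. \<forall>b\<le>l. \<forall>m>N. Y a b m x = 0" "\<forall>a\<le>l. \<forall>b\<le>l. \<forall>m>N. Y a b m (x + y) = 0"
    using M N by (auto simp: Y_add)
  then show ?thesis using N(1)
    by (simp add: L0_bounded[of N] casimir_add sum.distrib scale_right_distrib[symmetric] add_ac)
qed

lemma L0_scale: "L0 (scale c x) = scale c (L0 x)"
proof -
  obtain N where N: "\<forall>a\<le>l. \<forall>b\<le>l. \<forall>m>N. Y a b m x = 0" by (rule ex_bound)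
  have "\<forall>a\<le>l. \<forall>b\<le>l. \<forall>m>N. Y a b m (scale c x) = 0"
    using N by (auto simp: Y_scale)
  then show ?thesis using N
    by (simp add: L0_bounded[of N] casimir_scale scale_sum_right scale_right_distrib mult.commute)
qed

lemma L0_vac: "L0 v = 0"
proof -
  have "\<forall>a\<le>l. \<forall>b\<le>l. \<forall>m>0. Y a b m v = 0" using Y_vac by simp
  then show ?thesis by (subst L0_bounded[of 0]) (auto simp: casimir_def Y_vac)
qed

text \<open>The reflected block contributes \<open>- 2 n (l + 1)\<close> and the central terms
  contribute \<open>- 2 n\<close>. The normalization by twice the sum of the level 1 and the dual
  Coxeter number \<open>l + 1\<close> turns the total into \<open>- n\<close>.\<close>

lemma L0_commutator:
  assumes pq: "p \<le> l" "q \<le> l"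
  shows "L0 (Y p q n w) = Y p q n (L0 w) - scale (of_int n) (Y p q n w)"
proof -
  obtain M where M: "\<forall>a\<le>l. \<forall>b\<le>l. \<forall>m>M. Y a b m w = 0" "0 \<le> M" by (rule ex_bound)
  obtain K where K: "\<forall>a\<le>l. \<forall>b\<le>l. \<forall>m>K. Y a b m (Y p q n w) = 0" "M + \<bar>n\<bar> \<le> K" by (rule ex_bound)
  have Kw: "\<forall>a\<le>l. \<forall>b\<le>l. \<forall>m>K. Y a b m w = 0" using M K(2) by auto
  define t where "t k = adj_casimir p q n k w" for k
  let ?y = "Y p q n w"
  let ?N = "1 / (2 * (1 + of_nat (l + 1))) :: complex"
  have t0: "t k = 0" if "k > K - \<bar>n\<bar>" for k
    using that K(2) M pq by (simp add: t_def adj_casimir_def)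
  have D: "casimir m ?y - Y p q n (casimir m w) = t (m + n) - t m
      + (if m = - n then scale (of_int m) ?y else 0) - (if m = n then scale (of_int m) ?y else 0)" for m
    unfolding t_def casimir_commutator[OF pq] by (auto simp: eq_neg_iff_add_eq_0)
  have "(\<Sum>m=1..K. casimir m ?y) - Y p q n (\<Sum>m=1..K. casimir m w)
      = (\<Sum>m=1..K. casimir m ?y - Y p q n (casimir m w))"
    using pq by (simp add: Y_sum sum_subtractf)
  also have "\<dots> = ((\<Sum>m=1..K. t (m + n)) - (\<Sum>m=1..K. t m))
     + (\<Sum>m=1..K. if m = - n then scale (of_int m) ?y else 0) - (\<Sum>m=1..K. if m = n then scale (of_int m) ?y else 0)"
    unfolding D by (simp only: sum.distrib sum_subtractf)
  \<comment> \<open>For nonzero \<open>n\<close> exactly one of the two sums meets its mode: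
    \<open>m = n\<close> if \<open>n\<close> is positive, \<open>m = - n\<close> if it is negative.
    Either way the contribution is \<open>- n\<close>.\<close>
  also have "\<dots> = ((\<Sum>m=1..K. t (m + n)) - (\<Sum>m=1..K. t m)) - scale (of_int n) ?y"
    using K(2) M(2) by (auto simp: sum.delta)
  finally have S: "(\<Sum>m=1..K. casimir m ?y) - Y p q n (\<Sum>m=1..K. casimir m w)
      = ((\<Sum>m=1..K. t (m + n)) - (\<Sum>m=1..K. t m)) - scale (of_int n) ?y" .
  have S0: "casimir 0 ?y - Y p q n (casimir 0 w) = t n - t 0"
    using D[of 0] by auto
  have C: "t k + t (n - k) = scale (2 * of_nat (l + 1)) ?y" for k
    unfolding t_def by (rule adj_casimir_reflect[OF pq])
  have "L0 ?y - Y p q n (L0 w) = scale ?N ((casimir 0 ?y - Y p q n (casimir 0 w))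
     + ((\<Sum>m=1..K. casimir m ?y) - Y p q n (\<Sum>m=1..K. casimir m w))
     + ((\<Sum>m=1..K. casimir m ?y) - Y p q n (\<Sum>m=1..K. casimir m w)))"
    unfolding L0_bounded[OF K(1)] L0_bounded[OF Kw] Y_scale[OF pq] Y_add[OF pq] scale_right_diff_distrib[symmetric]
    by (rule arg_cong[where f = "scale ?N"]) (simp add: algebra_simps)
  also have "\<dots> = scale ?N ((t n - t 0 + ((\<Sum>m=1..K. t (m + n)) - (\<Sum>m=1..K. t m)) + ((\<Sum>m=1..K. t (m + n)) - (\<Sum>m=1..K. t m)))
      - scale (2 * of_int n) ?y)"
  proof -
    have e: "scale (2 * of_int n) ?y = scale (of_int n) ?y + scale (of_int n) ?y"
      by (simp only: mult_2 scale_left_distrib)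
    show ?thesis unfolding S S0 e by (rule arg_cong[where f = "scale ?N"]) (simp add: algebra_simps)
  qed
  also have "\<dots> = scale ?N (scale (- 2 * of_int n * of_nat (l + 1)) ?y - scale (2 * of_int n) ?y)"
  proof (cases "0 \<le> n")
    case True
    have "(\<Sum>m=1..n. scale (2 * of_nat (l + 1)) ?y) = scale (2 * of_int n * of_nat (l + 1)) ?y"
      using True by (subst sum_constant_scale) (simp add: mult_ac del: of_nat_add)
    then show ?thesis using True K M(2) by (subst sum_reflect_int[where t = t and n = n and K = K, OF C t0]) auto
  next
    case False
    have "(\<Sum>m=n+1..0. scale (2 * of_nat (l + 1)) ?y) = scale (- 2 * of_int n * of_nat (l + 1)) ?y"
      using False by (subst sum_constant_scale) (simp add: mult_ac del: of_nat_add)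
    then show ?thesis using False K M(2) by (subst sum_reflect_int[where t = t and n = n and K = K, OF C t0]) auto
  qed
  also have "\<dots> = scale (- of_int n) ?y"
  proof -
    have 1: "1 + of_nat (l + 1) \<noteq> (0::complex)" by (metis of_nat_Suc of_nat_neq_0)
    have 2: "1 / (2 * (1 + h)) * (- 2 * z * h - 2 * z) = - z" if "1 + h \<noteq> 0" for h z :: complex
    proof -
      have "- 2 * z * h - 2 * z = (2 * (1 + h)) * (- z)" by (simp add: algebra_simps)
      moreover have "1 / D * (D * x) = x" if "D \<noteq> 0" for D x :: complex using that by simp
      moreover have "2 * (1 + h) \<noteq> 0" using that unfolding mult_eq_0_iff by simp
      ultimately show ?thesis by metis
    qed
    show ?thesis unfolding scale_left_diff_distrib[symmetric] scale_scale 2[OF 1] ..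
  qed
  finally show ?thesis by (simp add: algebra_simps)
qed


lemma L0_word_act:
  assumes "word_in l ps"
  shows "L0 (word_act Y ps w) = word_act Y ps (L0 w) + scale (of_int (energy ps)) (word_act Y ps w)"
  using assms
proof (induction ps)
  case (Cons p ps)
  obtain a b m where p: "p = ((a, b), m)" by (metis surj_pair)
  show ?case using Cons unfolding p
    by (simp add: L0_commutator Y_add Y_scale scale_left_diff_distrib algebra_simps)
qed simp

lemma L0_word_vac:
  "word_in l ps \<Longrightarrow> L0 (word_act Y ps v) = scale (of_int (energy ps)) (word_act Y ps v)"
proof (subst L0_word_act)
  have "word_in l ps \<Longrightarrow> word_act Y ps 0 = 0"
  proof (induction ps)
    case (Cons p ps)
    then show ?case by (cases p; cases "fst p") auto
  qed simp
  then show "word_in l ps \<Longrightarrow> word_act Y ps (L0 v) + scale (of_int (energy ps)) (word_act Y ps v) = scale (of_int (energy ps)) (word_act Y ps v)"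
    by (simp add: L0_vac)
qed

section \<open>Singular vectors of positive energy\<close>

lemma eigenvector_span_independent:
  assumes "x \<in> span {w. \<exists>n::int\<ge>N. L0 w = scale (of_int n) w}" "L0 x = scale (of_int k) x" "k < N"
  shows "x = 0"
proof -
  obtain t r where t: "finite t" "t \<subseteq> {w. \<exists>n::int\<ge>N. L0 w = scale (of_int n) w}" "x = (\<Sum>a\<in>t. scale (r a) a)"
    using assms(1) unfolding span_explicit by blast
  obtain e :: "'v \<Rightarrow> int" where e: "e a \<ge> N" "L0 a = scale (of_int (e a)) a" if "a \<in> t" for a
  proof -
    have "\<forall>a\<in>t. \<exists>n::int. n \<ge> N \<and> L0 a = scale (of_int n) a" using t(2) by blast
    from bchoice[OF this] that show ?thesis by blast
  qed
  define D where "D = insert k (e ` t)"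
  \<comment> \<open>The summands of \<open>x\<close> are collected by eigenvalue, and
    \<open>- x\<close> itself is placed at \<open>k\<close>, which no summand has. The total is
    zero, so independence yields \<open>x = 0\<close>.\<close>
  define f where "f n = (if n = k then - x else (\<Sum>a | a \<in> t \<and> e a = n. scale (r a) a))" for n
  have L0_0: "L0 0 = 0" using L0_scale[of 0 0] by simp
  have L0_sum: "L0 (sum g A) = (\<Sum>i\<in>A. L0 (g i))" for g and A :: "'v set"
    by (induction A rule: infinite_finite_induct) (auto simp: L0_add L0_0)
  have "f k = 0"
  proof (rule eigenvectors_independent[where D = D and I = "{()}" and T = "\<lambda>_. L0" and \<mu> = "\<lambda>_ n. of_int n"])
    show "finite D" using t by (simp add: D_def)
    show "L0 (f d) = scale (of_int d) (f d)" if "d \<in> D" for d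
    proof (cases "d = k")
      case True
      have "L0 (- x) = - L0 x" using L0_scale[of "-1" x] by simp
      then show ?thesis using that True assms(2) by (simp add: f_def)
    next
      case False
      then show ?thesis using that e(2) by (simp add: f_def L0_sum L0_scale scale_sum_right mult.commute)
    qed
    have k: "k \<notin> e ` t" using e(1) assms(3) by force
    then have "(\<Sum>d\<in>D. f d) = - x + (\<Sum>d\<in>e ` t. \<Sum>a | a \<in> t \<and> e a = d. scale (r a) a)"
      using t(1) by (simp add: D_def) (auto simp: f_def intro!: sum.cong)
    also have "\<dots> = - x + x" using sum.group[of t "e ` t" e "\<lambda>a. scale (r a) a"] t by simp
    finally show "(\<Sum>d\<in>D. f d) = 0" by simp
    show "k \<in> D" by (simp add: D_def)
  qed (auto simp: L0_add L0_scale)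
  then show ?thesis by (simp add: f_def)
qed

text \<open>As the positive modes kill \<open>w\<close>, the submodule generated by \<open>w\<close>
  is spanned by words of nonpositive modes applied to \<open>w\<close>, hence by vectors of energy
  at least \<open>N\<close>. If \<open>w\<close> were nonzero, irreducibility would put
  \<open>v\<close>, of energy 0, into it.\<close>

lemma singular_vector_zero_aux:
  assumes L: "L0 w = scale (of_int N) w" "1 \<le> N" and s: "\<And>p q k. p \<le> l \<Longrightarrow> q \<le> l \<Longrightarrow> 1 \<le> k \<Longrightarrow> Y p q k w = 0"
  shows "w = 0"
proof (rule ccontr)
  assume "w \<noteq> 0"
  define B where "B = {word_act Y ps w | ps. word_in l ps \<and> (\<forall>p\<in>set ps. snd p \<le> 0)}"
  have low: "Y a b k x \<in> span B" if "a \<le> l" "b \<le> l" "k \<le> 0" "x \<in> span B" for a b k x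
    using that(4)
  proof (induction rule: span_induct_alt)
    case base then show ?case using that by (simp add: span_zero)
  next
    case (step c x y)
    obtain ps where ps: "x = word_act Y ps w" "word_in l ps" "\<forall>p\<in>set ps. snd p \<le> 0" using step(1) by (auto simp: B_def)
    then have "Y a b k x \<in> B" unfolding B_def using that by (auto intro!: exI[of _ "((a,b),k) # ps"])
    then show ?case using step that by (simp add: Y_add Y_scale span_add span_scale span_base)
  qed
  \<comment> \<open>An arbitrary mode is pushed to the right through the word. The brackets act on
    shorter words, whose images are under control for all modes at once, and a positive mode
    arriving at \<open>w\<close> vanishes.\<close>
  have word: "Y a b k (word_act Y ps w) \<in> span B"
    if "a \<le> l" "b \<le> l" "word_in l ps" "\<forall>p\<in>set ps. snd p \<le> 0" for a b k ps
    using that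
  proof (induction ps arbitrary: a b k)
    case Nil
    have "w \<in> B" unfolding B_def by (auto intro!: exI[of _ "[]"])
    then show ?case using low[of a b k w] s[of a b k] Nil by (cases "k \<le> 0") (auto simp: span_base span_zero)
  next
    case (Cons p ps)
    obtain c d n where p: "p = ((c, d), n)" by (metis surj_pair)
    let ?x = "word_act Y ps w"
    have IH: "Y a' b' k' ?x \<in> span B" if "a' \<le> l" "b' \<le> l" for a' b' k'
      using Cons that p by auto
    have x: "?x \<in> span B" using Cons.prems by (intro span_base) (auto simp: B_def p)
    have "Y a b k (Y c d n ?x) \<in> span B"
    proof -
      have cd: "c \<le> l" "d \<le> l" "n \<le> 0" using Cons.prems p by auto
      have "Y c d n (Y a b k ?x) \<in> span B" using low cd IH Cons.prems(1,2) by blast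
      moreover have "Y a d (k + n) ?x \<in> span B" "Y c b (k + n) ?x \<in> span B" using IH cd Cons.prems by auto
      moreover have "scale z ?x \<in> span B" for z using x by (rule span_scale)
      ultimately show ?thesis
        unfolding Y_swap[OF Cons.prems(1,2) cd(1,2)]
        by (intro span_add span_diff) (simp_all add: span_zero)
    qed
    then show ?case by (simp add: p)
  qed
  have closed: "Y a b k x \<in> span B" if "a \<le> l" "b \<le> l" "x \<in> span B" for a b k x
    using that(3)
  proof (induction rule: span_induct_alt)
    case base then show ?case using that by (simp add: span_zero)
  next
    case (step c x y)
    then have "Y a b k x \<in> span B" using word that by (auto simp: B_def)
    then show ?case using step that by (simp add: Y_add Y_scale span_add span_scale)
  qed
  have "w \<in> B" unfolding B_def by (auto intro!: exI[of _ "[]"])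
  then have "span B \<noteq> {0}" using \<open>w \<noteq> 0\<close> span_base by blast
  then have "span B = UNIV" using Y_irreducible[of "span B"] closed by auto
  then have "v \<in> span B" by simp
  moreover have "B \<subseteq> {w. \<exists>n::int\<ge>N. L0 w = scale (of_int n) w}"
  proof
    fix x assume "x \<in> B"
    then obtain ps where ps: "x = word_act Y ps w" "word_in l ps" "\<forall>p\<in>set ps. snd p \<le> 0" by (auto simp: B_def)
    have sc: "word_act Y ps (scale c w) = scale c (word_act Y ps w)" for c
      using ps(2)
    proof (induction ps)
      case (Cons p ps)
      then show ?case by (cases p; cases "fst p") (auto simp: Y_scale)
    qed simp
    have "0 \<le> energy ps" using ps(3) by (induction ps) auto
    moreover have "L0 x = scale (of_int (N + energy ps)) x"
      using ps by (simp add: L0_word_act L sc scale_left_distrib)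
    ultimately show "x \<in> {w. \<exists>n::int\<ge>N. L0 w = scale (of_int n) w}" by (auto intro!: exI[of _ "N + energy ps"])
  qed
  ultimately have "v \<in> span {w. \<exists>n::int\<ge>N. L0 w = scale (of_int n) w}" using span_mono by blast
  then have "v = 0" using eigenvector_span_independent[of v N 0] L0_vac assms(2) by simp
  then show False using v_nonzero by simp
qed

text \<open>The modes 1 generate all higher ones: brackets with diagonal units give the off-diagonal
  elements, and brackets of opposite units give the differences of diagonal ones. All diagonal
  elements then act equally on \<open>w\<close>, and since their sum is zero, each of them
  is.\<close>

lemma singular_vector_zero:
  assumes L: "L0 w = scale (of_int N) w" "1 \<le> N" and s: "\<And>p q. p \<le> l \<Longrightarrow> q \<le> l \<Longrightarrow> Y p q 1 w = 0"
  shows "w = 0"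
proof (rule singular_vector_zero_aux[OF L])
  have "\<forall>p\<le>l. \<forall>q\<le>l. Y p q (int (Suc k)) w = 0" for k
  proof (induction k)
    case 0 then show ?case using s by simp
  next
    case (Suc k)
    let ?k = "int (Suc k)"
    have k: "int (Suc (Suc k)) = 1 + ?k" by simp
    have nz: "1 + ?k \<noteq> 0" by simp
    have off: "Y p q (1 + ?k) w = 0" if "p \<le> l" "q \<le> l" "p \<noteq> q" for p q
      using Y_bracket[of p p p q 1 ?k w] that Suc s nz by simp
    have dg: "Y p p (1 + ?k) w = Y q q (1 + ?k) w" if "p \<le> l" "q \<le> l" for p q
      using Y_bracket[of p q q p 1 ?k w] that Suc s nz by (cases "p = q") simp_all
    have "Y p p (1 + ?k) w = 0" if "p \<le> l" for p
    proof -
      have "0 = (\<Sum>a\<le>l. Y p p (1 + ?k) w)"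
        using Y_trace[of "1 + ?k" w] dg[OF _ that] by (metis (no_types, lifting) atMost_iff sum.cong)
      also have "\<dots> = scale (of_nat (l + 1)) (Y p p (1 + ?k) w)" by (subst sum_constant_scale) simp
      finally show ?thesis by (metis of_nat_eq_0_iff scale_eq_0_iff add_is_0 one_neq_zero)
    qed
    then show ?case unfolding k using off by metis
  qed
  then show "\<And>p q k. p \<le> l \<Longrightarrow> q \<le> l \<Longrightarrow> 1 \<le> k \<Longrightarrow> Y p q k w = 0"
    by (metis Suc_pred' int_one_le_iff_zero_less nonneg_int_cases le_trans zero_le_one of_nat_0_less_iff zero_less_imp_eq_int)
qed

text \<open>Since \<open>\<gg>\<close> kills \<open>v\<close>, the operator \<open>x(1)\<close> maps the \<open>N\<close>-th quadratic vector to the image under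
  \<open>x(0)\<close> of the previous one; induction then leaves only singular vectors of positive energy.\<close>

lemma quadratic_relation:
  assumes ab: "a \<le> l" "b \<le> l" "a \<noteq> b"
  shows "(\<Sum>m=1..<int N. Y a b (- m) (Y a b (m - int N) v)) = 0"
proof (induction N)
  case (Suc N)
  show ?case
  proof (cases "N = 0")
    case True then show ?thesis by simp
  next
    case N: False
    let ?e = "Y a b"
    let ?R = "\<lambda>N. (\<Sum>m=1..<int N. ?e (- m) (?e (m - int N) v))"
    have ins: "{1..<int (Suc N)} = insert (int N) {1..<int N}" "{1..<int (Suc N)} = insert 1 {2..<int (Suc N)}" using N by auto
    show ?thesis
    proof (rule singular_vector_zero[of _ "int (Suc N)"])
      have L0_0: "L0 0 = 0" using L0_scale[of 0 0] by simp
      have L0_sum: "L0 (sum g A) = (\<Sum>i\<in>A. L0 (g i))" for g and A :: "int set"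
        by (induction A rule: infinite_finite_induct) (auto simp: L0_add L0_0)
      have "L0 (?e (- m) (?e (m - int (Suc N)) v)) = scale (of_int (int (Suc N))) (?e (- m) (?e (m - int (Suc N)) v))" for m
        using L0_word_vac[of "[((a,b),-m),((a,b),m - int (Suc N))]"] ab by simp
      then show "L0 (?R (Suc N)) = scale (of_int (int (Suc N))) (?R (Suc N))"
        by (simp only: L0_sum scale_sum_right)
    next
      fix p q assume pq: "p \<le> l" "q \<le> l"
      \<comment> \<open>\<open>\<kappa>\<close> is the invariant form of the two matrix units, and
        \<open>g k\<close> is the mode \<open>k\<close> of their bracket.\<close>
      define \<kappa> where "\<kappa> = (if q = a \<and> p = b then 1 else 0 :: complex)"
      define g where "g k x = (if q = a then Y p b k x else 0) - (if p = b then Y a q k x else 0)" for k x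
      have x1: "Y p q 1 (?e k x) = ?e k (Y p q 1 x) + g (1 + k) x + (if k = - 1 then scale \<kappa> x else 0)" for k x
        using pq ab by (subst Y_swap) (auto simp: g_def \<kappa>_def)
      have x0: "Y p q 0 (?e k x) = ?e k (Y p q 0 x) + g k x" for k x
        using pq ab by (subst Y_swap) (auto simp: g_def)
      have ge: "g 0 (?e k v) = - scale (2 * \<kappa>) (?e k v)" if "k \<noteq> 0" for k
        using that pq ab Y_vac unfolding g_def \<kappa>_def
        by (cases "q = a"; cases "p = b") (simp_all add: Y_swap double)
      \<comment> \<open>The first bracket gives x(0) acting on the inner factor of the relation for
        \<open>N\<close>. The second raises the outer mode to \<open>1 - m\<close>; after reindexing
        by one it supplies the missing half of the Leibniz rule for x(0). The central and end terms
        are kept separate.\<close>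
      have tm: "Y p q 1 (?e (- m) (?e (m - int (Suc N)) v))
         = (?e (- m) (Y p q 0 (?e (m - int N) v)) + (if m = int N then scale \<kappa> (?e (- int N) v) else 0))
          + ((if m = 1 then scale \<kappa> (?e (- int N) v) else 0) + g (1 - m) (?e (m - int (Suc N)) v))" for m
      proof -
        have "m - int (Suc N) = - 1 \<longleftrightarrow> m = int N" "1 + (m - int (Suc N)) = m - int N" by auto
        then have 1: "Y p q 1 (?e (m - int (Suc N)) v) = Y p q 0 (?e (m - int N) v) + (if m = int N then scale \<kappa> v else 0)"
          unfolding x1 x0 using pq ab Y_vac by simp
        show ?thesis unfolding x1[of "- m"] 1 using ab by (auto simp: Y_add Y_scale)
      qed
      have z: "Y p q 0 (?e 0 v) = 0" using Y_vac pq ab by simp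
      have "Y p q 1 (?R (Suc N)) = (\<Sum>m=1..<int (Suc N). ?e (- m) (Y p q 0 (?e (m - int N) v)) + (if m = int N then scale \<kappa> (?e (- int N) v) else 0))
          + (\<Sum>m=1..<int (Suc N). (if m = 1 then scale \<kappa> (?e (- int N) v) else 0) + g (1 - m) (?e (m - int (Suc N)) v))"
        unfolding Y_sum[OF pq] tm by (simp only: sum.distrib)
      also have "(\<Sum>m=1..<int (Suc N). ?e (- m) (Y p q 0 (?e (m - int N) v)) + (if m = int N then scale \<kappa> (?e (- int N) v) else 0))
         = (\<Sum>m=1..<int N. ?e (- m) (Y p q 0 (?e (m - int N) v))) + scale \<kappa> (?e (- int N) v)"
        unfolding ins(1) using ab z by (subst sum.insert) (auto simp: add.commute intro!: sum.cong)
      also have "(\<Sum>m=1..<int (Suc N). (if m = 1 then scale \<kappa> (?e (- int N) v) else 0) + g (1 - m) (?e (m - int (Suc N)) v))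
         = scale \<kappa> (?e (- int N) v) + g 0 (?e (- int N) v) + (\<Sum>m=2..<int (Suc N). g (1 - m) (?e (m - int (Suc N)) v))"
        unfolding ins(2) by (subst sum.insert) (auto simp: intro!: sum.cong)
      also have "(\<Sum>m=2..<int (Suc N). g (1 - m) (?e (m - int (Suc N)) v)) = (\<Sum>m=1..<int N. g (- m) (?e (m - int N) v))"
        by (rule sum.reindex_bij_witness[of _ "\<lambda>m. m + 1" "\<lambda>m. m - 1"]) (auto simp: algebra_simps)
      finally have "Y p q 1 (?R (Suc N)) = (\<Sum>m=1..<int N. ?e (- m) (Y p q 0 (?e (m - int N) v)) + g (- m) (?e (m - int N) v))
          + (scale \<kappa> (?e (- int N) v) + scale \<kappa> (?e (- int N) v) + g 0 (?e (- int N) v))"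
        by (simp add: sum.distrib algebra_simps)
      \<comment> \<open>For the opposite root vector the two central terms together have coefficient
        2 times the level, while the coroot acts on \<open>?e\<close> by the eigenvalue 2 with the
        opposite sign. At level one they cancel.\<close>
      also have "scale \<kappa> (?e (- int N) v) + scale \<kappa> (?e (- int N) v) + g 0 (?e (- int N) v) = 0"
        using N by (simp add: ge scale_left_distrib[symmetric])
      also have "(\<Sum>m=1..<int N. ?e (- m) (Y p q 0 (?e (m - int N) v)) + g (- m) (?e (m - int N) v)) = Y p q 0 (?R N)"
        unfolding Y_sum[OF pq] x0[of "- m" for m] ..
      also have "\<dots> = 0" using Suc.IH pq by simp
      finally show "Y p q 1 (?R (Suc N)) = 0" by simp
    qed simp
  qed
qed simp

end


section \<open>Twists and shifts\<close>

definition positive_word :: "nat \<Rightarrow> letter list \<Rightarrow> bool" where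
  "positive_word l ps \<longleftrightarrow> (\<forall>((a, b), m) \<in> set ps. a < b \<and> b \<le> l)"

lemma positive_word_simps [simp]: "positive_word l []"
  "positive_word l (((a, b), m) # ps) \<longleftrightarrow> a < b \<and> b \<le> l \<and> positive_word l ps"
  "positive_word l (ps @ qs) \<longleftrightarrow> positive_word l ps \<and> positive_word l qs"
  by (simp_all add: positive_word_def ball_Un)

lemma positive_word_in: "positive_word l ps \<Longrightarrow> word_in l ps"
  by (auto simp: positive_word_def word_in_def)

text \<open>The root \<epsilon>_a - \<epsilon>_b is the sum of the simple roots \<alpha>_i with a <
  i \<le> b, so its pairing with each fundamental weight is 0 or 1.\<close>

definition charge :: "letter list \<Rightarrow> nat \<Rightarrow> nat" where
  "charge ps i = (\<Sum>((a, b), m)\<leftarrow>ps. if a < i \<and> i \<le> b then 1 else 0)"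

lemma charge_simps [simp]: "charge [] i = 0"
  "charge (((a, b), m) # ps) i = (if a < i \<and> i \<le> b then 1 else 0) + charge ps i"
  "charge (ps @ qs) i = charge ps i + charge qs i"
  by (simp_all add: charge_def)

text \<open>The diagonal entries of the simple root \<alpha>_j; its pairing with \<epsilon>_a -
  \<epsilon>_b is therefore \<open>alpha j a - alpha j b\<close>.\<close>

definition alpha :: "nat \<Rightarrow> nat \<Rightarrow> int" where
  "alpha j a = (if Suc a = j then 1 else if a = j then - 1 else 0)"

definition twist_word :: "nat \<Rightarrow> letter list \<Rightarrow> letter list" where
  "twist_word j = map (\<lambda>((a, b), m). ((a, b), m - (alpha j a - alpha j b)))"

lemma twist_word_simps [simp]: "twist_word j [] = []"
  "twist_word j (((a, b), m) # ps) = ((a, b), m - (alpha j a - alpha j b)) # twist_word j ps"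
  "twist_word j (ps @ qs) = twist_word j ps @ twist_word j qs"
  by (simp_all add: twist_word_def)

lemma positive_twist_word [simp]: "positive_word l (twist_word j ps) = positive_word l ps"
  by (induction ps) auto

lemma charge_twist_word [simp]: "charge (twist_word j ps) i = charge ps i"
  by (induction ps) auto

text \<open>Both sides are the pairing of \<epsilon>_a - \<epsilon>_b with \<alpha>_j, on the left
  expanded in simple roots. This converts the twist of modes into the exponents of q in the
  recursion.\<close>

lemma cartan_pairing:
  assumes "a < b" "b \<le> l" "j \<in> {1..l}"
  shows "(\<Sum>i = 1..l. cartan_entry j i * int (if a < i \<and> i \<le> b then 1 else 0)) = alpha j a - alpha j b"
proof -
  let ?c = "\<lambda>i. if a < i \<and> i \<le> b then 1 else 0 :: int"
  have "(\<Sum>i = 1..l. cartan_entry j i * int (if a < i \<and> i \<le> b then 1 else 0)) =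
    (\<Sum>i = 1..l. (if i = j then 2 * ?c j else 0) - (if i = j + 1 then ?c (j + 1) else 0) - (if i = j - 1 then ?c (j - 1) else 0))"
    by (intro sum.cong refl) (use assms in \<open>auto simp: cartan_entry_def\<close>)
  \<comment> \<open>At the ends of the diagram \<open>j + 1\<close> or \<open>j - 1\<close> leaves
    the range of summation, but the charge of the root is 0 there.\<close>
  also have "\<dots> = 2 * ?c j - ?c (j + 1) - ?c (j - 1)"
    using assms by (simp add: sum_subtractf del: sum.cl_ivl_Suc)
  also have "\<dots> = alpha j a - alpha j b"
    using assms unfolding alpha_def by auto
  finally show ?thesis .
qed

lemma energy_twist_word:
  assumes "positive_word l ps" "j \<in> {1..l}"
  shows "energy (twist_word j ps) = energy ps + (\<Sum>i = 1..l. cartan_entry j i * int (charge ps i))"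
  using assms
proof (induction ps)
  case (Cons p ps)
  obtain a b m where p: "p = ((a, b), m)" by (metis surj_pair)
  have "(\<Sum>i = 1..l. cartan_entry j i * int (charge (p # ps) i)) =
     (\<Sum>i = 1..l. cartan_entry j i * int (if a < i \<and> i \<le> b then 1 else 0)) + (\<Sum>i = 1..l. cartan_entry j i * int (charge ps i))"
    by (simp only: p charge_simps of_nat_add distrib_left sum.distrib)
  also have "(\<Sum>i = 1..l. cartan_entry j i * int (if a < i \<and> i \<le> b then 1 else 0)) = alpha j a - alpha j b"
    using Cons.prems by (intro cartan_pairing) (auto simp: p)
  finally show ?case using Cons by (simp add: p)
qed simp

definition shift_word :: "nat \<Rightarrow> int \<Rightarrow> letter list \<Rightarrow> letter list" where
  "shift_word j s = map (\<lambda>((a, b), m). ((a, b), if a < j \<and> j \<le> b then m + s else m))"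

lemma shift_word_simps [simp]: "shift_word j s [] = []"
  "shift_word j s (((a, b), m) # ps) = ((a, b), if a < j \<and> j \<le> b then m + s else m) # shift_word j s ps"
  "shift_word j s (ps @ qs) = shift_word j s ps @ shift_word j s qs"
  by (simp_all add: shift_word_def)

lemma positive_shift_word [simp]: "positive_word l (shift_word j s ps) = positive_word l ps"
  by (induction ps) auto

lemma charge_shift_word [simp]: "charge (shift_word j s ps) i = charge ps i"
  by (induction ps) auto

lemma energy_shift_word: "energy (shift_word j s ps) = energy ps - s * int (charge ps j)"
  by (induction ps) (auto simp: algebra_simps)

lemma shift_word_shift_word: "shift_word j s (shift_word j t ps) = shift_word j (s + t) ps"
  by (induction ps) auto

lemma shift_word_0: "shift_word j 0 ps = ps"
  by (induction ps) auto

context loop_module begin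

text \<open>
  The automorphism \<open>x\<^sub>\<gamma>(m) \<mapsto> x\<^sub>\<gamma>(m - \<langle>\<gamma>, \<alpha>\<^sub>j\<rangle>)\<close>, \<open>h(m) \<mapsto> h(m) - \<delta>\<^bsub>m,0\<^esub> \<langle>h, \<alpha>\<^sub>j\<rangle> c\<close>, for which
  \<open>x\<^sub>j(-1) v\<close> is a vacuum vector.
\<close>

definition twist :: "nat \<Rightarrow> nat \<Rightarrow> nat \<Rightarrow> int \<Rightarrow> 'v \<Rightarrow> 'v" where
  "twist j a b m w = Y a b (m - (alpha j a - alpha j b)) w - (if a = b \<and> m = 0 then scale (of_int (alpha j a)) w else 0)"

lemma word_act_twist: "positive_word l ps \<Longrightarrow> word_act (twist j) ps w = word_act Y (twist_word j ps) w"
proof (induction ps)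
  case (Cons p ps)
  then show ?case by (cases p; cases "fst p") (auto simp: twist_def)
qed simp

lemma Y_minus: "a \<le> l \<Longrightarrow> b \<le> l \<Longrightarrow> Y a b m (- x) = - Y a b m x"
  using Y_diff[of a b m 0 x] by simp

lemma square_zero:
  assumes "a \<le> l" "b \<le> l" "a \<noteq> b"
  shows "Y a b (- 1) (Y a b (- 1) v) = 0"
proof -
  have "{1..<int 2} = {1}" by auto
  then show ?thesis using quadratic_relation[OF assms, of 2] by simp
qed

lemma product_zero:
  assumes "a \<le> l" "b \<le> l" "a \<noteq> b"
  shows "Y a b (- 2) (Y a b (- 1) v) = 0"
proof -
  have i: "{1..<3} = {1, 2::int}" by auto
  have "Y a b (- 2) (Y a b (- 1) v) = Y a b (- 1) (Y a b (- 2) v)"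
    using assms by (intro Y_commute) auto
  then have "scale 2 (Y a b (- 2) (Y a b (- 1) v)) = 0"
    using quadratic_relation[OF assms, of 3] by (simp add: i double)
  then show ?thesis by simp
qed

text \<open>A root vector of mode 0 kills \<open>v\<close> and acts as a derivation. Applied to the
  vanishing square it yields twice the mixed product, up to sign.\<close>

lemma adjacent_product_zero:
  assumes "a \<le> l" "b \<le> l" "c \<le> l" "a \<noteq> b" "c \<noteq> a" "c \<noteq> b"
  shows "Y a c (- 1) (Y a b (- 1) v) = 0" and "Y c b (- 1) (Y a b (- 1) v) = 0"
proof -
  have "Y b c 0 (Y a b (- 1) (Y a b (- 1) v)) = 0" using assms by (simp add: square_zero)
  moreover have "Y a b (- 1) (Y a c (- 1) v) = Y a c (- 1) (Y a b (- 1) v)"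
    using assms by (intro Y_commute) auto
  ultimately have "scale 2 (Y a c (- 1) (Y a b (- 1) v)) = 0"
    using assms Y_vac by (simp add: Y_swap[of b c a b] Y_diff Y_minus double eq_neg_iff_add_eq_0 neg_eq_iff_add_eq_0)
  then show "Y a c (- 1) (Y a b (- 1) v) = 0" by simp
  have "Y c a 0 (Y a b (- 1) (Y a b (- 1) v)) = 0" using assms by (simp add: square_zero)
  moreover have "Y a b (- 1) (Y c b (- 1) v) = Y c b (- 1) (Y a b (- 1) v)"
    using assms by (intro Y_commute) auto
  ultimately have "scale 2 (Y c b (- 1) (Y a b (- 1) v)) = 0"
    using assms Y_vac by (simp add: Y_swap[of c a a b] Y_add double)
  then show "Y c b (- 1) (Y a b (- 1) v) = 0" by simp
qed

text \<open>A twisted mode \<open>m \<ge> 0\<close> becomes negative only for roots pairing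
  positively with \<alpha>_j. It is then -1 or -2 for \<alpha>_j itself and -1 for its neighbours,
  and exactly these products with x_j(-1) were shown to vanish. On the diagonal, the scalar
  subtracted in \<open>twist\<close> is the weight of x_j(-1) v.\<close>

lemma twist_vac:
  assumes ab: "a \<le> l" "b \<le> l" "0 \<le> m" and j: "j \<in> {1..l}"
  shows "twist j a b m (Y (j - 1) j (- 1) v) = 0"
proof -
  define p where "p = j - 1"
  have jp: "j = Suc p" and p: "p < l" using j by (auto simp: p_def)
  have al: "alpha j i = (if i = p then 1 else if i = j then - 1 else 0)" for i
    by (auto simp: alpha_def jp)
  have Yv: "Y c d k v = 0" if "c \<le> l" "d \<le> l" "0 \<le> k" for c d k using Y_vac that by simp
  have sw: "Y a b k (Y p j (- 1) v) = Y p j (- 1) (Y a b k v)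
     + ((if b = p then Y a j (k - 1) v else 0) - (if a = j then Y p b (k - 1) v else 0)
      + (if k = 1 then scale (if b = p \<and> a = j then 1 else 0) v else 0))" for k
    using ab p j by (subst Y_swap) (auto simp: jp)
  have e: "m = 0 \<or> m = 1 \<or> m \<ge> 2" using ab by linarith
  \<comment> \<open>The pairing of \<epsilon>_a - \<epsilon>_b with \<alpha>_j in the nine cases is
    2, -2, 0, 0, 1, -1, -1, 1, 0.\<close>
  consider "a = p" "b = j" | "a = j" "b = p" | "a = p" "b = p" | "a = j" "b = j"
    | "a = p" "b \<noteq> p" "b \<noteq> j" | "a = j" "b \<noteq> p" "b \<noteq> j" | "b = p" "a \<noteq> p" "a \<noteq> j" | "b = j" "a \<noteq> p" "a \<noteq> j"
    | "a \<noteq> p" "a \<noteq> j" "b \<noteq> p" "b \<noteq> j" by blast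
  then have "twist j a b m (Y p j (- 1) v) = 0"
  proof cases
    case 1
    have "Y p j (m - 2) (Y p j (- 1) v) = 0" if "2 \<le> m"
      using sw[of "m - 2"] that ab p j Yv 1 by (simp add: jp)
    with 1 show ?thesis using e ab p j square_zero[of p j] product_zero[of p j] Yv unfolding twist_def al
      by (auto simp: jp sw)
  next
    case 2
    have "Y j p (m + 2) (Y p j (- 1) v) = 0"
      using sw[of "m + 2"] ab p j Yv 2 by (simp add: jp)
    with 2 show ?thesis using ab p j Yv unfolding twist_def al by (auto simp: jp sw)
  next
    case 3
    then show ?thesis using e ab p j Yv sw[of m] unfolding twist_def al by (auto simp: jp)
  next
    case 4
    then show ?thesis using e ab p j Yv sw[of m] unfolding twist_def al by (auto simp: jp)
  next
    case 5
    then show ?thesis using e ab p j Yv adjacent_product_zero(1)[of p j b] sw[of "m - 1"] unfolding twist_def al by (auto simp: jp)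
  next
    case 6
    then show ?thesis using ab p j Yv sw[of "m + 1"] unfolding twist_def al by (auto simp: jp)
  next
    case 7
    then show ?thesis using ab p j Yv sw[of "m + 1"] unfolding twist_def al by (auto simp: jp)
  next
    case 8
    then show ?thesis using e ab p j Yv adjacent_product_zero(2)[of p j a] sw[of "m - 1"] unfolding twist_def al by (auto simp: jp)
  next
    case 9
    then show ?thesis using ab p j Yv sw[of "m"] unfolding twist_def al by (auto simp: jp)
  qed
  then show ?thesis by (simp add: p_def)
qed

text \<open>Twisting is additive on roots, so only the central term needs an argument: for opposite
  roots the factor \<open>m\<close> changes by the pairing with \<alpha>_j, and the scalars in the
  two diagonal elements of the bracket compensate for this.\<close>

lemma twist_bracket:
  assumes i: "a \<le> l" "b \<le> l" "c \<le> l" "d \<le> l"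
  shows "twist j a b m (twist j c d n w) - twist j c d n (twist j a b m w) =
        (if b = c then twist j a d (m + n) w else 0) - (if a = d then twist j c b (m + n) w else 0)
        + (if m + n = 0 then scale (of_int m * ((if b = c \<and> a = d then 1 else 0)
            - (if a = b \<and> c = d then 1 / of_nat (l + 1) else 0))) w else 0)"
proof -
  define m' where "m' = m - (alpha j a - alpha j b)"
  define n' where "n' = n - (alpha j c - alpha j d)"
  let ?k = "\<lambda>m. scale (of_int m * ((if b = c \<and> a = d then 1 else 0) - (if a = b \<and> c = d then 1 / of_nat (l + 1) else 0))) w"
  define x where "x = (if a = b \<and> m = 0 then of_int (alpha j a) else 0 :: complex)"
  define y where "y = (if c = d \<and> n = 0 then of_int (alpha j c) else 0 :: complex)"
  have tx: "twist j a b m u = Y a b m' u - scale x u" for u by (simp add: twist_def x_def m'_def)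
  have ty: "twist j c d n u = Y c d n' u - scale y u" for u by (simp add: twist_def y_def n'_def)
  have "twist j a b m (twist j c d n w) - twist j c d n (twist j a b m w)
     = Y a b m' (Y c d n' w) - Y c d n' (Y a b m' w)"
    unfolding tx ty using i by (simp add: Y_diff Y_scale scale_right_diff_distrib mult.commute)
  also have "\<dots> = (if b = c then Y a d (m' + n') w else 0) - (if a = d then Y c b (m' + n') w else 0)
        + (if m' + n' = 0 then ?k m' else 0)"
    using i by (rule Y_bracket)
  also have "\<dots> = (if b = c then twist j a d (m + n) w else 0) - (if a = d then twist j c b (m + n) w else 0)
        + (if m + n = 0 then ?k m else 0)"
  proof (cases "b = c")
    case b: True
    have mn: "m' + n' = m + n - (alpha j a - alpha j d)" using b by (simp add: m'_def n'_def)
    show ?thesis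
    proof (cases "a = d")
      case a: True
      show ?thesis
      proof (cases "a = b")
        case True
        then show ?thesis using a b by (simp add: m'_def n'_def twist_def)
      next
        case False
        then show ?thesis using a b by (simp add: twist_def m'_def n'_def scale_left_diff_distrib)
      qed
    next
      case False
      then show ?thesis using b mn by (simp add: twist_def)
    qed
  next
    case b: False
    show ?thesis
    proof (cases "a = d")
      case a: True
      then have "m' + n' = m + n - (alpha j c - alpha j b)" by (simp add: m'_def n'_def)
      then show ?thesis using a b by (simp add: twist_def)
    next
      case False
      then show ?thesis using b by (simp add: m'_def n'_def)
    qed
  qed
  finally show ?thesis .
qed

lemma twist_loop_module:
  assumes j: "j \<in> {1..l}"
  shows "loop_module scale l (twist j) (Y (j - 1) j (- 1) v)"
proof
  fix a b c d :: nat and m n :: int and w x y z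
  assume ab: "a \<le> l" "b \<le> l"
  show "twist j a b m (x + y) = twist j a b m x + twist j a b m y"
    using ab by (simp add: twist_def Y_add scale_right_distrib)
  show "twist j a b m (scale z x) = scale z (twist j a b m x)"
    using ab by (simp add: twist_def Y_scale scale_right_diff_distrib mult.commute)
  show "twist j a b m (Y (j - 1) j (- 1) v) = 0" if "0 \<le> m"
    using ab that j by (rule twist_vac)
next
  fix a b c d :: nat and m n :: int and w
  assume "a \<le> l" "b \<le> l" "c \<le> l" "d \<le> l"
  then show "twist j a b m (twist j c d n w) - twist j c d n (twist j a b m w) =
        (if b = c then twist j a d (m + n) w else 0) - (if a = d then twist j c b (m + n) w else 0)
        + (if m + n = 0 then scale (of_int m * ((if b = c \<and> a = d then 1 else 0)
            - (if a = b \<and> c = d then 1 / of_nat (l + 1) else 0))) w else 0)"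
    by (rule twist_bracket)
next
  fix m w
  \<comment> \<open>The added scalars respect the trace relation because the matrix \<alpha>_j is
    traceless.\<close>
  have "(\<Sum>a\<le>l. alpha j a) = (\<Sum>a\<le>l. (if a = j - 1 then 1 else 0) - (if a = j then 1 else 0))"
    using j by (intro sum.cong) (auto simp: alpha_def)
  also have "\<dots> = 0" using j by (auto simp: sum_subtractf)
  finally have "(\<Sum>a\<le>l. of_int (alpha j a)) = (0::complex)"
    by (metis of_int_0 of_int_sum)
  then have "(\<Sum>a\<le>l. scale (of_int (alpha j a)) w) = 0"
    by (simp add: scale_sum_left[symmetric])
  then show "(\<Sum>a\<le>l. twist j a a m w) = 0"
    by (cases "m = 0") (simp_all add: twist_def sum_subtractf Y_trace)
next
  fix S assume S: "subspace S" "\<And>a b m w. a \<le> l \<Longrightarrow> b \<le> l \<Longrightarrow> w \<in> S \<Longrightarrow> twist j a b m w \<in> S"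
  show "S = {0} \<or> S = UNIV"
  proof (rule Y_irreducible[OF S(1)])
    fix a b m w assume h: "a \<le> l" "b \<le> l" "w \<in> S"
    \<comment> \<open>The original operators are recovered from the twisted ones and scalars, so
      both actions have the same invariant subspaces.\<close>
    have "Y a b m w = twist j a b (m + (alpha j a - alpha j b)) w
        + (if a = b \<and> m = 0 then scale (of_int (alpha j a)) w else 0)"
      by (auto simp: twist_def)
    also have "\<dots> \<in> S"
      using S h subspace_scale[OF S(1) h(3)] by (intro subspace_add[OF S(1)]) (auto simp: subspace_0)
    finally show "Y a b m w \<in> S" .
  qed
next
  have j': "j - 1 \<le> l" "j \<le> l" "j - 1 \<noteq> j" using j by auto
  show "Y (j - 1) j (- 1) v \<noteq> 0"
  proof
    assume "Y (j - 1) j (- 1) v = 0"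
    \<comment> \<open>The opposite root vector of mode 1 returns x_j(-1) v to \<open>v\<close>: the
      bracket part kills \<open>v\<close>, and the central term is the identity.\<close>
    then have "0 = Y j (j - 1) 1 (Y (j - 1) j (- 1) v)" using j' by simp
    also have "\<dots> = v" using j' Y_vac by (subst Y_swap) auto
    finally show False using v_nonzero by simp
  qed
qed

section \<open>Exponential of the modes of a fundamental weight\<close>

definition lam :: "nat \<Rightarrow> int \<Rightarrow> 'v \<Rightarrow> 'v" where
  "lam j n w = (\<Sum>a<j. Y a a n w)"

lemma lam_add: "j \<le> l \<Longrightarrow> lam j n (x + y) = lam j n x + lam j n y"
  by (simp add: lam_def Y_add sum.distrib)

lemma lam_scale: "j \<le> l \<Longrightarrow> lam j n (scale c x) = scale c (lam j n x)"
  by (simp add: lam_def Y_scale scale_sum_right)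

lemma lam_0: "j \<le> l \<Longrightarrow> lam j n 0 = 0"
  by (simp add: lam_def)

lemma lam_Y:
  assumes "a < b" "b \<le> l" "j \<le> l"
  shows "lam j n (Y a b m w) = Y a b m (lam j n w) + (if a < j \<and> j \<le> b then Y a b (m + n) w else 0)"
proof -
  have "Y i i n (Y a b m w) = Y a b m (Y i i n w) + ((if i = a then Y a b (m + n) w else 0) - (if i = b then Y a b (m + n) w else 0))"
    if "i < j" for i
    using assms that by (subst Y_swap) (auto simp: add.commute)
  then have "lam j n (Y a b m w) = (\<Sum>i<j. Y a b m (Y i i n w) + ((if i = a then Y a b (m + n) w else 0) - (if i = b then Y a b (m + n) w else 0)))"
    unfolding lam_def by (intro sum.cong) auto
  also have "\<dots> = Y a b m (lam j n w) + (if a < j \<and> j \<le> b then Y a b (m + n) w else 0)"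
    using assms by (simp add: sum.distrib sum_subtractf lam_def Y_sum)
  finally show ?thesis .
qed

lemma lam_vac: "j \<le> l \<Longrightarrow> 0 \<le> n \<Longrightarrow> lam j n v = 0"
  by (simp add: lam_def Y_vac)

fun shift_op :: "nat \<Rightarrow> nat \<Rightarrow> 'v \<Rightarrow> 'v" where
  "shift_op j 0 w = w"
| "shift_op j (Suc s) w = scale (1 / of_nat (Suc s)) (\<Sum>i\<le>s. scale ((- 1) ^ i) (lam j (int i + 1) (shift_op j (s - i) w)))"

declare shift_op.simps(2) [simp del]

lemma shift_op_Suc: "scale (of_nat (Suc s)) (shift_op j (Suc s) w) = (\<Sum>i\<le>s. scale ((- 1) ^ i) (lam j (int i + 1) (shift_op j (s - i) w)))"
  by (subst shift_op.simps) (simp del: of_nat_Suc)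

lemma shift_op_add: "j \<le> l \<Longrightarrow> shift_op j s (x + y) = shift_op j s x + shift_op j s y"
proof (induction s rule: less_induct)
  case (less s)
  then show ?case
    by (cases s) (simp_all add: shift_op.simps(2) lam_add scale_right_distrib sum.distrib)
qed

lemma shift_op_scale: "j \<le> l \<Longrightarrow> shift_op j s (scale c x) = scale c (shift_op j s x)"
proof (induction s rule: less_induct)
  case (less s)
  then show ?case
    by (cases s) (simp_all add: shift_op.simps(2) lam_scale scale_sum_right mult_ac)
qed

lemma shift_op_vac: "j \<le> l \<Longrightarrow> shift_op j s v = (if s = 0 then v else 0)"
proof (induction s rule: less_induct)
  case (less s)
  show ?case
  proof (cases s)
    case (Suc k)
    have "lam j (int i + 1) (shift_op j (k - i) v) = 0" if "i \<le> k" for i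
      using less that Suc by (cases "k - i = 0") (simp_all add: lam_0 lam_vac)
    then show ?thesis using Suc by (simp add: shift_op.simps(2))
  qed simp
qed

text \<open>The generating series of \<open>shift_op j\<close> is \<open>exp (- \<Sum>n\<ge>1. (- z)\<^sup>n \<lambda>\<^sub>j(n) / n)\<close>, written by
  Newton's identities; conjugating \<open>x\<^sub>\<gamma>(m)\<close> with it gives \<open>x\<^sub>\<gamma>(m) + z x\<^sub>\<gamma>(m + 1)\<close> if
  \<open>\<langle>\<lambda>\<^sub>j, \<gamma>\<rangle> = 1\<close>.\<close>

lemma shift_op_Y:
  assumes ab: "a < b" "b \<le> l" "j \<le> l"
  shows "shift_op j s (Y a b m w) = Y a b m (shift_op j s w)
     + (if a < j \<and> j \<le> b \<and> 0 < s then Y a b (m + 1) (shift_op j (s - 1) w) else 0)"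
proof (induction s rule: less_induct)
  case (less s)
  show ?case
  proof (cases s)
    case (Suc k)
    have a: "a \<le> l" using ab by simp
    let ?sg = "\<lambda>i x. scale ((- 1) ^ i) x"
    let ?E = "\<lambda>s. shift_op j s w"
    show ?thesis
    proof (cases "a < j \<and> j \<le> b")
      case True
      \<comment> \<open>\<open>G i\<close> arises when \<lambda>_j(i + 1) meets the root vector in
        the first term of the induction hypothesis. The second term yields \<open>G (Suc i)\<close>
        with the same sign, so the alternating sums telescope to \<open>G 0\<close>, which completes
        the factor \<open>k\<close> to \<open>k + 1\<close>.\<close>
      define G where "G i = Y a b (m + int i + 1) (?E (k - i))" for i
      have t: "?sg i (lam j (int i + 1) (shift_op j (k - i) (Y a b m w)))
        = Y a b m (?sg i (lam j (int i + 1) (?E (k - i)))) + ?sg i (G i)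
         + (if i < k then Y a b (m + 1) (?sg i (lam j (int i + 1) (?E (k - 1 - i)))) + ?sg i (G (Suc i)) else 0)"
        if "i \<le> k" for i
      proof -
        have "shift_op j (k - i) (Y a b m w) = Y a b m (?E (k - i)) + (if i < k then Y a b (m + 1) (?E (k - 1 - i)) else 0)"
          using less[of "k - i"] Suc True by (auto simp: diff_diff_add)
        then show ?thesis using True ab a that
          by (simp add: lam_add lam_Y lam_0 G_def scale_right_distrib Y_scale add_ac)
      qed
      have tel: "(\<Sum>i\<le>k. ?sg i (G i)) + (\<Sum>i<k. ?sg i (G (Suc i))) = G 0" for k
        by (induction k) auto
      have "scale (of_nat (Suc k)) (shift_op j (Suc k) (Y a b m w))
        = (\<Sum>i\<le>k. Y a b m (?sg i (lam j (int i + 1) (?E (k - i)))) + ?sg i (G i)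
         + (if i < k then Y a b (m + 1) (?sg i (lam j (int i + 1) (?E (k - 1 - i)))) + ?sg i (G (Suc i)) else 0))"
        unfolding shift_op_Suc by (intro sum.cong refl t) auto
      also have "\<dots> = (\<Sum>i\<le>k. Y a b m (?sg i (lam j (int i + 1) (?E (k - i))))) + (\<Sum>i\<le>k. ?sg i (G i))
         + ((\<Sum>i<k. Y a b (m + 1) (?sg i (lam j (int i + 1) (?E (k - 1 - i))))) + (\<Sum>i<k. ?sg i (G (Suc i))))"
      proof -
        have "{i \<in> {..k}. i < k} = {..<k}" by auto
        then show ?thesis by (simp add: sum.distrib sum.inter_filter[symmetric])
      qed
      also have "(\<Sum>i\<le>k. Y a b m (?sg i (lam j (int i + 1) (?E (k - i))))) = scale (of_nat (Suc k)) (Y a b m (?E (Suc k)))"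
        unfolding Y_sum[OF a ab(2), symmetric] shift_op_Suc[symmetric] by (rule Y_scale[OF a ab(2)])
      also have "(\<Sum>i<k. Y a b (m + 1) (?sg i (lam j (int i + 1) (?E (k - 1 - i))))) = scale (of_nat k) (Y a b (m + 1) (?E k))"
      proof (cases k)
        case (Suc k')
        have "{..<Suc k'} = {..k'}" by auto
        then show ?thesis 
          unfolding Suc Y_sum[OF a ab(2), symmetric] diff_Suc_1 by (simp only: shift_op_Suc[symmetric] Y_scale[OF a ab(2)])
      qed simp
      finally have "scale (of_nat (Suc k)) (shift_op j (Suc k) (Y a b m w))
         = scale (of_nat (Suc k)) (Y a b m (?E (Suc k))) + ((scale (of_nat k) (Y a b (m + 1) (?E k))) + ((\<Sum>i\<le>k. ?sg i (G i)) + (\<Sum>i<k. ?sg i (G (Suc i)))))"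
        by (simp only: add_ac)
      also have "\<dots> = scale (of_nat (Suc k)) (Y a b m (?E (Suc k)) + Y a b (m + 1) (?E k))"
        unfolding tel by (simp add: G_def scale_right_distrib scale_left_distrib add_ac)
      finally show ?thesis using True Suc by (simp del: of_nat_Suc)
    next
      case False
      have "scale (of_nat (Suc k)) (shift_op j (Suc k) (Y a b m w)) = (\<Sum>i\<le>k. Y a b m (?sg i (lam j (int i + 1) (?E (k - i)))))"
        unfolding shift_op_Suc
      proof (intro sum.cong refl)
        fix i assume "i \<in> {..k}"
        then have "shift_op j (k - i) (Y a b m w) = Y a b m (?E (k - i))"
          using less[of "k - i"] Suc False by auto
        then show "?sg i (lam j (int i + 1) (shift_op j (k - i) (Y a b m w))) = Y a b m (?sg i (lam j (int i + 1) (?E (k - i))))"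
          using ab a False by (auto simp: lam_Y Y_scale)
      qed
      also have "\<dots> = scale (of_nat (Suc k)) (Y a b m (?E (Suc k)))"
        unfolding Y_sum[OF a ab(2), symmetric] shift_op_Suc[symmetric] by (rule Y_scale[OF a ab(2)])
      finally show ?thesis using False Suc by (auto simp del: of_nat_Suc)
    qed
  qed simp
qed

text \<open>Each factor of \<lambda>_j-charge 1 absorbs at most one unit of \<open>s\<close>, the
  others none. When \<open>s\<close> equals the charge, every charged factor must absorb one; any
  surplus reaches \<open>v\<close> and vanishes.\<close>

lemma shift_op_word:
  assumes "positive_word l ps" "j \<le> l" "charge ps j \<le> s"
  shows "shift_op j s (word_act Y ps v) = (if s = charge ps j then word_act Y (shift_word j 1 ps) v else 0)"
  using assms
proof (induction ps arbitrary: s)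
  case Nil then show ?case by (simp add: shift_op_vac)
next
  case (Cons p ps)
  obtain a b m where p: "p = ((a, b), m)" by (metis surj_pair)
  have ab: "a < b" "b \<le> l" "a \<le> l" "positive_word l ps" using Cons.prems by (auto simp: p)
  show ?case
  proof (cases "a < j \<and> j \<le> b")
    case True
    have s: "0 < s" "charge ps j \<le> s - 1" "s \<noteq> charge ps j" using Cons.prems True by (auto simp: p)
    then show ?thesis using Cons.IH[of s] Cons.IH[of "s - 1"] ab Cons.prems(2) True
      by (auto simp: p shift_op_Y)
  next
    case False
    then show ?thesis using Cons.IH[of s] ab Cons.prems(2,3)
      by (auto simp: p shift_op_Y)
  qed
qed

end


section \<open>Functionals on words\<close>

text \<open>The value of \<open>F\<close> on a word is that of a functional on the word applied to \<open>v\<close>.\<close>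

locale vacuum_functional =
  fixes l :: nat and F :: "letter list \<Rightarrow> complex"
  assumes F_swap: "positive_word l (p @ ((a, b), m) # ((c, d), n) # s) \<Longrightarrow>
      F (p @ ((a, b), m) # ((c, d), n) # s) = F (p @ ((c, d), n) # ((a, b), m) # s)
        + (if b = c then F (p @ ((a, d), m + n) # s) else 0) - (if a = d then F (p @ ((c, b), m + n) # s) else 0)"
    and F_vac: "positive_word l (p @ [((a, b), m)]) \<Longrightarrow> 0 \<le> m \<Longrightarrow> F (p @ [((a, b), m)]) = 0"
    and F_quad: "positive_word l p \<Longrightarrow> i \<in> {1..l} \<Longrightarrow>
      (\<Sum>m=1..<N. F (p @ [((i - 1, i), - m), ((i - 1, i), m - N)])) = 0"
begin

lemma F_commute:
  assumes "positive_word l (p @ ((a, b), m) # ((c, d), n) # s)" "b \<noteq> c" "a \<noteq> d"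
  shows "F (p @ ((a, b), m) # ((c, d), n) # s) = F (p @ ((c, d), n) # ((a, b), m) # s)"
  using F_swap[OF assms(1)] assms(2,3) by simp

text \<open>A leading letter of negative mode can be moved into the prefix, as the rest still has
  negative energy. A leading letter of nonnegative mode is carried to the right end, where it gives
  zero. The prefix is arbitrary so that the induction may do this.\<close>

lemma negative_energy:
  assumes "positive_word l (p @ ps)" "energy ps < 0"
  shows "F (p @ ps) = 0"
  using assms
proof (induction "length ps" arbitrary: p ps rule: less_induct)
  case less
  show ?case
  proof (cases ps)
    case Nil
    then show ?thesis using less.prems by simp
  next
    case (Cons x qs)
    obtain a b m where x: "x = ((a, b), m)" by (metis surj_pair)
    have pos: "positive_word l p" "a < b" "b \<le> l" "positive_word l qs" using less.prems Cons x by auto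
    show ?thesis
    proof (cases "m < 0")
      case True
      then show ?thesis using less.hyps[of qs "p @ [x]"] less.prems Cons x by simp
    next
      case False
      \<comment> \<open>Every exchange leaves a bracket in which two letters are merged: the energy
        is unchanged and the word is shorter, so the outer induction applies.\<close>
      have "F (p @ q1 @ x # q2) = 0" if "qs = q1 @ q2" for q1 q2
        using that
      proof (induction q2 arbitrary: q1)
        case Nil
        then show ?case using F_vac[of "p @ q1" a b m] False pos x by simp
      next
        case (Cons y q3)
        obtain c d n where y: "y = ((c, d), n)" by (metis surj_pair)
        have cd: "c < d" "d \<le> l" "positive_word l q1" "positive_word l q3" using Cons.prems pos y by auto
        have en: "energy (q1 @ ((g, h), m + n) # q3) < 0" for g h
          using less.prems(2) \<open>ps = x # qs\<close> Cons.prems x y by simp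
        have len: "length (q1 @ ((g, h), m + n) # q3) < length ps" for g h
          using \<open>ps = x # qs\<close> Cons.prems by simp
        have z: "F (p @ q1 @ ((g, h), m + n) # q3) = 0" if "g < h" "h \<le> l" for g h
          using less.hyps[OF len[of g h], of p] en[of g h] that pos cd by simp
        have "F (p @ (q1 @ [y]) @ x # q3) = 0" using Cons by (intro Cons.IH) simp
        then have "F (p @ q1 @ y # x # q3) = 0" by simp
        moreover have "a < d" if "b = c" using that pos cd by simp
        moreover have "c < b" if "a = d" using that pos cd by simp
        ultimately show ?case
          using F_swap[of "p @ q1" a b m c d n q3] pos cd x y z by auto
      qed
      from this[of "[]" qs] show ?thesis using Cons by simp
    qed
  qed
qed

text \<open>The commutators survive because \<lambda>_j-charge is additive on roots. The other
  relations acquire modes one lower, and the assumption on words ending in x_j(-1) supplies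
  precisely what they then lack.\<close>

lemma unshift:
  assumes j: "j \<in> {1..l}" and van: "\<And>p. positive_word l p \<Longrightarrow> F (p @ [((j - 1, j), - 1)]) = 0"
  shows "vacuum_functional l (\<lambda>ps. F (shift_word j (- 1) ps))"
proof
  fix p s :: "letter list" and a b c d :: nat and m n :: int
  assume pos: "positive_word l (p @ ((a, b), m) # ((c, d), n) # s)"
  then have ab: "a < b" "c < d" by simp_all
  let ?c = "\<lambda>a b m. if a < j \<and> j \<le> b then m + - 1 else m :: int"
  have "F (shift_word j (- 1) p @ ((a, b), ?c a b m) # ((c, d), ?c c d n) # shift_word j (- 1) s)
     = F (shift_word j (- 1) p @ ((c, d), ?c c d n) # ((a, b), ?c a b m) # shift_word j (- 1) s)
        + (if b = c then F (shift_word j (- 1) p @ ((a, d), ?c a b m + ?c c d n) # shift_word j (- 1) s) else 0)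
        - (if a = d then F (shift_word j (- 1) p @ ((c, b), ?c a b m + ?c c d n) # shift_word j (- 1) s) else 0)"
    using pos by (intro F_swap) simp
  moreover have "?c a b m + ?c c d n = ?c a d (m + n)" if "b = c" using ab that by auto
  moreover have "?c a b m + ?c c d n = ?c c b (m + n)" if "a = d" using ab that by auto
  ultimately show "F (shift_word j (- 1) (p @ ((a, b), m) # ((c, d), n) # s)) = F (shift_word j (- 1) (p @ ((c, d), n) # ((a, b), m) # s))
        + (if b = c then F (shift_word j (- 1) (p @ ((a, d), m + n) # s)) else 0) - (if a = d then F (shift_word j (- 1) (p @ ((c, b), m + n) # s)) else 0)"
    by (simp del: split_paired_All cong: if_cong)
next
  fix p :: "letter list" and a b :: nat and m :: int
  assume pos: "positive_word l (p @ [((a, b), m)])" and m: "0 \<le> m"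
  \<comment> \<open>The assumption for \<alpha>_j spreads to all roots of \<lambda>_j-charge 1 by
    bracketing with letters of mode 0: \<open>A\<close> extends the root to smaller row indices,
    \<open>B\<close> to larger column indices.\<close>
  have A: "F (p @ [((a, j), - 1)]) = 0" if "positive_word l p" "a < j" for p a
  proof (cases "a = j - 1")
    case True then show ?thesis using van[of p] that by simp
  next
    case False
    then have a: "a < j - 1" "j - 1 < j" "j - 1 \<le> l" using that j by auto
    have "F (p @ [((a, j - 1), 0), ((j - 1, j), - 1)]) = 0"
      using van[of "p @ [((a, j - 1), 0)]"] that a j by simp
    moreover have "F (p @ [((j - 1, j), - 1), ((a, j - 1), 0)]) = 0"
      using F_vac[of "p @ [((j - 1, j), - 1)]" a "j - 1" 0] that a j by simp
    ultimately show ?thesis using F_swap[of p a "j - 1" 0 "j - 1" j "- 1" "[]"] that a j by simp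
  qed
  have B: "F (p @ [((a, b), - 1)]) = 0" if "positive_word l p" "a < j" "j \<le> b" "b \<le> l" for p a b
  proof (cases "b = j")
    case True then show ?thesis using A[of p a] that by simp
  next
    case False
    then have b: "j < b" using that by auto
    have "F (p @ [((j, b), 0), ((a, j), - 1)]) = 0"
      using A[of "p @ [((j, b), 0)]" a] that b by simp
    moreover have "F (p @ [((a, j), - 1), ((j, b), 0)]) = 0"
      using F_vac[of "p @ [((a, j), - 1)]" j b 0] that b by simp
    ultimately show ?thesis using F_swap[of p a j "- 1" j b 0 "[]"] that b by simp
  qed
  show "F (shift_word j (- 1) (p @ [((a, b), m)])) = 0"
  proof (cases "a < j \<and> j \<le> b \<and> m = 0")
    case True
    then show ?thesis using B[of "shift_word j (- 1) p" a b] pos by simp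
  next
    case False
    have "F (shift_word j (- 1) p @ [((a, b), if a < j \<and> j \<le> b then m + - 1 else m)]) = 0"
      using pos m False by (intro F_vac) auto
    then show ?thesis by simp
  qed
next
  fix p :: "letter list" and i :: nat and N :: int
  assume p: "positive_word l p" and i: "i \<in> {1..l}"
  show "(\<Sum>m=1..<N. F (shift_word j (- 1) (p @ [((i - 1, i), - m), ((i - 1, i), m - N)]))) = 0"
  proof (cases "i = j")
    case False
    then have z: "(i - 1 < j \<and> j \<le> i) = False" using i by auto
    show ?thesis unfolding shift_word_simps z if_False using F_quad[of "shift_word j (- 1) p" i N] p i by simp
  next
    case True
    let ?P = "shift_word j (- 1) p"
    \<comment> \<open>Both factors drop by one, so the relation of total mode
      \<open>- (N + 2)\<close> is used. Its two extra terms, \<open>m = 1\<close> and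
      \<open>m = N + 1\<close>, contain x_j(-1) and vanish.\<close>
    let ?g = "\<lambda>m. F (?P @ [((j - 1, j), - m), ((j - 1, j), m - (N + 2))])"
    show ?thesis
    proof (cases "1 < N")
      case True
      have last: "F (q @ [((j - 1, j), - 1)]) = 0" if "positive_word l q" for q using van[OF that] .
      have "?g 1 = F (?P @ [((j - 1, j), 1 - (N + 2)), ((j - 1, j), - 1)])"
        using p i \<open>i = j\<close> by (intro F_commute) auto
      also have "\<dots> = 0" using last[of "?P @ [((j - 1, j), 1 - (N + 2))]"] p i \<open>i = j\<close> by auto
      finally have g1: "?g 1 = 0" .
      have g2: "?g (N + 1) = 0" using last[of "?P @ [((j - 1, j), - (N + 1))]"] p i \<open>i = j\<close> by auto
      have "{1..<N + 2} = insert 1 (insert (N + 1) {2..<N + 1})" using True by auto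
      then have "0 = (\<Sum>m=2..<N + 1. ?g m)"
        using F_quad[of ?P i "N + 2"] p i g1 g2 \<open>i = j\<close> True by simp
      also have "\<dots> = (\<Sum>m=1..<N. ?g (m + 1))"
        by (rule sum.reindex_bij_witness[of _ "\<lambda>m. m + 1" "\<lambda>m. m - 1"]) auto
      also have "\<dots> = (\<Sum>m=1..<N. F (shift_word j (- 1) (p @ [((i - 1, i), - m), ((i - 1, i), m - N)])))"
        using i \<open>i = j\<close> by (intro sum.cong refl) (auto simp: algebra_simps)
      finally show ?thesis by simp
    qed simp
  qed
qed

text \<open>The pairing of adjacent simple roots is -1, so the twist raises both modes by one.
  Moving the last letter to the left leaves the quadratic relation for the same root and mixed
  products with the bracket root (g, h), all of which vanish separately.\<close>

lemma adjacent_quad: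
  assumes pos: "positive_word l P" and ab: "a < b" "b \<le> l" "c < d" "d \<le> l" "g < h" "h \<le> l"
    and br: "\<And>p k n s. positive_word l p \<Longrightarrow> positive_word l s \<Longrightarrow>
      F (p @ ((a, b), k) # ((c, d), n) # s) = F (p @ ((c, d), n) # ((a, b), k) # s) + \<sigma> * F (p @ ((g, h), k + n) # s)"
    and cm: "b \<noteq> g" "a \<noteq> h"
    and q: "\<And>p N. positive_word l p \<Longrightarrow> (\<Sum>m=1..<N. F (p @ [((a, b), - m), ((a, b), m - N)])) = 0"
    and \<sigma>: "\<sigma> \<noteq> 0"
  shows "(\<Sum>m=1..<N. F (P @ [((a, b), 1 - m), ((a, b), m - N + 1), ((c, d), - 1)])) = 0"
proof (cases "1 < N")
  case N: True
  let ?e = "\<lambda>k. ((a, b), k :: int)" and ?x = "\<lambda>k. ((c, d), k :: int)" and ?f = "\<lambda>k. ((g, h), k :: int)"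
  have fe: "F (p @ [?f k, ?e n]) = F (p @ [?e n, ?f k])" if "positive_word l p" for p k n
    using F_commute[of p a b n g h k "[]"] that ab cm by simp
  have end0: "F (p @ [((u, w), k)]) = 0" if "positive_word l p" "u < w" "w \<le> l" "0 \<le> k" for p u w k
    using F_vac[of p u w k] that by simp
  have br3: "F (P @ [?e k, ?e n, ?x r]) = F (P @ [?x r, ?e k, ?e n]) + \<sigma> * F (P @ [?e n, ?f (k + r)]) + \<sigma> * F (P @ [?e k, ?f (n + r)])" for k n r
  proof -
    have "F (P @ [?e k, ?e n, ?x r]) = F (P @ [?e k, ?x r, ?e n]) + \<sigma> * F (P @ [?e k, ?f (n + r)])"
      using br[of "P @ [?e k]" "[]" n r] pos ab by simp
    also have "F (P @ [?e k, ?x r, ?e n]) = F (P @ [?x r, ?e k, ?e n]) + \<sigma> * F (P @ [?f (k + r), ?e n])"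
      using br[of P "[?e n]" k r] pos ab by simp
    finally show ?thesis using fe[of P] pos by simp
  qed
  \<comment> \<open>The letter \<open>?x 0\<close> acts as a derivation on the quadratic relation
    and vanishes at the right end. The two resulting sums agree under
    \<open>m \<mapsto> M - m\<close>, so each is zero.\<close>
  have S: "(\<Sum>m=1..<M. F (P @ [?e (- m), ?f (m - M)])) = 0" for M
  proof -
    have "0 = (\<Sum>m=1..<M. F (P @ [?x 0, ?e (- m), ?e (m - M)]))"
      using q[of "P @ [?x 0]" M] pos ab by simp
    also have "\<dots> = (\<Sum>m=1..<M. - (\<sigma> * F (P @ [?e (m - M), ?f (- m)])) - \<sigma> * F (P @ [?e (- m), ?f (m - M)]))"
    proof (intro sum.cong refl)
      fix m
      have e: "F (P @ [?e (- m), ?e (m - M), ?x 0]) = 0"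
        using end0[of "P @ [?e (- m), ?e (m - M)]" c d 0] pos ab by simp
      have z: "x = - y - z" if "0 = x + y + z" for x y z :: complex
      proof -
        have "x = (x + y + z) - y - z" by simp
        then show ?thesis unfolding that[symmetric] by simp
      qed
      show "F (P @ [?x 0, ?e (- m), ?e (m - M)]) = - (\<sigma> * F (P @ [?e (m - M), ?f (- m)])) - \<sigma> * F (P @ [?e (- m), ?f (m - M)])"
        using br3[of "- m" "m - M" 0] unfolding e add_0_right by (rule z)
    qed
    also have "\<dots> = - \<sigma> * ((\<Sum>m=1..<M. F (P @ [?e (m - M), ?f (- m)])) + (\<Sum>m=1..<M. F (P @ [?e (- m), ?f (m - M)])))"
      by (simp add: sum_subtractf sum_negf sum_distrib_left algebra_simps)
    also have "(\<Sum>m=1..<M. F (P @ [?e (m - M), ?f (- m)])) = (\<Sum>m=1..<M. F (P @ [?e (- m), ?f (m - M)]))"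
      by (rule sum.reindex_bij_witness[of _ "\<lambda>m. M - m" "\<lambda>m. M - m"]) auto
    finally show ?thesis using \<sigma> by simp
  qed
  have sp: "{1..<N} = insert 1 {2..<N}" using N by auto
  \<comment> \<open>The two end terms have a factor of mode 0, which vanishes at the right end; the
    rest is the quadratic relation of total mode \<open>- (N - 2)\<close>.\<close>
  have T1: "(\<Sum>m=1..<N. F (P @ [?x (- 1), ?e (1 - m), ?e (m - N + 1)])) = 0"
  proof -
    have g: "F (P @ [?x (- 1), ?e (1 - m), ?e (m - N + 1)]) = 0" if "m = 1 \<or> m = N - 1" for m
    proof (cases "m = 1")
      case True
      have "F (P @ [?x (- 1), ?e 0, ?e (2 - N)]) = F (P @ [?x (- 1), ?e (2 - N), ?e 0])"
        using F_commute[of "P @ [?x (- 1)]" a b 0 a b "2 - N" "[]"] pos ab by simp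
      also have "\<dots> = 0" using end0[of "P @ [?x (- 1), ?e (2 - N)]" a b 0] pos ab by simp
      finally show ?thesis using True by (simp add: algebra_simps)
    next
      case False
      then show ?thesis using that end0[of "P @ [?x (- 1), ?e (1 - m)]" a b 0] pos ab by simp
    qed
    have "(\<Sum>m=1..<N. F (P @ [?x (- 1), ?e (1 - m), ?e (m - N + 1)])) = (\<Sum>m=2..<N-1. F (P @ [?x (- 1), ?e (1 - m), ?e (m - N + 1)]))"
      using N g by (intro sum.mono_neutral_right) auto
    also have "\<dots> = (\<Sum>m=1..<N-2. F ((P @ [?x (- 1)]) @ [?e (- m), ?e (m - (N - 2))]))"
      by (rule sum.reindex_bij_witness[of _ "\<lambda>m. m + 1" "\<lambda>m. m - 1"]) (auto simp: algebra_simps)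
    also have "\<dots> = 0" using pos ab by (intro q) simp
    finally show ?thesis .
  qed
  have T3: "(\<Sum>m=1..<N. F (P @ [?e (1 - m), ?f (m - N)])) = 0"
  proof -
    have "F (P @ [?e 0, ?f (1 - N)]) = 0"
      using fe[of P "1 - N" 0] end0[of "P @ [?f (1 - N)]" a b 0] pos ab by simp
    then have "(\<Sum>m=1..<N. F (P @ [?e (1 - m), ?f (m - N)])) = (\<Sum>m=2..<N. F (P @ [?e (1 - m), ?f (m - N)]))"
      unfolding sp by simp
    also have "\<dots> = (\<Sum>m=1..<N-1. F (P @ [?e (- m), ?f (m - (N - 1))]))"
      by (rule sum.reindex_bij_witness[of _ "\<lambda>m. m + 1" "\<lambda>m. m - 1"]) (auto simp: algebra_simps)
    also have "\<dots> = 0" by (rule S)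
    finally show ?thesis .
  qed
  have T2: "(\<Sum>m=1..<N. F (P @ [?e (m - N + 1), ?f (- m)])) = (\<Sum>m=1..<N. F (P @ [?e (1 - m), ?f (m - N)]))"
    by (rule sum.reindex_bij_witness[of _ "\<lambda>m. N - m" "\<lambda>m. N - m"]) (auto simp: algebra_simps)
  have "(\<Sum>m=1..<N. F (P @ [?e (1 - m), ?e (m - N + 1), ?x (- 1)]))
     = (\<Sum>m=1..<N. F (P @ [?x (- 1), ?e (1 - m), ?e (m - N + 1)])) + \<sigma> * (\<Sum>m=1..<N. F (P @ [?e (m - N + 1), ?f (- m)]))
       + \<sigma> * (\<Sum>m=1..<N. F (P @ [?e (1 - m), ?f (m - N)]))"
    unfolding br3 by (simp add: sum.distrib sum_distrib_left algebra_simps)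
  then show ?thesis by (simp add: T1 T2 T3)
qed simp

text \<open>The counterpart of \<open>twist_vac\<close> for words: the relations for
  \<open>F\<close> must suffice, without operators for negative roots or the Cartan subalgebra. The
  quadratic relations split according to the pairing of \<alpha>_i and \<alpha>_j, which is 2, -1 or
  0.\<close>

lemma twist_functional:
  assumes j: "j \<in> {1..l}"
  shows "vacuum_functional l (\<lambda>ps. F (twist_word j ps @ [((j - 1, j), - 1)]))"
proof
  fix p s :: "letter list" and a b c d :: nat and m n :: int
  assume pos: "positive_word l (p @ ((a, b), m) # ((c, d), n) # s)"
  let ?t = "\<lambda>a b m. m - (alpha j a - alpha j b)"
  let ?s = "twist_word j s @ [((j - 1, j), - 1)]"
  have "F (twist_word j p @ ((a, b), ?t a b m) # ((c, d), ?t c d n) # ?s)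
     = F (twist_word j p @ ((c, d), ?t c d n) # ((a, b), ?t a b m) # ?s)
        + (if b = c then F (twist_word j p @ ((a, d), ?t a b m + ?t c d n) # ?s) else 0)
        - (if a = d then F (twist_word j p @ ((c, b), ?t a b m + ?t c d n) # ?s) else 0)"
    using pos j by (intro F_swap) auto
  then show "F (twist_word j (p @ ((a, b), m) # ((c, d), n) # s) @ [((j - 1, j), - 1)])
      = F (twist_word j (p @ ((c, d), n) # ((a, b), m) # s) @ [((j - 1, j), - 1)])
        + (if b = c then F (twist_word j (p @ ((a, d), m + n) # s) @ [((j - 1, j), - 1)]) else 0)
        - (if a = d then F (twist_word j (p @ ((c, b), m + n) # s) @ [((j - 1, j), - 1)]) else 0)"
    by (cases "b = c"; cases "a = d") (simp_all add: algebra_simps)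
next
  fix p :: "letter list" and a b :: nat and m :: int
  assume pos: "positive_word l (p @ [((a, b), m)])" and m: "0 \<le> m"
  define q where "q = j - 1"
  have jq: "j = Suc q" and q: "Suc q \<le> l" using j by (auto simp: q_def)
  let ?P = "twist_word j p"
  let ?x = "\<lambda>k. ((q, Suc q), k :: int)"
  have P: "positive_word l ?P" and ab: "a < b" "b \<le> l" using pos by auto
  have end0: "F (p @ [((u, w), k)]) = 0" if "positive_word l p" "u < w" "w \<le> l" "0 \<le> k" for p u w k
    using F_vac[of p u w k] that by simp
  have al: "alpha j i = (if i = q then 1 else if i = Suc q then - 1 else 0)" for i
    by (auto simp: alpha_def jq)
  have xx: "F (?P @ [?x (- 1), ?x (- 1)]) = 0" "positive_word l p \<Longrightarrow> F (p @ [?x (- 1), ?x (- 1)]) = 0" for p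
  proof -
    have i: "{1..<2} = {1 :: int}" by auto
    show *: "F (p @ [?x (- 1), ?x (- 1)]) = 0" if "positive_word l p" for p
      using F_quad[of p "Suc q" 2] that q by (simp add: i)
    show "F (?P @ [?x (- 1), ?x (- 1)]) = 0" by (rule *) (rule P)
  qed
  have xx2: "F (?P @ [?x (- 2), ?x (- 1)]) = 0"
  proof -
    have i: "{1..<3} = {1, 2 :: int}" by auto
    have "F (?P @ [?x (- 2), ?x (- 1)]) = F (?P @ [?x (- 1), ?x (- 2)])"
      using P q by (intro F_commute) auto
    then show ?thesis using F_quad[of ?P "Suc q" 3] P q by (simp add: i)
  qed
  \<comment> \<open>A letter of mode 0 is pushed through the vanishing square of x_j(-1); its two
    brackets coincide since the letters commute. \<open>L\<close> is the mirror image.\<close>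
  have R: "F (?P @ [((q, b), - 1), ?x (- 1)]) = 0" if "Suc q < b" "b \<le> l"
  proof -
    have "0 = F (?P @ [((Suc q, b), 0), ?x (- 1), ?x (- 1)])"
      using xx(2)[of "?P @ [((Suc q, b), 0)]"] P that by simp
    also have "\<dots> = F (?P @ [?x (- 1), ((Suc q, b), 0), ?x (- 1)]) - F (?P @ [((q, b), - 1), ?x (- 1)])"
      using F_swap[of ?P "Suc q" b 0 q "Suc q" "- 1" "[?x (- 1)]"] P that by simp
    also have "F (?P @ [?x (- 1), ((Suc q, b), 0), ?x (- 1)]) = - F (?P @ [?x (- 1), ((q, b), - 1)])"
      using F_swap[of "?P @ [?x (- 1)]" "Suc q" b 0 q "Suc q" "- 1" "[]"] end0[of "?P @ [?x (- 1), ?x (- 1)]" "Suc q" b 0] P that by simp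
    also have "F (?P @ [?x (- 1), ((q, b), - 1)]) = F (?P @ [((q, b), - 1), ?x (- 1)])"
      using P that by (intro F_commute) auto
    finally show ?thesis by simp
  qed
  have L: "F (?P @ [((a, Suc q), - 1), ?x (- 1)]) = 0" if "a < q"
  proof -
    have "0 = F (?P @ [((a, q), 0), ?x (- 1), ?x (- 1)])"
      using xx(2)[of "?P @ [((a, q), 0)]"] P that q by simp
    also have "\<dots> = F (?P @ [?x (- 1), ((a, q), 0), ?x (- 1)]) + F (?P @ [((a, Suc q), - 1), ?x (- 1)])"
      using F_swap[of ?P a q 0 q "Suc q" "- 1" "[?x (- 1)]"] P that q by simp
    also have "F (?P @ [?x (- 1), ((a, q), 0), ?x (- 1)]) = F (?P @ [?x (- 1), ((a, Suc q), - 1)])"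
      using F_swap[of "?P @ [?x (- 1)]" a q 0 q "Suc q" "- 1" "[]"] end0[of "?P @ [?x (- 1), ?x (- 1)]" a q 0] P that q by simp
    also have "F (?P @ [?x (- 1), ((a, Suc q), - 1)]) = F (?P @ [((a, Suc q), - 1), ?x (- 1)])"
      using P that q by (intro F_commute) auto
    finally show ?thesis by simp
  qed
  have sw: "F (?P @ [((a, b), k), ?x (- 1)]) = F (?P @ [?x (- 1), ((a, b), k)])
     + (if b = q then F (?P @ [((a, Suc q), k - 1)]) else 0) - (if a = Suc q then F (?P @ [((q, b), k - 1)]) else 0)" for k
    using F_swap[of ?P a b k q "Suc q" "- 1" "[]"] P ab q by simp
  have e0: "F (?P @ [?x (- 1), ((a, b), k)]) = 0" if "0 \<le> k" for k
    using end0[of "?P @ [?x (- 1)]" a b k] that P q ab by simp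
  define k where "k = m - (alpha j a - alpha j b)"
  have "F (?P @ [((a, b), k), ?x (- 1)]) = 0"
  proof (cases "0 \<le> k")
    case True
    have "F (?P @ [((a, Suc q), k - 1)]) = 0" if "b = q"
      using that m ab q P unfolding k_def al by (intro end0) auto
    moreover have "F (?P @ [((q, b), k - 1)]) = 0" if "a = Suc q"
      using that m ab q P unfolding k_def al by (intro end0) auto
    ultimately show ?thesis using sw[of k] e0[OF True] by simp
  next
    case False
    \<comment> \<open>A negative untwisted mode requires a positive pairing with \<alpha>_j: it is 2
      for \<alpha>_j itself, and 1 for the longer positive roots starting or ending where \<alpha>_j
      does.\<close>
    then have "a = q \<and> b = Suc q \<and> (k = - 1 \<or> k = - 2) \<or> a = q \<and> Suc q < b \<and> k = - 1 \<or> a < q \<and> b = Suc q \<and> k = - 1"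
      using m ab unfolding k_def al by (simp split: if_splits) arith?
    then consider "a = q" "b = Suc q" "k = - 1 \<or> k = - 2" | "a = q" "Suc q < b" "k = - 1" | "a < q" "b = Suc q" "k = - 1"
      by blast
    then show ?thesis
    proof cases
      case 1 then show ?thesis using xx(1) xx2 by auto
    next
      case 2 then show ?thesis using R ab by simp
    next
      case 3 then show ?thesis using L by simp
    qed
  qed
  then show "F (twist_word j (p @ [((a, b), m)]) @ [((j - 1, j), - 1)]) = 0"
    by (simp add: k_def jq)
next
  fix p :: "letter list" and i :: nat and N :: int
  assume p: "positive_word l p" and i: "i \<in> {1..l}"
  let ?P = "twist_word j p"
  have P: "positive_word l ?P" using p by simp
  have pos1: "i - 1 < i" "j - 1 < j" "i \<le> l" "j \<le> l" using i j by auto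
  consider "i = j" | "i = j + 1" | "j = i + 1" | "i \<noteq> j" "i \<noteq> j + 1" "j \<noteq> i + 1" by blast
  then show "(\<Sum>m=1..<N. F (twist_word j (p @ [((i - 1, i), - m), ((i - 1, i), m - N)]) @ [((j - 1, j), - 1)])) = 0"
  proof cases
    case 1
    let ?e = "\<lambda>k. ((j - 1, j), k :: int)"
    have al: "alpha j (j - 1) - alpha j j = 2" using j by (auto simp: alpha_def)
    have c1: "F (p @ ?e k # ?e n # s) = F (p @ ?e n # ?e k # s)" if "positive_word l p" "positive_word l s" for p s k n
      using that pos1 by (intro F_commute) auto
    have c3: "F (?P @ [?e k, ?e n, ?e r]) = F (?P @ [?e r, ?e k, ?e n])" for k n r
      using c1[of "?P @ [?e k]" "[]" n r] c1[of ?P "[?e n]" k r] P pos1 by simp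
    have i2: "{1..<2} = {1 :: int}" "{1..<3} = {1, 2 :: int}" by auto
    have e1: "F (p @ [?e (- 1), ?e (- 1)]) = 0" if "positive_word l p" for p
      using F_quad[of p j 2] that j by (simp add: i2)
    have e2: "F (p @ [?e (- 2), ?e (- 1)]) = 0" "F (p @ [?e (- 1), ?e (- 2)]) = 0" if "positive_word l p" for p
      using F_quad[of p j 3] c1[of p "[]" "- 2" "- 1"] that j by (simp_all add: i2)
    show ?thesis
    proof (cases "1 < N")
      case N: True
      \<comment> \<open>The pairing 2 lowers each mode by two, hence total mode
        \<open>- (N + 4)\<close>. Together with the third letter x_j(-1), the two terms at either
        end contain x_j(-1) x_j(-1) or x_j(-2) x_j(-1), which vanish at the right end of a
        word.\<close>
      let ?g = "\<lambda>m. F (?P @ [?e (- 1), ?e (- m), ?e (m - (N + 4))])"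
      have g: "?g m = 0" if "m \<in> {1, 2, N + 2, N + 3}" for m
      proof -
        from that have "m = 1 \<or> m = 2 \<or> m = N + 2 \<or> m = N + 3" by blast
        then consider "m = 1" | "m = 2" | "m = N + 2" | "m = N + 3" by blast
        then show ?thesis
        proof cases
          case 1 then show ?thesis using c3[of "- 1" "- 1" "1 - (N + 4)"] e1[of "?P @ [?e (1 - (N + 4))]"] P pos1 by simp
        next
          case 2 then show ?thesis using c3[of "- 1" "- 2" "2 - (N + 4)"] e2[of "?P @ [?e (2 - (N + 4))]"] P pos1 by simp
        next
          case 3 then show ?thesis using c1[of ?P "[?e (- 2)]" "- 1" "- (N + 2)"] e2[of "?P @ [?e (- (N + 2))]"] P pos1 by simp
        next
          case 4 then show ?thesis using c1[of ?P "[?e (- 1)]" "- 1" "- (N + 3)"] e1[of "?P @ [?e (- (N + 3))]"] P pos1 by simp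
        qed
      qed
      have "0 = (\<Sum>m=1..<N + 4. ?g m)" using F_quad[of "?P @ [?e (- 1)]" j "N + 4"] P j by simp
      also have "\<dots> = (\<Sum>m=3..<N + 2. ?g m)"
      proof (intro sum.mono_neutral_right ballI g)
        fix m assume "m \<in> {1..<N + 4} - {3..<N + 2}"
        then show "m \<in> {1, 2, N + 2, N + 3}" by auto
      qed (use N in auto)
      also have "\<dots> = (\<Sum>m=1..<N. ?g (m + 2))"
        by (rule sum.reindex_bij_witness[of _ "\<lambda>m. m + 2" "\<lambda>m. m - 2"]) auto
      also have "\<dots> = (\<Sum>m=1..<N. F (?P @ [?e (- m - 2), ?e (m - N - 2), ?e (- 1)]))"
      proof (intro sum.cong refl)
        fix m
        have "- (m + 2) = - m - 2" "m + 2 - (N + 4) = m - N - 2" by auto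
        then show "?g (m + 2) = F (?P @ [?e (- m - 2), ?e (m - N - 2), ?e (- 1)])"
          unfolding c3[of "- m - 2" "m - N - 2" "- 1"] by simp
      qed
      finally show ?thesis using 1 al by simp
    qed simp
  next
    case 2
    have al: "alpha j (i - 1) - alpha j i = - 1" using 2 j by (auto simp: alpha_def)
    have "(\<Sum>m=1..<N. F (?P @ [((i - 1, i), 1 - m), ((i - 1, i), m - N + 1), ((j - 1, j), - 1)])) = 0"
    proof (rule adjacent_quad[where g = "j - 1" and h = i and \<sigma> = "- 1"])
      show "F (p @ ((i - 1, i), k) # ((j - 1, j), n) # s) = F (p @ ((j - 1, j), n) # ((i - 1, i), k) # s) + - 1 * F (p @ ((j - 1, i), k + n) # s)"
        if "positive_word l p" "positive_word l s" for p k n s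
        using F_swap[of p "i - 1" i k "j - 1" j n s] that 2 pos1 by simp
    qed (use P pos1 2 F_quad[OF _ i] in auto)
    then show ?thesis unfolding twist_word_simps al by (simp add: algebra_simps)
  next
    case 3
    have al: "alpha j (i - 1) - alpha j i = - 1" using 3 i by (auto simp: alpha_def)
    have "(\<Sum>m=1..<N. F (?P @ [((i - 1, i), 1 - m), ((i - 1, i), m - N + 1), ((j - 1, j), - 1)])) = 0"
    proof (rule adjacent_quad[where g = "i - 1" and h = j and \<sigma> = 1])
      show "F (p @ ((i - 1, i), k) # ((j - 1, j), n) # s) = F (p @ ((j - 1, j), n) # ((i - 1, i), k) # s) + 1 * F (p @ ((i - 1, j), k + n) # s)"
        if "positive_word l p" "positive_word l s" for p k n s
        using F_swap[of p "i - 1" i k "j - 1" j n s] that 3 pos1 by simp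
    qed (use P pos1 3 F_quad[OF _ i] in auto)
    then show ?thesis unfolding twist_word_simps al by (simp add: algebra_simps)
  next
    case 4
    let ?e = "\<lambda>k. ((i - 1, i), k :: int)" and ?x = "((j - 1, j), - 1 :: int)"
    have al: "alpha j (i - 1) - alpha j i = 0" using 4 i j by (auto simp: alpha_def)
    have "F (?P @ [?e k, ?e n, ?x]) = F (?P @ [?x, ?e k, ?e n])" for k n
    proof -
      have d: "i \<noteq> j - 1" "i - 1 \<noteq> j" using 4 i j by auto
      have "F (?P @ [?e k, ?e n, ?x]) = F (?P @ [?e k, ?x, ?e n])"
        using F_commute[of "?P @ [?e k]" "i - 1" i n "j - 1" j "- 1" "[]"] d P pos1 by simp
      also have "\<dots> = F (?P @ [?x, ?e k, ?e n])"
        using F_commute[of ?P "i - 1" i k "j - 1" j "- 1" "[?e n]"] d P pos1 by simp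
      finally show ?thesis .
    qed
    then show ?thesis using F_quad[of "?P @ [?x]" i N] P pos1 i unfolding twist_word_simps al by simp
  qed
qed

end

section \<open>Linear forms on a module as functionals on words\<close>

context loop_module begin

lemma word_act_add: "word_in l ps \<Longrightarrow> word_act Y ps (x + y) = word_act Y ps x + word_act Y ps y"
proof (induction ps)
  case (Cons p ps)
  then show ?case by (cases p; cases "fst p") (auto simp: Y_add)
qed simp

lemma word_act_scale: "word_in l ps \<Longrightarrow> word_act Y ps (scale c x) = scale c (word_act Y ps x)"
proof (induction ps)
  case (Cons p ps)
  then show ?case by (cases p; cases "fst p") (auto simp: Y_scale)
qed simp

lemma word_act_0: "word_in l ps \<Longrightarrow> word_act Y ps 0 = 0"
  using word_act_scale[of ps 0 0] by simp

lemma word_act_diff: "word_in l ps \<Longrightarrow> word_act Y ps (x - y) = word_act Y ps x - word_act Y ps y"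
  using word_act_add[of ps "x - y" y] by (simp add: algebra_simps)

lemma word_act_sum: "word_in l ps \<Longrightarrow> word_act Y ps (\<Sum>i\<in>A. f i) = (\<Sum>i\<in>A. word_act Y ps (f i))"
  by (induction A rule: infinite_finite_induct) (auto simp: word_act_0 word_act_add)

lemma linear_vacuum_functional:
  assumes "Vector_Spaces.linear scale (*) \<phi>"
  shows "vacuum_functional l (\<lambda>ps. \<phi> (word_act Y ps v))"
proof
  interpret \<phi>: Vector_Spaces.linear scale "(*)" \<phi> by fact
  fix p s :: "letter list" and a b c d :: nat and m n :: int
  assume pos: "positive_word l (p @ ((a, b), m) # ((c, d), n) # s)"
  let ?w = "word_act Y s v"
  have p: "word_in l p" using pos by (simp add: positive_word_in)
  have "Y a b m (Y c d n ?w) = Y c d n (Y a b m ?w) + (if b = c then Y a d (m + n) ?w else 0) - (if a = d then Y c b (m + n) ?w else 0)"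
    using pos by (subst Y_swap) auto
  then show "\<phi> (word_act Y (p @ ((a, b), m) # ((c, d), n) # s) v) = \<phi> (word_act Y (p @ ((c, d), n) # ((a, b), m) # s) v)
        + (if b = c then \<phi> (word_act Y (p @ ((a, d), m + n) # s) v) else 0) - (if a = d then \<phi> (word_act Y (p @ ((c, b), m + n) # s) v) else 0)"
    using p by (simp add: word_act_add word_act_diff word_act_0 \<phi>.add \<phi>.diff \<phi>.zero)
next
  interpret \<phi>: Vector_Spaces.linear scale "(*)" \<phi> by fact
  fix p :: "letter list" and a b :: nat and m :: int
  assume pos: "positive_word l (p @ [((a, b), m)])" "0 \<le> m"
  then have "Y a b m v = 0" by (intro Y_vac) auto
  then show "\<phi> (word_act Y (p @ [((a, b), m)]) v) = 0"
    using pos by (simp add: word_act_0 positive_word_in \<phi>.zero)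
next
  interpret \<phi>: Vector_Spaces.linear scale "(*)" \<phi> by fact
  fix p :: "letter list" and i :: nat and N :: int
  assume p: "positive_word l p" and i: "i \<in> {1..l}"
  have "(\<Sum>m=1..<N. Y (i - 1) i (- m) (Y (i - 1) i (m - N) v)) = 0"
    using quadratic_relation[of "i - 1" i "nat N"] i by (cases "0 \<le> N") auto
  then have "\<phi> (word_act Y p (\<Sum>m=1..<N. Y (i - 1) i (- m) (Y (i - 1) i (m - N) v))) = 0"
    using p by (simp add: word_act_0 positive_word_in \<phi>.zero)
  then show "(\<Sum>m=1..<N. \<phi> (word_act Y (p @ [((i - 1, i), - m), ((i - 1, i), m - N)]) v)) = 0"
    using p by (simp add: word_act_sum positive_word_in \<phi>.sum)
qed

end


section \<open>The principal subspace and its dimensions\<close>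

lemma twist_word_surj: "\<exists>ps. twist_word j ps = qs"
proof (induction qs)
  case Nil
  show ?case by (auto intro: exI[of _ "[]"])
next
  case (Cons q qs)
  then obtain ps where ps: "twist_word j ps = qs" by blast
  obtain a b m where q: "q = ((a, b), m)" by (metis surj_pair)
  have "twist_word j (((a, b), m + (alpha j a - alpha j b)) # ps) = q # qs" by (simp add: ps q)
  then show ?case by blast
qed

lemma charge_fun_simps:
  assumes "positive_word l (p @ ((a, b), m) # ((c, d), n) # s)"
  shows "charge (p @ ((a, b), m) # ((c, d), n) # s) = charge (p @ ((c, d), n) # ((a, b), m) # s)"
    and "b = c \<Longrightarrow> charge (p @ ((a, b), m) # ((c, d), n) # s) = charge (p @ ((a, d), m + n) # s)"
    and "a = d \<Longrightarrow> charge (p @ ((a, b), m) # ((c, d), n) # s) = charge (p @ ((c, b), m + n) # s)"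
  using assms by (auto simp: fun_eq_iff)

text \<open>All the relations are homogeneous in charge and energy. The restriction makes it
  possible to assume vanishing on words ending in x_j(-1) when it is known in a single degree
  only.\<close>

lemma (in vacuum_functional) restrict_degree:
  "vacuum_functional l (\<lambda>ps. if charge ps = r \<and> energy ps = k then F ps else 0)"
proof
  fix p s :: "letter list" and a b c d :: nat and m n :: int
  assume pos: "positive_word l (p @ ((a, b), m) # ((c, d), n) # s)"
  let ?R = "\<lambda>ps. if charge ps = r \<and> energy ps = k then F ps else 0"
  let ?w = "p @ ((a, b), m) # ((c, d), n) # s"
  show "?R ?w = ?R (p @ ((c, d), n) # ((a, b), m) # s)
     + (if b = c then ?R (p @ ((a, d), m + n) # s) else 0) - (if a = d then ?R (p @ ((c, b), m + n) # s) else 0)"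
  proof (cases "charge ?w = r \<and> energy ?w = k")
    case True
    then show ?thesis using F_swap[OF pos] charge_fun_simps[OF pos]
      by (cases "b = c"; cases "a = d") (simp_all add: algebra_simps)
  next
    case False
    then show ?thesis using charge_fun_simps[OF pos]
      by (cases "b = c"; cases "a = d") (auto simp: algebra_simps)
  qed
next
  fix p :: "letter list" and a b :: nat and m :: int
  assume "positive_word l (p @ [((a, b), m)])" "0 \<le> m"
  then show "(if charge (p @ [((a, b), m)]) = r \<and> energy (p @ [((a, b), m)]) = k then F (p @ [((a, b), m)]) else 0) = 0"
    using F_vac by simp
next
  fix p :: "letter list" and i :: nat and N :: int
  assume p: "positive_word l p" and i: "i \<in> {1..l}"
  let ?w = "\<lambda>m. p @ [((i - 1, i), - m), ((i - 1, i), m - N)]"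
  obtain c where c: "charge (?w m) = c" for m
    using that[of "charge (?w 0)"] by (simp add: fun_eq_iff)
  obtain e where e: "energy (?w m) = e" for m
    using that[of "energy (?w 0)"] by simp
  show "(\<Sum>m=1..<N. if charge (?w m) = r \<and> energy (?w m) = k then F (?w m) else 0) = 0"
    unfolding c e using F_quad[OF p i, of N] by (cases "c = r \<and> e = k") auto
qed

lemma vacuum_functional_diff:
  assumes "vacuum_functional l F" "vacuum_functional l G"
  shows "vacuum_functional l (\<lambda>ps. F ps - G ps)"
proof -
  interpret F: vacuum_functional l F by fact
  interpret G: vacuum_functional l G by fact
  show ?thesis
  proof
    fix p s :: "letter list" and a b c d :: nat and m n :: int
    assume "positive_word l (p @ ((a, b), m) # ((c, d), n) # s)"
    from F.F_swap[OF this] G.F_swap[OF this]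
    show "F (p @ ((a, b), m) # ((c, d), n) # s) - G (p @ ((a, b), m) # ((c, d), n) # s) =
        F (p @ ((c, d), n) # ((a, b), m) # s) - G (p @ ((c, d), n) # ((a, b), m) # s)
        + (if b = c then F (p @ ((a, d), m + n) # s) - G (p @ ((a, d), m + n) # s) else 0)
        - (if a = d then F (p @ ((c, b), m + n) # s) - G (p @ ((c, b), m + n) # s) else 0)"
      by (cases "b = c"; cases "a = d") simp_all
  next
    fix p :: "letter list" and i :: nat and N :: int
    assume "positive_word l p" "i \<in> {1..l}"
    from F.F_quad[OF this] G.F_quad[OF this]
    show "(\<Sum>m=1..<N. F (p @ [((i - 1, i), - m), ((i - 1, i), m - N)]) - G (p @ [((i - 1, i), - m), ((i - 1, i), m - N)])) = 0"
      unfolding sum_subtractf by simp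
  qed (simp only: F.F_vac G.F_vac diff_zero)
qed

lemma (in vector_space) linear_functionalI:
  assumes "\<And>x y. \<phi> (x + y) = \<phi> x + \<phi> y" "\<And>c x. \<phi> (scale c x) = c * \<phi> x"
  shows "Vector_Spaces.linear scale (*) \<phi>"
proof -
  have "vector_space ((*) :: 'a \<Rightarrow> 'a \<Rightarrow> 'a)" by unfold_locales (simp_all add: algebra_simps)
  then show ?thesis using assms by (simp add: Vector_Spaces.linear_iff vector_space_axioms)
qed

lemma (in vector_space) separating_functional:
  assumes "x \<notin> span S"
  shows "\<exists>\<phi>. Vector_Spaces.linear scale (*) \<phi> \<and> (\<forall>y\<in>span S. \<phi> y = 0) \<and> \<phi> x \<noteq> 0"
proof -
  have v: "vector_space ((*) :: 'a \<Rightarrow> 'a \<Rightarrow> 'a)" by unfold_locales (simp_all add: algebra_simps)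
  interpret f: vector_space "(*) :: 'a \<Rightarrow> 'a \<Rightarrow> 'a" by (rule v)
  interpret p: vector_space_pair scale "(*) :: 'a \<Rightarrow> 'a \<Rightarrow> 'a" by unfold_locales
  obtain B where B: "B \<subseteq> S" "independent B" "S \<subseteq> span B" by (rule maximal_independent_subset)
  have sp: "span B = span S" using B by (metis span_mono span_span subset_antisym)
  have "independent (insert x B)" using B assms sp by (intro independent_insertI) auto
  then obtain g where g: "Vector_Spaces.linear scale (*) g" "\<forall>y\<in>insert x B. g y = (if y = x then 1 else 0)"
    using p.linear_independent_extend[of "insert x B" "\<lambda>y. if y = x then 1 else 0"] by blast
  interpret g: Vector_Spaces.linear scale "(*)" g by (rule g)
  have "x \<notin> B" using assms B span_base by blast
  then have gB: "g y = 0" if "y \<in> B" for y using g(2) that by auto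
  have "g y = 0" if "y \<in> span B" for y
    using that by (induction rule: span_induct_alt) (simp_all add: g.add g.scale g.zero gB)
  then show ?thesis using g sp by (intro exI[of _ g]) simp
qed

lemma (in loop_module) linear_functional_compose_shift:
  assumes "Vector_Spaces.linear scale (*) \<psi>" "Vector_Spaces.linear scale (*) \<theta>" "j \<le> l"
  shows "Vector_Spaces.linear scale (*) (\<lambda>x. \<psi> x + \<theta> (shift_op j s x))"
proof -
  interpret \<psi>: Vector_Spaces.linear scale "(*)" \<psi> by fact
  interpret \<theta>: Vector_Spaces.linear scale "(*)" \<theta> by fact
  show ?thesis
    by (rule linear_functionalI) (simp_all add: \<psi>.add \<theta>.add \<psi>.scale \<theta>.scale shift_op_add[OF assms(3)] shift_op_scale[OF assms(3)] algebra_simps)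
qed

section \<open>Degrees of words and the factorization of functionals\<close>

definition has_degree :: "nat \<Rightarrow> (nat \<Rightarrow> nat) \<Rightarrow> int \<Rightarrow> letter list \<Rightarrow> bool" where
  "has_degree l r k ps \<longleftrightarrow> positive_word l ps \<and> charge ps = r \<and> energy ps = k"

lemma has_degree_0:
  assumes "has_degree l r k ps" "\<forall>i\<in>{1..l}. r i = 0"
  shows "ps = []"
proof (cases ps)
  case (Cons p qs)
  obtain a b m where p: "p = ((a, b), m)" by (metis surj_pair)
  then have "a < b" "b \<le> l" "charge ps b = 0" using assms Cons by (auto simp: has_degree_def)
  then show ?thesis using Cons p by simp
qed

text \<open>From the energy \<open>k\<close> of a word ending in x_j(-1), that letter takes 1 and
  the twist takes the pairing of \<alpha>_j with the remaining charges. This is the exponent of q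
  produced by x_j q \<chi>(x_i q^a_ji).\<close>

definition lower_energy :: "nat \<Rightarrow> nat \<Rightarrow> (nat \<Rightarrow> nat) \<Rightarrow> int \<Rightarrow> int" where
  "lower_energy l j r k = k - 1 - (\<Sum>i = 1..l. cartan_entry j i * int ((r(j := r j - 1)) i))"

lemma has_degree_twist:
  assumes j: "j \<in> {1..l}" "0 < r j"
  shows "has_degree l r k (twist_word j ps @ [((j - 1, j), - 1)]) \<longleftrightarrow>
    has_degree l (r(j := r j - 1)) (lower_energy l j r k) ps"
proof -
  have "(j - 1 < i \<and> i \<le> j) = (i = j)" for i using j by auto
  then have "charge (twist_word j ps @ [((j - 1, j), - 1)]) = (charge ps)(j := Suc (charge ps j))"
    by (auto simp: fun_eq_iff)
  then have c: "charge (twist_word j ps @ [((j - 1, j), - 1)]) = r \<longleftrightarrow> charge ps = r(j := r j - 1)"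
    using j(2) by (auto simp: fun_eq_iff)
  have "energy (twist_word j ps @ [((j - 1, j), - 1)]) = energy ps + (\<Sum>i = 1..l. cartan_entry j i * int (charge ps i)) + 1"
    if "positive_word l ps" using energy_twist_word[OF that j(1)] by simp
  moreover have "positive_word l (twist_word j ps @ [((j - 1, j), - 1)]) = positive_word l ps" using j by auto
  ultimately show ?thesis unfolding has_degree_def lower_energy_def c by (auto simp del: positive_word_simps energy_simps)
qed

lemma has_degree_shift: "has_degree l r k (shift_word j 1 ps) \<longleftrightarrow> has_degree l r (k + int (r j)) ps"
  by (auto simp: has_degree_def energy_shift_word fun_eq_iff)

text \<open>Every solution of the relations comes from \<open>W(\<Lambda>\<^sub>0)\<close>: first subtract the functional that
  agrees with it on the twisted principal subspace generated by \<open>x\<^sub>j(-1) v\<close>; the remainder is a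
  solution of the relations with \<open>x\<^sub>j(m)\<close> replaced by \<open>x\<^sub>j(m + 1)\<close>.\<close>

lemma vacuum_functional_factors:
  assumes "loop_module scale l Y v" "vacuum_functional l F"
  shows "\<exists>\<phi>. Vector_Spaces.linear scale (*) \<phi> \<and> (\<forall>ps. has_degree l r k ps \<longrightarrow> F ps = \<phi> (word_act Y ps v))"
  using assms
proof (induction "\<Sum>i = 1..l. r i" arbitrary: Y v F r k)
  case 0
  interpret loop_module scale l Y v by fact
  have r: "\<forall>i\<in>{1..l}. r i = 0" using 0 by simp
  obtain \<phi> where \<phi>: "Vector_Spaces.linear scale (*) \<phi>" "\<phi> v \<noteq> 0"
    using separating_functional[of v "{}"] v_nonzero by auto
  interpret \<phi>: Vector_Spaces.linear scale "(*)" \<phi> by (rule \<phi>)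
  \<comment> \<open>Only the empty word has charge zero, so one value must be matched.\<close>
  define c where "c = F [] / \<phi> v"
  have "Vector_Spaces.linear scale (*) (\<lambda>x. c * \<phi> x)"
    by (rule linear_functionalI) (simp_all only: \<phi>.add \<phi>.scale distrib_left mult.left_commute)
  moreover have "F ps = c * \<phi> (word_act Y ps v)" if "has_degree l r k ps" for ps
    using has_degree_0[OF that r] \<phi>(2) by (simp add: c_def)
  ultimately show ?case by blast
next
  case (Suc n)
  interpret loop_module scale l Y v by fact
  obtain j where j: "j \<in> {1..l}" "0 < r j"
    using Suc.hyps(2) by (metis Suc_neq_Zero neq0_conv sum.neutral)
  have jl: "j \<le> l" using j by simp
  let ?x = "((j - 1, j), - 1 :: int)"
  let ?r = "r(j := r j - 1)"
  have n: "n = (\<Sum>i = 1..l. ?r i)"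
  proof -
    have "(\<Sum>i = 1..l. ?r i) = (\<Sum>i\<in>{1..l} - {j}. r i) + (r j - 1)"
      using j by (subst sum.remove[of _ j]) (auto intro!: sum.cong)
    moreover have "(\<Sum>i = 1..l. r i) = (\<Sum>i\<in>{1..l} - {j}. r i) + r j"
      using j by (subst sum.remove[of _ j]) auto
    ultimately show ?thesis using Suc.hyps(2) j(2) by simp
  qed
  show ?case
    using \<open>vacuum_functional l F\<close>
  \<comment> \<open>Unshifting lowers the energy by \<open>r j > 0\<close>. With \<open>+ 1\<close>
    the measure also drops when the energy passes from 0 to a negative value, where all functionals
    vanish.\<close>
  proof (induction "nat (k + 1)" arbitrary: F k rule: less_induct)
    case less
    interpret F: vacuum_functional l F by fact
    show ?case
    proof (cases "k < 0")
      case True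
      have "Vector_Spaces.linear scale (*) (\<lambda>x. 0)" by (rule linear_functionalI) simp_all
      moreover have "F ps = 0" if "has_degree l r k ps" for ps
        using F.negative_energy[of "[]" ps] that True by (simp add: has_degree_def)
      ultimately show ?thesis by blast
    next
      case False
      have "vacuum_functional l (\<lambda>ps. F (twist_word j ps @ [?x]))"
        using j by (intro F.twist_functional)
      from Suc.hyps(1)[OF n twist_loop_module[OF j(1)] this]
      obtain \<psi> where \<psi>: "Vector_Spaces.linear scale (*) \<psi>"
        "\<And>ps. has_degree l ?r (lower_energy l j r k) ps \<Longrightarrow> F (twist_word j ps @ [?x]) = \<psi> (word_act (twist j) ps (Y (j - 1) j (- 1) v))"
        by blast
      have last: "F (qs @ [?x]) = \<psi> (word_act Y (qs @ [?x]) v)" if "has_degree l r k (qs @ [?x])" for qs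
      proof -
        obtain ps where ps: "qs = twist_word j ps" using twist_word_surj by metis
        then have d: "has_degree l ?r (lower_energy l j r k) ps" 
          using that has_degree_twist[of j l r k ps, OF j] unfolding ps by blast
        then have "positive_word l ps" by (simp add: has_degree_def)
        then show ?thesis using \<psi>(2)[OF d] by (simp add: ps word_act_twist)
      qed
      define D where "D ps = F ps - \<psi> (word_act Y ps v)" for ps
      \<comment> \<open>\<open>D\<close> is known to vanish on words ending in x_j(-1) in the degree
        \<open>(r, k)\<close> only, whereas \<open>unshift\<close> asks for all such words.\<close>
      define G where "G ps = (if charge ps = r \<and> energy ps = k then D ps else 0)" for ps
      have "vacuum_functional l D" unfolding D_def
        by (intro vacuum_functional_diff less.prems linear_vacuum_functional \<psi>)
      then interpret D: vacuum_functional l D .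
      interpret G: vacuum_functional l G unfolding G_def by (rule D.restrict_degree)
      have "G (p @ [?x]) = 0" if "positive_word l p" for p
        using last[of p] that j by (auto simp: G_def D_def has_degree_def)
      then have H: "vacuum_functional l (\<lambda>ps. G (shift_word j (- 1) ps))" using j by (intro G.unshift)
      have "nat (k - int (r j) + 1) < nat (k + 1)" using False j by auto
      from less.hyps[OF this H] obtain \<theta> where \<theta>: "Vector_Spaces.linear scale (*) \<theta>"
        "\<And>ps. has_degree l r (k - int (r j)) ps \<Longrightarrow> G (shift_word j (- 1) ps) = \<theta> (word_act Y ps v)"
        by blast
      \<comment> \<open>\<open>\<theta>\<close> sees the shifted word; \<open>shift_op\<close>
        realizes this relabelling of modes as a linear map on vectors, so the sum is again a linear
        form in the original vector.\<close>
      have "F ps = \<psi> (word_act Y ps v) + \<theta> (shift_op j (r j) (word_act Y ps v))" if d: "has_degree l r k ps" for ps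
      proof -
        have "G (shift_word j (- 1) (shift_word j 1 ps)) = \<theta> (word_act Y (shift_word j 1 ps) v)"
          using d by (intro \<theta>) (simp add: has_degree_shift)
        also have "word_act Y (shift_word j 1 ps) v = shift_op j (r j) (word_act Y ps v)"
          using d jl by (auto simp: shift_op_word has_degree_def)
        finally show ?thesis using d by (simp add: shift_word_shift_word shift_word_0 G_def D_def has_degree_def diff_eq_eq add.commute)
      qed
      then show ?thesis using linear_functional_compose_shift[OF \<psi>(1) \<theta>(1) jl] by blast
    qed
  qed
qed

section \<open>Kernel and image of the shift on graded pieces\<close>

context loop_module begin

definition word_vectors :: "(nat \<Rightarrow> nat) \<Rightarrow> int \<Rightarrow> 'v set" where
  "word_vectors r k = {word_act Y ps v | ps. has_degree l r k ps}"

lemma shift_op_image: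
  assumes j: "j \<in> {1..l}"
  shows "shift_op j (r j) ` word_vectors r k = word_vectors r (k - int (r j))"
proof -
  have sh: "shift_op j (r j) (word_act Y ps v) = word_act Y (shift_word j 1 ps) v" if "has_degree l r k ps" for ps
    using that j by (auto simp: shift_op_word has_degree_def)
  show ?thesis
  proof (intro equalityI subsetI)
    fix x assume "x \<in> shift_op j (r j) ` word_vectors r k"
    then obtain ps where ps: "has_degree l r k ps" "x = shift_op j (r j) (word_act Y ps v)" by (auto simp: word_vectors_def)
    then have "has_degree l r (k - int (r j)) (shift_word j 1 ps)" by (simp add: has_degree_shift)
    then show "x \<in> word_vectors r (k - int (r j))" using ps sh by (auto simp: word_vectors_def)
  next
    fix x assume "x \<in> word_vectors r (k - int (r j))"
    then obtain ps where ps: "has_degree l r (k - int (r j)) ps" "x = word_act Y ps v" by (auto simp: word_vectors_def)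
    have e: "shift_word j 1 (shift_word j (- 1) ps) = ps" by (simp add: shift_word_shift_word shift_word_0)
    have "has_degree l r k (shift_word j (- 1) ps)"
      using ps(1) has_degree_shift[of l r "k - int (r j)" j "shift_word j (- 1) ps"] by (simp add: e)
    then show "x \<in> shift_op j (r j) ` word_vectors r k"
      using sh[of "shift_word j (- 1) ps"] ps(2) e by (force simp: word_vectors_def)
  qed
qed

lemma twist_word_vectors:
  assumes j: "j \<in> {1..l}" "0 < r j"
  shows "loop_module.word_vectors l (twist j) (Y (j - 1) j (- 1) v) (r(j := r j - 1)) (lower_energy l j r k)
    = {word_act Y (qs @ [((j - 1, j), - 1)]) v | qs. has_degree l r k (qs @ [((j - 1, j), - 1)])}" (is "?L = ?R")
proof -
  interpret tw: loop_module scale l "twist j" "Y (j - 1) j (- 1) v" using j by (intro twist_loop_module)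
  show ?thesis
  proof (intro equalityI subsetI)
    fix x assume "x \<in> ?L"
    then obtain ps where ps: "has_degree l (r(j := r j - 1)) (lower_energy l j r k) ps" "x = word_act (twist j) ps (Y (j - 1) j (- 1) v)"
      unfolding tw.word_vectors_def by blast
    have "positive_word l ps" using ps(1) by (simp add: has_degree_def)
    then have "x = word_act Y (twist_word j ps @ [((j - 1, j), - 1)]) v" using ps(2) by (simp add: word_act_twist)
    moreover have "has_degree l r k (twist_word j ps @ [((j - 1, j), - 1)])" using ps(1) j by (simp only: has_degree_twist)
    ultimately show "x \<in> ?R" by blast
  next
    fix x assume "x \<in> ?R"
    then obtain qs where qs: "has_degree l r k (qs @ [((j - 1, j), - 1)])" "x = word_act Y (qs @ [((j - 1, j), - 1)]) v" by blast
    obtain ps where ps: "qs = twist_word j ps" using twist_word_surj by metis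
    have d: "has_degree l (r(j := r j - 1)) (lower_energy l j r k) ps" using qs(1) j unfolding ps by (simp only: has_degree_twist)
    then have "positive_word l ps" by (simp add: has_degree_def)
    then have "x = word_act (twist j) ps (Y (j - 1) j (- 1) v)" using qs(2) by (simp add: word_act_twist ps)
    then show "x \<in> ?L" using d unfolding tw.word_vectors_def by blast
  qed
qed

text \<open>One inclusion holds because the shift turns x_j(-1) into x_j(0), which kills
  \<open>v\<close>. The other is by duality: a form vanishing on the words ending in x_j(-1) can be
  unshifted and then factors through the module, so it is a form composed with
  \<open>shift_op\<close> and vanishes on the whole kernel.\<close>

lemma shift_op_kernel:
  assumes j: "j \<in> {1..l}" "0 < r j"
  shows "{w \<in> span (word_vectors r k). shift_op j (r j) w = 0} =
     span {word_act Y (qs @ [((j - 1, j), - 1)]) v | qs. has_degree l r k (qs @ [((j - 1, j), - 1)])}" (is "?L = span ?R")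
proof (intro equalityI subsetI)
  have jl: "j \<le> l" using j by simp
  have s0: "shift_op j s 0 = 0" for s using shift_op_scale[OF jl, of s 0 0] by simp
  fix w assume "w \<in> span ?R"
  then show "w \<in> ?L"
  proof (induction rule: span_induct_alt)
    case base
    then show ?case by (simp add: s0 span_zero)
  next
    case (step c x y)
    then obtain qs where qs: "x = word_act Y (qs @ [((j - 1, j), - 1)]) v" "has_degree l r k (qs @ [((j - 1, j), - 1)])" by blast
    have "shift_op j (r j) x = word_act Y (shift_word j 1 (qs @ [((j - 1, j), - 1)])) v"
      unfolding qs(1) using qs(2) jl by (subst shift_op_word) (auto simp: has_degree_def)
    also have "\<dots> = 0"
    proof -
      have "Y (j - 1) j 0 v = 0" using j by (intro Y_vac) auto
      moreover have "word_in l (shift_word j 1 qs)" using qs(2) by (simp add: positive_word_in has_degree_def)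
      ultimately show ?thesis using j by (simp add: word_act_0)
    qed
    finally have "shift_op j (r j) x = 0" .
    moreover have "x \<in> span (word_vectors r k)" using qs unfolding word_vectors_def by (intro span_base) blast
    ultimately show ?case using step by (simp add: shift_op_add[OF jl] shift_op_scale[OF jl] span_add span_scale)
  qed
next
  have jl: "j \<le> l" using j by simp
  fix w assume w: "w \<in> ?L"
  show "w \<in> span ?R"
  proof (rule ccontr)
    assume "w \<notin> span ?R"
    then obtain \<phi> where \<phi>: "Vector_Spaces.linear scale (*) \<phi>" "\<And>y. y \<in> span ?R \<Longrightarrow> \<phi> y = 0" "\<phi> w \<noteq> 0"
      using separating_functional[of w ?R] by blast
    interpret \<phi>: Vector_Spaces.linear scale "(*)" \<phi> by (rule \<phi>)
    define G where "G ps = (if charge ps = r \<and> energy ps = k then \<phi> (word_act Y ps v) else 0)" for ps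
    interpret G: vacuum_functional l G unfolding G_def
      by (intro vacuum_functional.restrict_degree linear_vacuum_functional \<phi>)
    have "G (p @ [((j - 1, j), - 1)]) = 0" if "positive_word l p" for p
    proof (cases "has_degree l r k (p @ [((j - 1, j), - 1)])")
      case True
      then have "word_act Y (p @ [((j - 1, j), - 1)]) v \<in> span ?R" by (intro span_base) blast
      from \<phi>(2)[OF this] show ?thesis by (simp add: G_def)
    next
      case False
      then have "\<not> (charge (p @ [((j - 1, j), - 1)]) = r \<and> energy (p @ [((j - 1, j), - 1)]) = k)"
        using that j by (auto simp: has_degree_def)
      then show ?thesis unfolding G_def by (simp only: if_False)
    qed
    then have "vacuum_functional l (\<lambda>ps. G (shift_word j (- 1) ps))" using j by (intro G.unshift)
    from vacuum_functional_factors[OF loop_module_axioms this]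
    obtain \<theta> where \<theta>: "Vector_Spaces.linear scale (*) \<theta>"
      "\<And>ps. has_degree l r (k - int (r j)) ps \<Longrightarrow> G (shift_word j (- 1) ps) = \<theta> (word_act Y ps v)" by blast
    interpret \<theta>: Vector_Spaces.linear scale "(*)" \<theta> by (rule \<theta>)
    have words: "\<phi> (word_act Y ps v) = \<theta> (shift_op j (r j) (word_act Y ps v))" if d: "has_degree l r k ps" for ps
    proof -
      have "G (shift_word j (- 1) (shift_word j 1 ps)) = \<theta> (word_act Y (shift_word j 1 ps) v)"
        using d by (intro \<theta>) (simp add: has_degree_shift)
      also have "word_act Y (shift_word j 1 ps) v = shift_op j (r j) (word_act Y ps v)"
        using d jl by (auto simp: shift_op_word has_degree_def)
      finally show ?thesis using d by (simp add: shift_word_shift_word shift_word_0 G_def has_degree_def)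
    qed
    have s0: "shift_op j s 0 = 0" for s using shift_op_scale[OF jl, of s 0 0] by simp
    have "\<phi> x = \<theta> (shift_op j (r j) x)" if "x \<in> span (word_vectors r k)" for x
      using that
    proof (induction rule: span_induct_alt)
      case (step c x y)
      then show ?case using words by (auto simp: word_vectors_def \<phi>.add \<phi>.scale \<theta>.add \<theta>.scale shift_op_add[OF jl] shift_op_scale[OF jl])
    qed (simp add: s0 \<phi>.zero \<theta>.zero)
    then have "\<phi> w = \<theta> (shift_op j (r j) w)" using w by simp
    then show False using w \<phi>(3) \<theta>.zero by simp
  qed
qed

end

section \<open>Finite dimension and rank-nullity\<close>

context vector_space begin

text \<open>Unlike \<open>dim\<close>, which is 0 also for a space of infinite dimension, this
  records a finite basis. It refers to the span of an arbitrary set.\<close>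

definition has_dim where
  "has_dim S n \<longleftrightarrow> (\<exists>B. finite B \<and> independent B \<and> span B = span S \<and> card B = n)"

lemma has_dim_imp_dim: "local.has_dim S n \<Longrightarrow> dim S = n"
  unfolding has_dim_def using dim_eq_card by blast

text \<open>A basis of the kernel and lifts of a basis of the image together form a basis. The lifts
  are added one at a time; a dependence would be carried by \<open>T\<close> to one among the basis
  vectors of the image.\<close>

lemma has_dim_rank_nullity:
  assumes T: "Vector_Spaces.linear scale scale T"
    and ker: "{x \<in> span S. T x = 0} = span K" "local.has_dim K m" and im: "local.has_dim (T ` S) n"
  shows "local.has_dim S (m + n)"
proof -
  interpret T: Vector_Spaces.linear scale scale T by (rule T)
  obtain BK where BK: "finite BK" "independent BK" "span BK = span K" "card BK = m" using ker(2) unfolding has_dim_def by blast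
  obtain BI where BI: "finite BI" "independent BI" "span BI = span (T ` S)" "card BI = n" using im unfolding has_dim_def by blast
  have "\<forall>y\<in>BI. \<exists>x\<in>span S. T x = y"
  proof
    fix y assume "y \<in> BI"
    then have "y \<in> T ` span S" using BI(3) span_base T.span_image[of S] by blast
    then show "\<exists>x\<in>span S. T x = y" by blast
  qed
  then obtain g where g: "\<And>y. y \<in> BI \<Longrightarrow> g y \<in> span S" "\<And>y. y \<in> BI \<Longrightarrow> T (g y) = y" by metis
  have TK: "T x = 0" "x \<in> span S" if "x \<in> span BK" for x using that ker(1) BK(3) by auto
  have ind: "independent (BK \<union> g ` C) \<and> card (BK \<union> g ` C) = m + card C" if "C \<subseteq> BI" for C
  proof -
    have "finite C" using that BI(1) finite_subset by blast
    then show ?thesis using that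
    proof (induction C rule: finite_induct)
      case empty
      then show ?case using BK by simp
    next
      case (insert y C)
      have "g y \<notin> span (BK \<union> g ` C)"
      proof
        assume "g y \<in> span (BK \<union> g ` C)"
        then have "y \<in> T ` span (BK \<union> g ` C)" using g(2)[of y] insert.prems by force
        then have "y \<in> span (T ` BK \<union> T ` g ` C)" by (simp add: T.span_image[symmetric] image_Un)
        also have "\<dots> \<subseteq> span ({0} \<union> C)"
        proof (intro span_mono Un_mono subsetI)
          show "y \<in> {0}" if "y \<in> T ` BK" for y using that TK(1) span_base by auto
          show "y \<in> C" if "y \<in> T ` g ` C" for y using that g(2) insert.prems by auto
        qed
        also have "\<dots> = span C" by simp
        finally have "y \<in> span C" .
        moreover have "C \<subseteq> BI - {y}" using insert by auto
        ultimately have "y \<in> span (BI - {y})" using span_mono by blast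
        then show False using BI(2) insert.prems unfolding dependent_def by blast
      qed
      note ny = this
      have nb: "g y \<notin> BK \<union> g ` C" using ny span_base[of "g y"] by metis
      have IH: "independent (BK \<union> g ` C)" "card (BK \<union> g ` C) = m + card C" using insert by auto
      have "independent (insert (g y) (BK \<union> g ` C))" by (rule independent_insertI[OF ny IH(1)])
      moreover have "finite (BK \<union> g ` C)" using BK(1) insert.hyps by simp
      then have "card (insert (g y) (BK \<union> g ` C)) = m + card (insert y C)"
        using nb insert.hyps by (metis card_insert_disjoint add_Suc_right IH(2))
      ultimately show ?case by (simp only: image_insert Un_insert_right not_False_eq_True simp_thms)
    qed
  qed
  have "span (BK \<union> g ` BI) = span S"
  proof
    have "BK \<union> g ` BI \<subseteq> span S" using TK(2) g(1) span_base by blast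
    then show "span (BK \<union> g ` BI) \<subseteq> span S" by (simp add: span_minimal)
    show "span S \<subseteq> span (BK \<union> g ` BI)"
    proof
      fix x assume x: "x \<in> span S"
      have "T ` g ` BI = BI" using g(2) by force
      moreover have "T x \<in> span BI" using x BI(3) T.span_image[of S] by blast
      ultimately have "T x \<in> T ` span (g ` BI)" using T.span_image[of "g ` BI"] by simp
      then obtain z where z: "z \<in> span (g ` BI)" "T x = T z" by blast
      have "span (g ` BI) \<subseteq> span S" using g(1) by (intro span_minimal) auto
      then have "x - z \<in> span S" using x z(1) by (intro span_diff) auto
      then have "x - z \<in> span BK" using z(2) ker(1) BK(3) T.diff by auto
      then have "(x - z) + z \<in> span (BK \<union> g ` BI)"
        using z(1) span_mono[of BK "BK \<union> g ` BI"] span_mono[of "g ` BI" "BK \<union> g ` BI"] by (intro span_add) auto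
      then show "x \<in> span (BK \<union> g ` BI)" by simp
    qed
  qed
  moreover have "finite (BK \<union> g ` BI)" using BK BI by simp
  ultimately show ?thesis using ind[of BI] BI(4) unfolding has_dim_def by blast
qed

end

lemma (in loop_module) shift_op_linear: "j \<le> l \<Longrightarrow> Vector_Spaces.linear scale scale (shift_op j s)"
  by (simp add: Vector_Spaces.linear_iff vector_space_axioms shift_op_add shift_op_scale)

lemma (in loop_module) word_vectors_recursion:
  assumes j: "j \<in> {1..l}" "0 < r j"
    and "has_dim (loop_module.word_vectors l (twist j) (Y (j - 1) j (- 1) v) (r(j := r j - 1)) (lower_energy l j r k)) m"
    and "has_dim (word_vectors r (k - int (r j))) n"
  shows "has_dim (word_vectors r k) (m + n)"
  using has_dim_rank_nullity[OF shift_op_linear shift_op_kernel[of j r, OF j]] shift_op_image twist_word_vectors[of j r, OF j] assms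
  by simp

lemma (in loop_module) word_vectors_negative:
  assumes "k < 0" shows "has_dim (word_vectors r k) 0"
proof -
  have "word_act Y ps v = 0" if "has_degree l r k ps" for ps
  proof (rule ccontr)
    assume "word_act Y ps v \<noteq> 0"
    then obtain \<phi> where \<phi>: "Vector_Spaces.linear scale (*) \<phi>" "\<phi> (word_act Y ps v) \<noteq> 0"
      using separating_functional[of _ "{}"] by auto
    interpret F: vacuum_functional l "\<lambda>ps. \<phi> (word_act Y ps v)" by (rule linear_vacuum_functional) fact
    show False using F.negative_energy[of "[]" ps] that assms \<phi>(2) by (simp add: has_degree_def)
  qed
  then have "word_vectors r k \<subseteq> {0}" by (auto simp: word_vectors_def)
  then have "span (word_vectors r k) = span {}"
    using span_insert_0[of "{}"] by (auto dest: subset_singletonD)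
  then show ?thesis unfolding has_dim_def by (intro exI[of _ "{}"]) (simp add: independent_empty)
qed

text \<open>One number for all modules at once: the induction passes to the twisted module.\<close>

lemma word_vectors_has_dim:
  fixes scale :: "complex \<Rightarrow> 'v::ab_group_add \<Rightarrow> 'v"
  shows "\<exists>n. \<forall>Y v. loop_module scale l Y v \<longrightarrow> vector_space.has_dim scale (loop_module.word_vectors l Y v r k) n"
proof (induction "\<Sum>i = 1..l. r i" arbitrary: r k)
  case 0
  have r: "\<forall>i\<in>{1..l}. r i = 0" using 0 by simp
  have "vector_space.has_dim scale (loop_module.word_vectors l Y v r k) (if has_degree l r k [] then 1 else 0)"
    if "loop_module scale l Y v" for Y :: "nat \<Rightarrow> nat \<Rightarrow> int \<Rightarrow> 'v \<Rightarrow> 'v" and v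
  proof -
    interpret loop_module scale l Y v by fact
    have d0: "ps = []" if "has_degree l r k ps" for ps using has_degree_0[OF that r] .
    have "word_vectors r k = (if has_degree l r k [] then {v} else {})"
      unfolding word_vectors_def by (auto dest: d0 intro!: exI[of _ "[]"])
    moreover have "has_dim {v} 1"
      unfolding has_dim_def using v_nonzero by (intro exI[of _ "{v}"]) simp
    moreover have "has_dim {} 0" unfolding has_dim_def by (intro exI[of _ "{}"]) (simp add: independent_empty)
    ultimately show ?thesis by simp
  qed
  then show ?case by blast
next
  case (Suc n)
  obtain j where j: "j \<in> {1..l}" "0 < r j"
    using Suc.hyps(2) by (metis Suc_neq_Zero neq0_conv sum.neutral)
  let ?r = "r(j := r j - 1)"
  have n: "n = (\<Sum>i = 1..l. ?r i)"
  proof -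
    have "(\<Sum>i = 1..l. ?r i) = (\<Sum>i\<in>{1..l} - {j}. r i) + (r j - 1)"
      using j by (subst sum.remove[of _ j]) (auto intro!: sum.cong)
    moreover have "(\<Sum>i = 1..l. r i) = (\<Sum>i\<in>{1..l} - {j}. r i) + r j"
      using j by (subst sum.remove[of _ j]) auto
    ultimately show ?thesis using Suc.hyps(2) j(2) by simp
  qed
  show ?case
  proof (induction "nat (k + 1)" arbitrary: k rule: less_induct)
    case less
    show ?case
    proof (cases "k < 0")
      case True
      then show ?thesis using loop_module.word_vectors_negative by blast
    next
      case False
      obtain a where a: "\<forall>Y v. loop_module scale l Y v \<longrightarrow> vector_space.has_dim scale (loop_module.word_vectors l Y v ?r (lower_energy l j r k)) a"
        using Suc.hyps(1)[OF n] by blast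
      have "nat (k - int (r j) + 1) < nat (k + 1)" using False j by auto
      from less.hyps[OF this] obtain b where
        b: "\<forall>Y v. loop_module scale l Y v \<longrightarrow> vector_space.has_dim scale (loop_module.word_vectors l Y v r (k - int (r j))) b"
        by blast
      have "vector_space.has_dim scale (loop_module.word_vectors l Y v r k) (a + b)"
        if "loop_module scale l Y v" for Y :: "nat \<Rightarrow> nat \<Rightarrow> int \<Rightarrow> 'v \<Rightarrow> 'v" and v
      proof -
        interpret loop_module scale l Y v by fact
        show ?thesis using a b that twist_loop_module[OF j(1)] by (intro word_vectors_recursion[of j r, OF j]) blast+
      qed
      then show ?thesis by blast
    qed
  qed
qed

text \<open>The kernel is a graded piece of the twisted module. As
  \<open>word_vectors_has_dim\<close> gives one number valid for every module, this piece has the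
  dimension of the piece of the same degree in the original module.\<close>

lemma (in loop_module) dim_word_vectors_recursion:
  assumes j: "j \<in> {1..l}" "0 < r j"
  shows "dim (word_vectors r k) = dim (word_vectors r (k - int (r j))) + dim (word_vectors (r(j := r j - 1)) (lower_energy l j r k))"
proof -
  obtain a where a: "\<forall>Y v. loop_module scale l Y v \<longrightarrow> has_dim (loop_module.word_vectors l Y v (r(j := r j - 1)) (lower_energy l j r k)) a"
    using word_vectors_has_dim by blast
  obtain b where b: "\<forall>Y v. loop_module scale l Y v \<longrightarrow> has_dim (loop_module.word_vectors l Y v r (k - int (r j))) b"
    using word_vectors_has_dim by blast
  have "has_dim (word_vectors r k) (a + b)"
    using a b twist_loop_module[OF j(1)] loop_module_axioms by (intro word_vectors_recursion[of j r, OF j]) blast+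
  then show ?thesis using a b loop_module_axioms has_dim_imp_dim by (metis add.commute)
qed

lemma (in loop_module) dim_word_vectors_negative: "k < 0 \<Longrightarrow> dim (word_vectors r k) = 0"
  using word_vectors_negative has_dim_imp_dim by blast


section \<open>The standard module\<close>

definition traceless_unit :: "nat \<Rightarrow> nat \<Rightarrow> nat \<Rightarrow> complex mat" where
  "traceless_unit l a b = mat (l + 1) (l + 1) (\<lambda>(i, j).
     (if i = a \<and> j = b then 1 else 0) - (if a = b \<and> i = j then 1 / of_nat (l + 1) else 0))"

lemma traceless_unit_carrier [simp]: "traceless_unit l a b \<in> carrier_mat (l + 1) (l + 1)"
  "dim_row (traceless_unit l a b) = l + 1" "dim_col (traceless_unit l a b) = l + 1"
  by (simp_all add: traceless_unit_def)

lemma traceless_unit_index: "i \<le> l \<Longrightarrow> j \<le> l \<Longrightarrow> traceless_unit l a b $$ (i, j) =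
   (if i = a \<and> j = b then 1 else 0) - (if a = b \<and> i = j then 1 / of_nat (l + 1) else 0)"
  by (simp add: traceless_unit_def)

lemma root_vec_eq_traceless_unit: "a \<noteq> b \<Longrightarrow> root_vec l a b = traceless_unit l a b"
  by (simp add: root_vec_def traceless_unit_def)

lemma traceless_unit_sum:
  assumes "i \<le> l" "b \<le> l"
  shows "(\<Sum>k<l + 1. traceless_unit l a b $$ (i, k) * f k) =
    (if i = a then f b else 0) - (if a = b then f i / of_nat (l + 1) else 0)"
proof -
  have "(\<Sum>k<l + 1. traceless_unit l a b $$ (i, k) * f k) =
    (\<Sum>k<l + 1. (if k = b then (if i = a then f b else 0) else 0) - (if k = i then (if a = b then f i / of_nat (l + 1) else 0) else 0))"
    using assms by (intro sum.cong refl) (auto simp: traceless_unit_index left_diff_distrib)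
  also have "\<dots> = (if i = a then f b else 0) - (if a = b then f i / of_nat (l + 1) else 0)"
    using assms by (simp add: sum_subtractf del: sum.lessThan_Suc)
  finally show ?thesis .
qed

lemma mat_trace_traceless_unit:
  assumes "a \<le> l" "b \<le> l"
  shows "mat_trace (traceless_unit l a b) = 0"
proof -
  have "mat_trace (traceless_unit l a b) = (\<Sum>i<l + 1. (if i = a then (if a = b then 1 else 0) else 0) - (if a = b then 1 / of_nat (l + 1) else 0))"
    unfolding mat_trace_def by (intro sum.cong) (auto simp: traceless_unit_index)
  also have "\<dots> = 0"
    using assms by (simp add: sum_subtractf del: sum.lessThan_Suc of_nat_Suc)
  finally show ?thesis .
qed

lemma traceless_unit_in_sl: "a \<le> l \<Longrightarrow> b \<le> l \<Longrightarrow> traceless_unit l a b \<in> sl_carrier l"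
  using traceless_unit_carrier(1)[of l a b] by (simp only: sl_carrier_def mem_Collect_eq mat_trace_traceless_unit simp_thms)

lemma traceless_unit_product:
  assumes "i \<le> l" "j \<le> l" "b \<le> l"
  shows "(traceless_unit l a b * traceless_unit l c d) $$ (i, j) =
     (if i = a then traceless_unit l c d $$ (b, j) else 0) - (if a = b then traceless_unit l c d $$ (i, j) / of_nat (l + 1) else 0)"
proof -
  have "(traceless_unit l a b * traceless_unit l c d) $$ (i, j) = (\<Sum>k<l + 1. traceless_unit l a b $$ (i, k) * traceless_unit l c d $$ (k, j))"
    using assms by (simp add: scalar_prod_def lessThan_atLeast0 del: sum.lessThan_Suc sum.op_ivl_Suc)
  then show ?thesis using assms by (simp only: traceless_unit_sum)
qed

lemma mat_bracket_traceless_unit: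
  assumes "a \<le> l" "b \<le> l" "c \<le> l" "d \<le> l"
  shows "mat_bracket (traceless_unit l a b) (traceless_unit l c d) =
    (if b = c then 1 else 0) \<cdot>\<^sub>m traceless_unit l a d + (if a = d then - 1 else 0) \<cdot>\<^sub>m traceless_unit l c b"
proof (rule eq_matI)
  fix i j
  assume "i < dim_row ((if b = c then 1 else 0) \<cdot>\<^sub>m traceless_unit l a d + (if a = d then - 1 else 0) \<cdot>\<^sub>m traceless_unit l c b)"
    "j < dim_col ((if b = c then 1 else 0) \<cdot>\<^sub>m traceless_unit l a d + (if a = d then - 1 else 0) \<cdot>\<^sub>m traceless_unit l c b)"
  then have ij: "i \<le> l" "j \<le> l" by simp_all
  have "mat_bracket (traceless_unit l a b) (traceless_unit l c d) $$ (i, j) =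
     (traceless_unit l a b * traceless_unit l c d) $$ (i, j) - (traceless_unit l c d * traceless_unit l a b) $$ (i, j)"
    using ij by (simp add: mat_bracket_def)
  also have "\<dots> = (if b = c then 1 else 0) * traceless_unit l a d $$ (i, j) + (if a = d then - 1 else 0) * traceless_unit l c b $$ (i, j)"
    unfolding traceless_unit_product[OF ij assms(2)] traceless_unit_product[OF ij assms(4)]
    using ij assms by (simp add: traceless_unit_index diff_divide_distrib)
  also have "\<dots> = ((if b = c then 1 else 0) \<cdot>\<^sub>m traceless_unit l a d + (if a = d then - 1 else 0) \<cdot>\<^sub>m traceless_unit l c b) $$ (i, j)"
    using ij by simp
  finally show "mat_bracket (traceless_unit l a b) (traceless_unit l c d) $$ (i, j) =
    ((if b = c then 1 else 0) \<cdot>\<^sub>m traceless_unit l a d + (if a = d then - 1 else 0) \<cdot>\<^sub>m traceless_unit l c b) $$ (i, j)" .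
qed (simp_all add: mat_bracket_def)

lemma inv_form_traceless_unit:
  assumes "a \<le> l" "b \<le> l" "c \<le> l" "d \<le> l"
  shows "inv_form (traceless_unit l a b) (traceless_unit l c d) =
     (if b = c \<and> a = d then 1 else 0) - (if a = b \<and> c = d then 1 / of_nat (l + 1) else 0)"
proof -
  let ?B = "traceless_unit l c d"
  have "inv_form (traceless_unit l a b) ?B = (\<Sum>i<l + 1. (traceless_unit l a b * ?B) $$ (i, i))"
    by (simp add: inv_form_def mat_trace_def)
  also have "\<dots> = (\<Sum>i<l + 1. (if i = a then ?B $$ (b, a) else 0) - (if a = b then ?B $$ (i, i) / of_nat (l + 1) else 0))"
  proof (intro sum.cong refl)
    fix i assume "i \<in> {..<l + 1}"
    then have i: "i \<le> l" by simp
    show "(traceless_unit l a b * ?B) $$ (i, i) = (if i = a then ?B $$ (b, a) else 0) - (if a = b then ?B $$ (i, i) / of_nat (l + 1) else 0)"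
      unfolding traceless_unit_product[OF i i assms(2)] by simp
  qed
  also have "\<dots> = ?B $$ (b, a) - (if a = b then (\<Sum>i<l + 1. ?B $$ (i, i)) / of_nat (l + 1) else 0)"
    using assms by (simp add: sum_subtractf sum_divide_distrib del: sum.lessThan_Suc)
  also have "(\<Sum>i<l + 1. ?B $$ (i, i)) = 0"
    using mat_trace_traceless_unit[OF assms(3,4)] by (simp add: mat_trace_def)
  also have "?B $$ (b, a) - (if a = b then 0 / of_nat (l + 1) else 0)
     = (if b = c \<and> a = d then 1 else 0) - (if a = b \<and> c = d then 1 / of_nat (l + 1) else 0)"
    using assms by (auto simp: traceless_unit_index)
  finally show ?thesis .
qed

context affine_sl_module begin

lemma X_zero: "X (0\<^sub>m (l + 1) (l + 1)) m w = 0"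
proof -
  have "0\<^sub>m (l + 1) (l + 1) = 0 \<cdot>\<^sub>m traceless_unit l 0 0" by (rule eq_matI) simp_all
  then show ?thesis using X_smult[of "traceless_unit l 0 0" 0 m w] by (simp add: traceless_unit_in_sl)
qed

lemma sl_carrier_add: "x \<in> sl_carrier l \<Longrightarrow> y \<in> sl_carrier l \<Longrightarrow> x + y \<in> sl_carrier l"
  by (auto simp: sl_carrier_def mat_trace_def sum.distrib)

lemma sl_carrier_smult: "x \<in> sl_carrier l \<Longrightarrow> c \<cdot>\<^sub>m x \<in> sl_carrier l"
proof -
  assume x: "x \<in> sl_carrier l"
  then have "mat_trace (c \<cdot>\<^sub>m x) = c * mat_trace x"
    unfolding mat_trace_def sum_distrib_left by (intro sum.cong) (auto simp: sl_carrier_def)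
  then show ?thesis using x by (simp add: sl_carrier_def)
qed

text \<open>Linear combinations are written entrywise because the zero matrix depends on the size.
  Membership is carried along since additivity of \<open>X\<close> is available only inside the
  carrier.\<close>

lemma X_sum:
  assumes "finite I" "\<And>p. p \<in> I \<Longrightarrow> M p \<in> sl_carrier l"
  shows "mat (l + 1) (l + 1) (\<lambda>(i, j). \<Sum>p\<in>I. c p * M p $$ (i, j)) \<in> sl_carrier l \<and>
    X (mat (l + 1) (l + 1) (\<lambda>(i, j). \<Sum>p\<in>I. c p * M p $$ (i, j))) m w = (\<Sum>p\<in>I. scale (c p) (X (M p) m w))"
  using assms
proof (induction I rule: finite_induct)
  case empty
  have e: "mat (l + 1) (l + 1) (\<lambda>(i, j). 0) = 0\<^sub>m (l + 1) (l + 1)"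
    by (rule eq_matI) simp_all
  show ?case unfolding sum.empty e X_zero by (simp add: sl_carrier_def mat_trace_def)
next
  case (insert q I)
  let ?S = "\<lambda>I. mat (l + 1) (l + 1) (\<lambda>(i, j). \<Sum>p\<in>I. c p * M p $$ (i, j))"
  have q: "M q \<in> sl_carrier l" "c q \<cdot>\<^sub>m M q \<in> sl_carrier l" using insert.prems sl_carrier_smult by auto
  have "\<And>p. p \<in> I \<Longrightarrow> M p \<in> sl_carrier l" using insert.prems by simp
  note IH = conjunct1[OF insert.IH[OF this]] conjunct2[OF insert.IH[OF this]]
  have e: "?S (insert q I) = c q \<cdot>\<^sub>m M q + ?S I"
    using insert.hyps q by (intro eq_matI) (auto simp: sl_carrier_def)
  have step: "N \<in> sl_carrier l \<and> X N m w = scale (c q) (X (M q) m w) + R"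
    if "N = c q \<cdot>\<^sub>m M q + N'" "N' \<in> sl_carrier l" "X N' m w = R" for N N' R
    using that q by (simp add: X_add X_smult sl_carrier_add)
  have r: "(\<Sum>p\<in>insert q I. scale (c p) (X (M p) m w)) = scale (c q) (X (M q) m w) + (\<Sum>p\<in>I. scale (c p) (X (M p) m w))"
    using insert.hyps by simp
  show ?case unfolding r by (rule step[OF e IH])
qed

text \<open>Replacing matrix units by their traceless parts changes the expansion of
  \<open>x\<close> by a multiple of its trace, which is zero.\<close>

lemma X_expand:
  assumes x: "x \<in> sl_carrier l"
  shows "X x m w = (\<Sum>a\<le>l. \<Sum>b\<le>l. scale (x $$ (a, b)) (X (traceless_unit l a b) m w))"
proof -
  let ?I = "{..l} \<times> {..l}"
  have "x = mat (l + 1) (l + 1) (\<lambda>(i, j). \<Sum>p\<in>?I. x $$ p * traceless_unit l (fst p) (snd p) $$ (i, j))" (is "x = ?M")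
  proof (rule eq_matI)
    fix i j assume "i < dim_row ?M" "j < dim_col ?M"
    then have ij: "i \<le> l" "j \<le> l" by simp_all
    have tr: "(\<Sum>a\<le>l. x $$ (a, a)) = 0"
      using x by (auto simp: sl_carrier_def mat_trace_def lessThan_Suc_atMost)
    have "(\<Sum>p\<in>?I. x $$ p * traceless_unit l (fst p) (snd p) $$ (i, j)) =
      (\<Sum>a\<le>l. \<Sum>b\<le>l. (if b = j then (if a = i then x $$ (a, b) else 0) else 0)
         - (if b = a then (if i = j then x $$ (a, a) / of_nat (l + 1) else 0) else 0))"
      unfolding sum.cartesian_product[symmetric] fst_conv snd_conv
      using ij by (subst sum.cartesian_product) (auto simp: traceless_unit_index sum.cartesian_product right_diff_distrib intro!: sum.cong)
    also have "\<dots> = x $$ (i, j) - (if i = j then (\<Sum>a\<le>l. x $$ (a, a)) / of_nat (l + 1) else 0)"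
      using ij by (simp add: sum_subtractf sum_divide_distrib)
    finally show "x $$ (i, j) = ?M $$ (i, j)" using ij tr by simp
  qed (use x in \<open>auto simp: sl_carrier_def\<close>)
  then have "X x m w = X ?M m w" by simp
  also have "\<dots> = (\<Sum>p\<in>?I. scale (x $$ p) (X (traceless_unit l (fst p) (snd p)) m w))"
    using X_sum[of ?I "\<lambda>p. traceless_unit l (fst p) (snd p)" "\<lambda>p. x $$ p" m w] traceless_unit_in_sl by auto
  finally show ?thesis by (simp add: sum.cartesian_product split_def)
qed

end

section \<open>Identification of the gradings and of the principal subspace\<close>

context level_one_standard_module begin

abbreviation Y :: "nat \<Rightarrow> nat \<Rightarrow> int \<Rightarrow> 'v \<Rightarrow> 'v" where
  "Y a b \<equiv> X (traceless_unit l a b)"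

lemma Y_trace_zero: "(\<Sum>a\<le>l. Y a a m w) = 0"
proof -
  have "mat (l + 1) (l + 1) (\<lambda>(i, j). \<Sum>a\<le>l. 1 * traceless_unit l a a $$ (i, j)) = 0\<^sub>m (l + 1) (l + 1)" (is "?M = _")
  proof (rule eq_matI)
    fix i j assume "i < dim_row (0\<^sub>m (l + 1) (l + 1) :: complex mat)" "j < dim_col (0\<^sub>m (l + 1) (l + 1) :: complex mat)"
    then have ij: "i \<le> l" "j \<le> l" by simp_all
    have "(\<Sum>a\<le>l. 1 * traceless_unit l a a $$ (i, j)) = (\<Sum>a\<le>l. (if a = i then (if i = j then 1 else 0) else 0) - (if i = j then 1 / of_nat (l + 1) else 0))"
      using ij by (intro sum.cong refl) (auto simp: traceless_unit_index)
    also have "\<dots> = 0" using ij by (simp add: sum_subtractf del: of_nat_Suc)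
    finally show "?M $$ (i, j) = 0\<^sub>m (l + 1) (l + 1) $$ (i, j)" using ij by simp
  qed simp_all
  then show ?thesis
    using X_sum[of "{..l}" "\<lambda>a. traceless_unit l a a" "\<lambda>_. 1" m w] X_zero[of m w] traceless_unit_in_sl by simp
qed

sublocale L: loop_module scale l Y v
proof
  fix a b c d :: nat and m n :: int and w x y :: 'v and z :: complex
  assume ab: "a \<le> l" "b \<le> l"
  interpret A: Vector_Spaces.linear scale scale "Y a b m" using ab by (intro linear_X traceless_unit_in_sl)
  show "Y a b m (x + y) = Y a b m x + Y a b m y" by (rule A.add)
  show "Y a b m (scale z x) = scale z (Y a b m x)" by (rule A.scale)
  show "Y a b m v = 0" if "0 \<le> m" using that ab by (intro hw_annihilated traceless_unit_in_sl)
next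
  fix a b c d :: nat and m n :: int and w :: 'v
  assume i: "a \<le> l" "b \<le> l" "c \<le> l" "d \<le> l"
  have "Y a b m (Y c d n w) - Y c d n (Y a b m w) =
     X (mat_bracket (traceless_unit l a b) (traceless_unit l c d)) (m + n) w
      + (if m + n = 0 then scale (of_int m * inv_form (traceless_unit l a b) (traceless_unit l c d)) (C w) else 0)"
    using i by (intro X_bracket traceless_unit_in_sl)
  also have "X (mat_bracket (traceless_unit l a b) (traceless_unit l c d)) (m + n) w =
     (if b = c then Y a d (m + n) w else 0) - (if a = d then Y c b (m + n) w else 0)"
    unfolding mat_bracket_traceless_unit[OF i]
    using i by (subst X_add) (auto simp: sl_carrier_smult traceless_unit_in_sl X_smult)
  finally show "Y a b m (Y c d n w) - Y c d n (Y a b m w) =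
        (if b = c then Y a d (m + n) w else 0) - (if a = d then Y c b (m + n) w else 0)
        + (if m + n = 0 then scale (of_int m * ((if b = c \<and> a = d then 1 else 0)
            - (if a = b \<and> c = d then 1 / of_nat (l + 1) else 0))) w else 0)"
    unfolding inv_form_traceless_unit[OF i] level_one .
next
  fix m w
  show "(\<Sum>a\<le>l. Y a a m w) = 0" by (rule Y_trace_zero)
next
  fix S assume S: "subspace S" and cl: "\<And>a b m w. a \<le> l \<Longrightarrow> b \<le> l \<Longrightarrow> w \<in> S \<Longrightarrow> Y a b m w \<in> S"
  have "submodule S" unfolding submodule_def
  proof (intro conjI ballI allI)
    fix x m w assume h: "x \<in> sl_carrier l" "w \<in> S"
    show "X x m w \<in> S" unfolding X_expand[OF h(1)]
      using cl h(2) by (intro subspace_sum[OF S] subspace_scale[OF S]) auto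
  qed (use S level_one in auto)
  then show "S = {0} \<or> S = UNIV" using irreducible by (simp add: irreducible_module_def)
qed (rule hw_nonzero)

text \<open>The constant j / (l + 1) on the diagonal of the fundamental weight multiplies the sum of
  all diagonal operators, which is zero; the first \<open>j\<close> of them remain.\<close>

lemma fund_weight_eq_lam:
  assumes "j \<in> {1..l}"
  shows "X (fund_weight l j) m w = L.lam j m w"
proof -
  let ?c = "\<lambda>a. (if a < j then 1 else 0) - of_nat j / of_nat (l + 1) :: complex"
  have "X (fund_weight l j) m w = (\<Sum>a\<le>l. \<Sum>b\<le>l. scale (fund_weight l j $$ (a, b)) (Y a b m w))"
    by (rule X_expand[OF fund_weight_in_sl[OF assms]])
  also have "\<dots> = (\<Sum>a\<le>l. \<Sum>b\<le>l. if b = a then scale (?c a) (Y a a m w) else 0)"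
    by (intro sum.cong refl) (auto simp: fund_weight_def)
  also have "\<dots> = (\<Sum>a\<le>l. (if a < j then Y a a m w else 0) - scale (of_nat j / of_nat (l + 1)) (Y a a m w))"
    by (intro sum.cong refl) (auto simp: scale_left_diff_distrib)
  also have "\<dots> = (\<Sum>a\<le>l. if a < j then Y a a m w else 0)"
    by (simp add: sum_subtractf scale_sum_right[symmetric] Y_trace_zero del: of_nat_add)
  also have "\<dots> = (\<Sum>a<j. Y a a m w)"
  proof -
    have "{a \<in> {..l}. a < j} = {..<j}" using assms by auto
    then show ?thesis by (simp add: sum.inter_filter[symmetric])
  qed
  finally show ?thesis by (simp add: L.lam_def)
qed

lemma simple_root_eq:
  assumes "i \<in> {1..l}"
  shows "X (simple_root l i) m w = Y (i - 1) (i - 1) m w - Y i i m w"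
proof -
  have i: "i - 1 \<le> l" "i \<le> l" using assms by auto
  have "simple_root l i = 1 \<cdot>\<^sub>m traceless_unit l (i - 1) (i - 1) + (- 1) \<cdot>\<^sub>m traceless_unit l i i"
    by (rule eq_matI) (auto simp: simple_root_def root_vec_def traceless_unit_def)
  then show ?thesis
    using i by (simp add: X_add X_smult sl_carrier_smult traceless_unit_in_sl)
qed

text \<open>Only the Cartan parts differ. Fundamental weights are partial sums and simple roots
  differences of the diagonal units, so summation by parts applies; the trace relation evaluates the
  boundary term.\<close>

lemma casimir_modes_eq: "casimir_modes m w = L.casimir m w"
proof -
  let ?D = "\<lambda>a. Y a a (- m)"
  let ?S = "\<lambda>i. L.lam i m w"
  have cartan: "(\<Sum>i = 1..k. ?D (i - 1) (?S i) - ?D i (?S i)) = (\<Sum>a<k. ?D a (Y a a m w)) - ?D k (?S k)" if "k \<le> l" for k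
    using that
  proof (induction k)
    case 0
    then show ?case by (simp add: L.lam_def)
  next
    case (Suc k)
    have "?S (Suc k) = ?S k + Y k k m w" by (simp add: L.lam_def)
    then show ?case using Suc by (simp add: L.Y_add)
  qed
  have "?S l = - Y l l m w"
  proof -
    have "?S l + Y l l m w = 0"
      using Y_trace_zero[of m w] by (simp add: L.lam_def lessThan_Suc_atMost[symmetric])
    then show ?thesis by (simp add: eq_neg_iff_add_eq_0)
  qed
  then have "(\<Sum>i = 1..l. ?D (i - 1) (?S i) - ?D i (?S i)) = (\<Sum>a\<le>l. ?D a (Y a a m w))"
    unfolding cartan[OF order_refl] by (simp add: L.Y_minus lessThan_Suc_atMost[symmetric])
  moreover have "(\<Sum>i = 1..l. X (simple_root l i) (- m) (X (fund_weight l i) m w)) = (\<Sum>i = 1..l. ?D (i - 1) (?S i) - ?D i (?S i))"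
    by (intro sum.cong refl) (simp add: simple_root_eq fund_weight_eq_lam)
  moreover have "(\<Sum>(a, b) \<in> {(a, b). a \<le> l \<and> b \<le> l \<and> a \<noteq> b}. X (root_vec l a b) (- m) (X (root_vec l b a) m w))
     = (\<Sum>a\<le>l. \<Sum>b\<le>l. if a \<noteq> b then Y a b (- m) (Y b a m w) else 0)"
  proof -
    have e: "{(a, b). a \<le> l \<and> b \<le> l \<and> a \<noteq> b} = {p \<in> {..l} \<times> {..l}. fst p \<noteq> snd p}" by auto
    show ?thesis unfolding sum.cartesian_product e
      by (subst sum.inter_filter) (auto simp: root_vec_eq_traceless_unit intro!: sum.cong)
  qed
  moreover have "L.casimir m w = (\<Sum>a\<le>l. \<Sum>b\<le>l. if a \<noteq> b then Y a b (- m) (Y b a m w) else 0) + (\<Sum>a\<le>l. ?D a (Y a a m w))"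
  proof -
    have "L.casimir m w = (\<Sum>a\<le>l. \<Sum>b\<le>l. (if a \<noteq> b then Y a b (- m) (Y b a m w) else 0) + (if b = a then ?D a (Y a a m w) else 0))"
      unfolding L.casimir_def by (intro sum.cong refl) auto
    then show ?thesis by (simp add: sum.distrib)
  qed
  ultimately show ?thesis by (simp add: casimir_modes_def)
qed

lemma virasoro_L0_eq: "virasoro_L0 w = L.L0 w"
  by (simp add: virasoro_L0_def L.L0_def casimir_modes_eq)

lemma root_monomial_eq: "positive_word l ps \<Longrightarrow> root_monomial ps = word_act Y ps v"
  unfolding root_monomial_def
proof (induction ps)
  case (Cons p ps)
  then show ?case by (cases p; cases "fst p") (auto simp: root_vec_eq_traceless_unit)
qed simp

lemma principal_subspace_eq: "principal_subspace = span {word_act Y ps v | ps. positive_word l ps}"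
proof -
  have "{root_monomial ps | ps. \<forall>((a, b), m) \<in> set ps. a < b \<and> b \<le> l} = {word_act Y ps v | ps. positive_word l ps}"
    unfolding positive_word_def[symmetric] by (auto simp: root_monomial_eq) (metis root_monomial_eq)
  then show ?thesis by (simp add: principal_subspace_def)
qed

lemma lam_word: "positive_word l ps \<Longrightarrow> j \<le> l \<Longrightarrow> L.lam j 0 (word_act Y ps v) = scale (of_nat (charge ps j)) (word_act Y ps v)"
proof (induction ps)
  case Nil
  then show ?case by (simp add: L.lam_vac)
next
  case (Cons p ps)
  obtain a b m where p: "p = ((a, b), m)" by (metis surj_pair)
  have "a \<le> l" "b \<le> l" "a < b" "positive_word l ps" using Cons.prems by (auto simp: p)
  then show ?case using Cons.IH Cons.prems(2) by (simp add: p L.lam_Y L.Y_scale scale_left_distrib)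
qed

text \<open>Word vectors are joint eigenvectors of the charge operators and L(0). When a vector of
  the graded piece is written as a combination of them, independence of eigenvectors removes all
  words of other degrees.\<close>

lemma graded_piece_eq:
  assumes r: "\<forall>i. i \<notin> {1..l} \<longrightarrow> r i = 0"
  shows "graded_piece r k = span (L.word_vectors r (int k))"
proof (intro equalityI subsetI)
  fix w assume "w \<in> span (L.word_vectors r (int k))"
  then show "w \<in> graded_piece r k"
  proof (induction rule: span_induct_alt)
    case base
    then show ?case
      using L.L0_scale[of 0 0] by (simp add: graded_piece_def principal_subspace_eq span_zero fund_weight_eq_lam L.lam_0 virasoro_L0_eq)
  next
    case (step c x y)
    then obtain ps where ps: "x = word_act Y ps v" "has_degree l r (int k) ps" by (auto simp: L.word_vectors_def)
    then have d: "positive_word l ps" "charge ps = r" "energy ps = int k" by (auto simp: has_degree_def)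
    have x: "x \<in> principal_subspace" "\<forall>j\<in>{1..l}. L.lam j 0 x = scale (of_nat (r j)) x" "L.L0 x = scale (of_nat k) x"
      using ps(1) d lam_word[OF d(1)] L.L0_word_vac[OF positive_word_in[OF d(1)]]
      by (auto simp: principal_subspace_eq intro!: span_base)
    show ?case using step.IH x
      by (auto simp: graded_piece_def fund_weight_eq_lam virasoro_L0_eq principal_subspace_eq span_add span_scale
          L.lam_add L.lam_scale L.L0_add L.L0_scale scale_right_distrib mult.commute)
  qed
next
  fix w assume w: "w \<in> graded_piece r k"
  obtain t c where t: "finite t" "t \<subseteq> {word_act Y ps v | ps. positive_word l ps}" "w = (\<Sum>a\<in>t. scale (c a) a)"
    using w unfolding graded_piece_def principal_subspace_eq span_explicit by blast
  have "\<forall>a\<in>t. \<exists>ps. positive_word l ps \<and> a = word_act Y ps v" using t(2) by blast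
  from bchoice[OF this] obtain wd where wd: "\<And>a. a \<in> t \<Longrightarrow> positive_word l (wd a)" "\<And>a. a \<in> t \<Longrightarrow> a = word_act Y (wd a) v" by blast
  define e where "e a = (charge (wd a), energy (wd a))" for a
  define d0 where "d0 = (r, int k)"
  define D where "D = insert d0 (e ` t)"
  define g where "g d = (\<Sum>a | a \<in> t \<and> e a = d. scale (c a) a)" for d
  define f where "f d = g d - (if d = d0 then w else 0)" for d
  \<comment> \<open>The index 0 is free for the energy, as charges are numbered from 1. Subtracting
    \<open>w\<close> at \<open>d0\<close> makes the components sum to zero, so
    \<open>f d0 = 0\<close> says that \<open>w\<close> is its component of degree
    \<open>d0\<close>.\<close>
  define T where "T i = (if i = 0 then L.L0 else L.lam i 0)" for i
  define \<mu> where "\<mu> i d = (if i = 0 then of_int (snd d) else of_nat (fst d i) :: complex)" for i :: nat and d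
  have T_add: "T i (x + y) = T i x + T i y" and T_scale: "T i (scale z x) = scale z (T i x)" if "i \<in> {0..l}" for i x y z
    using that by (auto simp: T_def L.L0_add L.L0_scale L.lam_add L.lam_scale)
  have T_sum: "T i (sum h A) = (\<Sum>a\<in>A. T i (h a))" if "i \<in> {0..l}" for i h and A :: "'v set"
    using T_scale[OF that, of 0 0] by (induction A rule: infinite_finite_induct) (auto simp: T_add[OF that])
  have Ta: "T i a = scale (\<mu> i (e a)) a" if "i \<in> {0..l}" "a \<in> t" for i a
    using that wd[OF that(2)] lam_word[of "wd a" i] L.L0_word_vac[OF positive_word_in, of "wd a"]
    by (simp add: T_def \<mu>_def e_def)
  have Tg: "T i (g d) = scale (\<mu> i d) (g d)" if "i \<in> {0..l}" for i d
    using that Ta unfolding g_def by (simp add: T_sum T_scale scale_sum_right mult.commute)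
  have Tw: "T i w = scale (\<mu> i d0) w" if "i \<in> {0..l}" for i
    using w that by (auto simp: graded_piece_def T_def \<mu>_def d0_def fund_weight_eq_lam virasoro_L0_eq)
  have "f d0 = 0"
  proof (rule eigenvectors_independent[where D = D and I = "{0..l}" and T = T and \<mu> = \<mu>])
    show "finite D" using t by (simp add: D_def)
    show "d0 \<in> D" by (simp add: D_def)
    show "T i (f d) = scale (\<mu> i d) (f d)" if "i \<in> {0..l}" for i d
    proof -
      have diff: "T i (x - y) = T i x - T i y" for x y
        using T_add[OF that, of "x - y" y] by (simp add: algebra_simps)
      have "T i 0 = 0" using T_scale[OF that, of 0 0] by simp
      then show ?thesis using Tg[OF that] Tw[OF that] by (simp add: f_def diff scale_right_diff_distrib)
    qed
    show "\<exists>i\<in>{0..l}. \<mu> i d \<noteq> \<mu> i d'" if "d \<in> D" "d' \<in> D" "d \<noteq> d'" for d d'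
    proof (rule ccontr)
      assume "\<not> (\<exists>i\<in>{0..l}. \<mu> i d \<noteq> \<mu> i d')"
      then have eq: "\<mu> i d = \<mu> i d'" if "i \<le> l" for i using that by auto
      have "snd d = snd d'" using eq[of 0] by (simp add: \<mu>_def)
      moreover have "fst d i = fst d' i" for i
      proof (cases "i \<in> {1..l}")
        case True
        then show ?thesis using eq[of i] by (simp add: \<mu>_def)
      next
        case False
        have c0: "charge ps i = 0" if "positive_word l ps" for ps
          using that False by (induction ps) auto
        have "fst x i = 0" if "x \<in> D" for x
          using that r False c0 wd(1) by (auto simp: D_def d0_def e_def)
        then show ?thesis using that by simp
      qed
      ultimately show False using \<open>d \<noteq> d'\<close> by (simp add: prod_eq_iff fun_eq_iff)
    qed
    have "(\<Sum>d\<in>D. g d) = w" unfolding g_def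
      using t by (subst sum.group) (auto simp: D_def)
    moreover have "(\<Sum>d\<in>D. if d = d0 then w else 0) = w" using t by (simp add: D_def)
    ultimately show "(\<Sum>d\<in>D. f d) = 0" by (simp add: f_def sum_subtractf)
  qed (use T_add T_scale in auto)
  then have "w = g d0" by (simp add: f_def)
  moreover have "g d0 \<in> span (L.word_vectors r (int k))"
    unfolding g_def
  proof (intro span_sum span_scale span_base)
    fix a assume "a \<in> {a \<in> t. e a = d0}"
    then show "a \<in> L.word_vectors r (int k)"
      using wd by (auto simp: L.word_vectors_def has_degree_def e_def d0_def intro!: exI[of _ "wd a"])
  qed
  ultimately show "w \<in> span (L.word_vectors r (int k))" by simp
qed

text \<open>Valid for every integer \<open>n\<close>: in negative degrees the series has no terms,
  and the word vectors vanish by \<open>dim_word_vectors_negative\<close>.\<close>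

lemma graded_dim_nth:
  "fls_nth (graded_dim r) n = (if \<forall>i. i \<notin> {1..l} \<longrightarrow> r i = 0 then int (dim (L.word_vectors r n)) else 0)"
proof (cases "\<forall>i. i \<notin> {1..l} \<longrightarrow> r i = 0")
  case True
  have "graded_dim r = fps_to_fls (Abs_fps (\<lambda>k. of_nat (dim (graded_piece r k))))"
    unfolding graded_dim_def using True by (rule if_P)
  then show ?thesis
    unfolding if_P[OF True] by (simp add: graded_piece_eq[OF True] L.dim_word_vectors_negative)
next
  case False
  have "graded_dim r = 0" unfolding graded_dim_def using False by (rule if_not_P)
  then show ?thesis unfolding if_not_P[OF False] by simp
qed

end

theorem theorem3:
  fixes scale :: "complex \<Rightarrow> 'v::ab_group_add \<Rightarrow> 'v"
    and l :: nat
    and X :: "complex mat \<Rightarrow> int \<Rightarrow> 'v \<Rightarrow> 'v"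
    and C :: "'v \<Rightarrow> 'v"
    and v :: 'v
  defines "\<chi> \<equiv> level_one_standard_module.graded_dim scale l X v"
  assumes "2 \<le> l"
    and "level_one_standard_module scale l X C v"
    and "j \<in> {1..l}"
  shows "\<chi> r = subst_q_powers l (\<lambda>i. if i = j then 1 else 0) \<chi> r
             + times_xq j (subst_q_powers l (cartan_entry j) \<chi>) r"
proof (rule fls_eqI)
  interpret level_one_standard_module scale l X C v by fact
  fix n
  let ?r = "r(j := r j - 1)"
  have e: "(\<Sum>i = 1..l. (if i = j then 1 else 0) * int (r i)) = int (r j)"
    using \<open>j \<in> {1..l}\<close> by (simp add: if_distrib[of "\<lambda>x. x * _"] cong: if_cong)
  have s1: "fls_nth (subst_q_powers l (\<lambda>i. if i = j then 1 else 0) \<chi> r) n = fls_nth (\<chi> r) (n - int (r j))"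
    unfolding subst_q_powers_def e by (simp add: fls_X_intpow_times_conv_shift)
  have s2: "fls_nth (times_xq j (subst_q_powers l (cartan_entry j) \<chi>) r) n =
     (if r j = 0 then 0 else fls_nth (\<chi> ?r) (lower_energy l j r n))"
    by (simp add: times_xq_def subst_q_powers_def lower_energy_def fls_X_intpow_times_conv_shift fls_X_times_conv_shift algebra_simps)
  have outside: "(\<forall>i. i \<notin> {1..l} \<longrightarrow> ?r i = 0) \<longleftrightarrow> (\<forall>i. i \<notin> {1..l} \<longrightarrow> r i = 0)"
    using \<open>j \<in> {1..l}\<close> by auto
  \<comment> \<open>For \<open>r j = 0\<close> the shift of \<open>n\<close> and the second term
    both disappear. For exponents not supported in \<open>{1..l}\<close> all terms are zero, since
    \<open>?r\<close> differs from \<open>r\<close> only at \<open>j\<close>.\<close>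
  have "fls_nth (\<chi> r) n = fls_nth (\<chi> r) (n - int (r j)) + (if r j = 0 then 0 else fls_nth (\<chi> ?r) (lower_energy l j r n))"
  proof (cases "r j = 0")
    case False
    show ?thesis
    proof (cases "\<forall>i. i \<notin> {1..l} \<longrightarrow> r i = 0")
      case True
      show ?thesis unfolding \<chi>_def graded_dim_nth outside if_P[OF True]
        using L.dim_word_vectors_recursion[of j r n] \<open>j \<in> {1..l}\<close> False by simp
    next
      case False
      show ?thesis unfolding \<chi>_def graded_dim_nth outside if_not_P[OF False] by simp
    qed
  qed simp
  then show "fls_nth (\<chi> r) n = fls_nth (subst_q_powers l (\<lambda>i. if i = j then 1 else 0) \<chi> r
             + times_xq j (subst_q_powers l (cartan_entry j) \<chi>) r) n"
    by (simp add: s1 s2)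
qed

end
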